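(* Let $\varphi,\psi:[0,1]\to\mathbb R$ be continuously differentiable. Under the standing assumption and Assumption 2, with $h=h_n\to0$ and $nh_n\to\infty$, $$Z_n^T(u^* )=Z_n^{T*}(u^* )+R_n^T(u^* ),\qquad u^*\in[h,1-h],$$ where $Z_n^T(u^* )=\sqrt{nh}\,(\hat T_h(u^* )-T(u^* ))/\hat q_h(u^* )$, $Z_n^{T*}(u^* )=-\varphi(u^* )A(u^* )\mathbb G_{n,h}(u^* )$, and $\sup_{u^*\in[h,1-h]}|R_n^T(u^* )|=O_{a.s.}\big(n^{1/2}h^{3/2}+h^{1/2}+h^{-1/2}n^{-1/4}\ell(n)\big)$.
   Context: Standing assumption: $b_1,\dots,b_n$ i.i.d. bids with continuous CDF $F$, quantile function $Q=F^{-1}$ twice continuously differentiable on $[0,1]$, $q=Q'>0$ on $[0,1]$. $p_1,\dots,p_M$ fixed known nonnegative numbers, $A_1(u)=\sum_{m=1}^Mp_mu^{m-1}$ with $A_1'\ne0$ on $[0,1]$, $A=A_1/A_1'$. $v(u)=Q(u)+A(u)q(u)$. Counterfactual: $T(u^* )=\varphi(u^* )v(u^* )+\int_{u^*}^1\psi(x)v(x)\,dx$. Estimators: $b_{(i)}$ order statistics; $\hat Q(u)=b_{(\lfloor nu\rfloor+1)}$ ($u<1$), $\hat Q(1)=b_{(n)}$; $K_h(z)=h^{-1}K(z/h)$; $\hat q_h(u)=\sum_{i=1}^{n-1}K_h(u-i/n)(b_{(i+1)}-b_{(i)})$; $\hat v_h=\hat Q+A\hat q_h$; $\chi_\psi=(1-A')\psi-A\psi'$;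 $\hat S_\psi(u^* )=\int_{u^*}^1\chi_\psi(u)\hat Q(u)du-A(u^* )\psi(u^* )\hat Q(u^* )+A(1)\psi(1)\hat Q(1)$; $\hat T_h(u^* )=\varphi(u^* )\hat v_h(u^* )+\hat S_\psi(u^* )$. $\mathbb G_{n,h}(u)=\sqrt{nh}\,\frac1n\sum_{i=1}^n[K_h(u-F(b_i))-\mathbb EK_h(u-F(b_i))]$; $\ell(n)=(\log n)^{1/2}(\log\log n)^{1/4}$. Assumption 2: $K$ nonnegative, $\int K=1$, $\int K^2<\infty$, Lipschitz, supported on $[-1,1]$. $X_n=O_{a.s.}(r_n)$ means $|X_n|\le Cr_n$ for all large $n$ with $C$ an a.s. finite random variable. *)

theory Defs
  imports "HOL-Probability.Probability"
begin

text \<open>Order statistics b_(1) <= ... <= b_(n) of the sample x 1, ..., x n (1-indexed).\<close>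
definition order_stat :: "(nat \<Rightarrow> real) \<Rightarrow> nat \<Rightarrow> nat \<Rightarrow> real" where
  "order_stat x n i = sort (map x [1..<n+1]) ! (i - 1)"

definition Qhat :: "(nat \<Rightarrow> real) \<Rightarrow> nat \<Rightarrow> real \<Rightarrow> real" where
  "Qhat x n u = (if u < 1 then order_stat x n (nat \<lfloor>real n * u\<rfloor> + 1) else order_stat x n n)"

definition Kh :: "(real \<Rightarrow> real) \<Rightarrow> real \<Rightarrow> real \<Rightarrow> real" where
  "Kh K h z = K (z / h) / h"

definition qhat :: "(real \<Rightarrow> real) \<Rightarrow> real \<Rightarrow> (nat \<Rightarrow> real) \<Rightarrow> nat \<Rightarrow> real \<Rightarrow> real" where
  "qhat K h x n u = (\<Sum>i = 1..n - 1. Kh K h (u - real i / real n) * (order_stat x n (i + 1) - order_stat x n i))"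

definition A1 :: "(nat \<Rightarrow> real) \<Rightarrow> nat \<Rightarrow> real \<Rightarrow> real" where
  "A1 p M u = (\<Sum>m = 1..M. p m * u ^ (m - 1))"

definition Afun :: "(nat \<Rightarrow> real) \<Rightarrow> nat \<Rightarrow> real \<Rightarrow> real" where
  "Afun p M u = A1 p M u / deriv (A1 p M) u"

definition vfun :: "(real \<Rightarrow> real) \<Rightarrow> (real \<Rightarrow> real) \<Rightarrow> (real \<Rightarrow> real) \<Rightarrow> real \<Rightarrow> real" where
  "vfun A Q q u = Q u + A u * q u"

definition Tfun :: "(real \<Rightarrow> real) \<Rightarrow> (real \<Rightarrow> real) \<Rightarrow> (real \<Rightarrow> real) \<Rightarrow> real \<Rightarrow> real" where
  "Tfun \<phi> \<psi> v us = \<phi> us * v us + integral {us..1} (\<lambda>x. \<psi> x * v x)"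

definition vhat :: "(real \<Rightarrow> real) \<Rightarrow> (real \<Rightarrow> real) \<Rightarrow> real \<Rightarrow> (nat \<Rightarrow> real) \<Rightarrow> nat \<Rightarrow> real \<Rightarrow> real" where
  "vhat A K h x n u = Qhat x n u + A u * qhat K h x n u"

text \<open>chi_psi = (1 - A') psi - A psi', with psi' the derivative of psi on [0,1].\<close>
definition chi :: "(real \<Rightarrow> real) \<Rightarrow> (real \<Rightarrow> real) \<Rightarrow> (real \<Rightarrow> real) \<Rightarrow> real \<Rightarrow> real" where
  "chi A \<psi> \<psi>' u = (1 - deriv A u) * \<psi> u - A u * \<psi>' u"

definition Shat :: "(real \<Rightarrow> real) \<Rightarrow> (real \<Rightarrow> real) \<Rightarrow> (real \<Rightarrow> real) \<Rightarrow> (nat \<Rightarrow> real) \<Rightarrow> nat \<Rightarrow> real \<Rightarrow> real" where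
  "Shat A \<psi> \<psi>' x n us =
     integral {us..1} (\<lambda>u. chi A \<psi> \<psi>' u * Qhat x n u)
     - A us * \<psi> us * Qhat x n us + A 1 * \<psi> 1 * Qhat x n 1"

definition That :: "(real \<Rightarrow> real) \<Rightarrow> (real \<Rightarrow> real) \<Rightarrow> (real \<Rightarrow> real) \<Rightarrow> (real \<Rightarrow> real) \<Rightarrow> (real \<Rightarrow> real)
                    \<Rightarrow> real \<Rightarrow> (nat \<Rightarrow> real) \<Rightarrow> nat \<Rightarrow> real \<Rightarrow> real" where
  "That A \<phi> \<psi> \<psi>' K h x n us = \<phi> us * vhat A K h x n us + Shat A \<psi> \<psi>' x n us"

definition Gnh :: "'a measure \<Rightarrow> (nat \<Rightarrow> 'a \<Rightarrow> real) \<Rightarrow> (real \<Rightarrow> real) \<Rightarrow> (real \<Rightarrow> real) \<Rightarrow> nat \<Rightarrow> real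
                   \<Rightarrow> 'a \<Rightarrow> real \<Rightarrow> real" where
  "Gnh M b F K n h \<omega> u = sqrt (real n * h) * (1 / real n) *
     (\<Sum>i = 1..n. Kh K h (u - F (b i \<omega>)) - integral\<^sup>L M (\<lambda>\<omega>'. Kh K h (u - F (b i \<omega>'))))"

definition ell :: "nat \<Rightarrow> real" where
  "ell n = sqrt (ln (real n)) * (ln (ln (real n))) powr (1/4)"

end

theory Submission
  imports Defs "HOL-Real_Asymp.Real_Asymp"
begin

text \<open>
  Put \<open>U\<^sub>i = F (b\<^sub>i)\<close>, a uniform sample with \<open>b\<^sub>i = Q (U\<^sub>i)\<close>, and let \<open>\<gamma>\<close> be the centred kernel density of the \<open>U\<^sub>i\<close>
  at \<open>u\<^sup>*\<close>, so that the leading term is built from \<open>sqrt (n h) \<gamma>\<close>. Summation by parts shows that the spacing estimator \<open>g\<close>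
  computed from the \<open>U\<^sub>i\<close> satisfies \<open>g - 1 = - \<gamma>\<close> up to \<open>O(1/h)\<close> times the Bahadur--Kiefer remainder, which is an
  oscillation of the empirical process over a distance given by its own supremum. That supremum is bounded by the law of the
  iterated logarithm (dyadic chaining and a maximal exponential inequality over the blocks \<open>4 ^ (k - 1) < n \<le> 4 ^ k\<close>), the
  oscillation by Bernstein's inequality on a grid; together they give \<open>n powr (-3/4) * ell n\<close>. The estimate of \<open>q\<close> is \<open>q g\<close> up
  to a relative error of order \<open>h\<close> plus the supremum, and the terms involving \<open>Qhat\<close> undifferentiated are of the order of
  the supremum.

  Nothing prevents \<open>n h\<close> from growing more slowly than \<open>ln n\<close>, where the estimate of \<open>q\<close> is no longer bounded away from zero. A
  lower bound for sums of consecutive spacings shows that it still exceeds a multiple of \<open>n powr (-1/8)\<close>, which suffices because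
  the claimed rate is then at least of order \<open>n powr (1/4)\<close> up to logarithms.
\<close>


subsection \<open>Stieltjes sums against Lipschitz functions\<close>

text \<open>Six almost sure statements carry all the randomness: the uniform sample lies in (0, 1],
  the bids are its image under \<open>Q\<close>, one bound for the supremum, two for oscillations,
  one for spacings. Everything else is a deterministic inequality valid for every \<open>us\<close>
  at once, so uniformity in \<open>us\<close> costs nothing and the final constant does not depend
  on the sample point. The obstacle is the random denominator. Dividing by the estimate
  \<open>qh\<close> instead of \<open>q\<close> leaves a product of two kernel deviations, each of
  order sqrt(ln n / (n h)); scaled by sqrt(n h) it is of order ln n / sqrt(n h), which the third
  summand of the rate dominates for large n. Two oscillation scales are needed: distance about h for
  the kernel deviation itself, and distance about sqrt(ln ln n / n) for the Bahadur--Kiefer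
  remainder. Multiplied by sqrt(n h) / h, the second bound becomes a multiple of the third summand
  of the rate. When n h < ln n no cancellation is sought: error and leading term are bounded
  separately.\<close>

lemma abel_sum_bound:
  fixes \<kappa> W :: "nat \<Rightarrow> real"
  assumes "\<kappa> 0 = 0" "\<kappa> N = 0"
    and W: "\<And>j. j < N \<Longrightarrow> \<bar>W j\<bar> \<le> B"
    and k: "\<And>j. j < N \<Longrightarrow> \<bar>\<kappa> (Suc j) - \<kappa> j\<bar> \<le> d"
  shows "\<bar>\<Sum>j<N. \<kappa> (Suc j) * (W (Suc j) - W j)\<bar> \<le> real N * (B * d)"
proof -
  have "(\<Sum>j<N. \<kappa> (Suc j) * (W (Suc j) - W j)) + (\<Sum>j<N. W j * (\<kappa> (Suc j) - \<kappa> j)) = \<kappa> N * W N - \<kappa> 0 * W 0"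
    by (induction N) (auto simp: algebra_simps)
  hence "(\<Sum>j<N. \<kappa> (Suc j) * (W (Suc j) - W j)) = - (\<Sum>j<N. W j * (\<kappa> (Suc j) - \<kappa> j))"
    using assms by simp
  moreover have "\<bar>\<Sum>j<N. W j * (\<kappa> (Suc j) - \<kappa> j)\<bar> \<le> (\<Sum>j<N. B * d)"
  proof (rule order_trans[OF sum_abs], rule sum_mono)
    fix j assume "j \<in> {..<N}"
    hence "\<bar>W j\<bar> \<le> B" "\<bar>\<kappa> (Suc j) - \<kappa> j\<bar> \<le> d" using W k by auto
    thus "\<bar>W j * (\<kappa> (Suc j) - \<kappa> j)\<bar> \<le> B * d"
      unfolding abs_mult by (intro mult_mono) auto
  qed
  ultimately show ?thesis by simp
qed

text \<open>The indicator differences vanish except for the one cell (y i, y (i + 1)] that contains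
  z, so the sum collapses to the value of \<open>\<kappa>\<close> at the right end of that cell, at
  most one mesh width from z. For z outside (a, b] both terms are zero.\<close>

lemma stieltjes_sum_approx:
  fixes \<kappa> :: "real \<Rightarrow> real"
  assumes ab: "a < b" and N: "N > 0"
    and lip: "\<And>x y. \<bar>\<kappa> x - \<kappa> y\<bar> \<le> L * \<bar>x - y\<bar>"
    and supp: "\<And>x. x \<le> a \<or> b \<le> x \<Longrightarrow> \<kappa> x = 0"
  defines "y \<equiv> (\<lambda>j. a + real j * ((b - a) / real N))"
  shows "\<bar>\<kappa> z - (\<Sum>j<N. \<kappa> (y (Suc j)) * ((if z \<le> y (Suc j) then 1 else 0) - (if z \<le> y j then 1 else 0)))\<bar>
          \<le> L * ((b - a) / real N)"
proof -
  define \<delta> where "\<delta> = (b - a) / real N"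
  have d: "\<delta> > 0" using ab N by (simp add: \<delta>_def)
  have y: "y j = a + real j * \<delta>" for j by (simp add: y_def \<delta>_def)
  have L: "L \<ge> 0" using lip[of 0 1] by simp
  have yN: "y N = b" using N by (simp add: y_def)
  have mono: "y i < y j \<longleftrightarrow> i < j" for i j using d by (simp add: y)
  show ?thesis
  proof (cases "a < z \<and> z \<le> b")
    case False
    have "(\<Sum>j<N. \<kappa> (y (Suc j)) * ((if z \<le> y (Suc j) then 1 else 0) - (if z \<le> y j then 1 else 0))) = 0"
    proof (rule sum.neutral, safe)
      fix j assume j: "j < N"
      have "z \<le> a \<or> z > b" using False by auto
      moreover have "a \<le> y j" "y j \<le> y (Suc j)" using d by (auto simp: y algebra_simps)
      moreover have "y (Suc j) \<le> b" using j mono[of "Suc j" N] yN by (cases "Suc j = N") auto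
      ultimately show "\<kappa> (y (Suc j)) * ((if z \<le> y (Suc j) then 1 else 0) - (if z \<le> y j then 1 else 0)) = 0"
        by auto
    qed
    moreover have "\<kappa> z = 0" using False supp by force
    moreover have "0 \<le> L * \<delta>" using L d by simp
    ultimately show ?thesis by (simp add: \<delta>_def)
  next
    case True
    define i where "i = nat (\<lceil>(z - a) / \<delta>\<rceil>) - 1"
    have pos: "(z - a) / \<delta> > 0" using True d by simp
    hence c1: "\<lceil>(z - a) / \<delta>\<rceil> \<ge> 1" by simp
    hence i: "int i = \<lceil>(z - a) / \<delta>\<rceil> - 1" unfolding i_def by linarith
    hence "real i < (z - a) / \<delta>" "(z - a) / \<delta> \<le> real i + 1" by linarith+
    hence iz: "y i < z" "z \<le> y (Suc i)" using d by (auto simp: y field_simps)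
    have "(z - a) / \<delta> \<le> real N" using True d N by (simp add: field_simps \<delta>_def)
    hence iN: "i < N" using i by linarith
    have eq: "((if z \<le> y (Suc j) then 1 else 0) - (if z \<le> y j then 1 else 0)) = (if j = i then 1 else (0::real))" for j
    proof -
      have "z \<le> y j \<longleftrightarrow> i < j"
      proof
        assume "z \<le> y j" thus "i < j" using iz mono[of i j] by linarith
      next
        assume "i < j" hence "y (Suc i) \<le> y j" using mono[of "Suc i" j] by (cases "Suc i = j") auto
        thus "z \<le> y j" using iz by linarith
      qed
      moreover have "z \<le> y (Suc j) \<longleftrightarrow> i \<le> j"
      proof
        assume "z \<le> y (Suc j)" thus "i \<le> j" using iz mono[of i "Suc j"] by linarith
      next
        assume "i \<le> j" hence "y (Suc i) \<le> y (Suc j)" using mono[of "Suc i" "Suc j"] by (cases "i = j") auto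
        thus "z \<le> y (Suc j)" using iz by linarith
      qed
      ultimately show ?thesis by auto
    qed
    have "(\<Sum>j<N. \<kappa> (y (Suc j)) * ((if z \<le> y (Suc j) then 1 else 0) - (if z \<le> y j then 1 else 0))) = \<kappa> (y (Suc i))"
      unfolding eq using iN by (subst sum.remove[of _ i]) auto
    moreover have "\<bar>\<kappa> z - \<kappa> (y (Suc i))\<bar> \<le> L * \<bar>z - y (Suc i)\<bar>" by (rule lip)
    moreover have "\<bar>z - y (Suc i)\<bar> \<le> \<delta>" using iz by (simp add: y algebra_simps)
    hence "L * \<bar>z - y (Suc i)\<bar> \<le> L * \<delta>" using L by (intro mult_left_mono)
    ultimately show ?thesis by (simp add: \<delta>_def)
  qed
qed

lemma riemann_sum_approx:
  fixes \<kappa> :: "real \<Rightarrow> real"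
  assumes ab: "a < b" and N: "N > 0"
    and lip: "\<And>x y. \<bar>\<kappa> x - \<kappa> y\<bar> \<le> L * \<bar>x - y\<bar>"
  defines "y \<equiv> (\<lambda>j. a + real j * ((b - a) / real N))"
  shows "\<bar>integral {a..b} \<kappa> - (\<Sum>j<N. \<kappa> (y (Suc j)) * (y (Suc j) - y j))\<bar> \<le> L * (b - a) * ((b - a) / real N)"
proof -
  define \<delta> where "\<delta> = (b - a) / real N"
  have d: "\<delta> > 0" using ab N by (simp add: \<delta>_def)
  have y: "y j = a + real j * \<delta>" for j by (simp add: y_def \<delta>_def)
  have L: "L \<ge> 0" using lip[of 0 1] by simp
  have yN: "y N = b" using N by (simp add: y_def)
  have "L-lipschitz_on UNIV \<kappa>" using L lip by (auto simp: lipschitz_on_def dist_real_def)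
  hence cont: "continuous_on S \<kappa>" for S
    using lipschitz_on_continuous_on continuous_on_subset by blast
  have int: "\<kappa> integrable_on {c..e}" for c e by (intro integrable_continuous_interval cont)
  have "\<bar>integral {y 0..y m} \<kappa> - (\<Sum>j<m. \<kappa> (y (Suc j)) * (y (Suc j) - y j))\<bar> \<le> real m * (L * \<delta> * \<delta>)" for m
  proof (induction m)
    case 0 show ?case by simp
  next
    case (Suc m)
    have le: "y 0 \<le> y m" "y m \<le> y (Suc m)" using d by (auto simp: y algebra_simps)
    have 1: "integral {y 0..y (Suc m)} \<kappa> = integral {y 0..y m} \<kappa> + integral {y m..y (Suc m)} \<kappa>"
      using Henstock_Kurzweil_Integration.integral_combine[OF le int] by simp
    have dy: "y (Suc m) - y m = \<delta>" by (simp add: y algebra_simps)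
    have "integral {y m..y (Suc m)} \<kappa> - \<kappa> (y (Suc m)) * (y (Suc m) - y m)
        = integral {y m..y (Suc m)} (\<lambda>x. \<kappa> x - \<kappa> (y (Suc m)))"
      using le by (subst integral_diff[OF int]) (auto simp: mult.commute)
    moreover have "norm (integral {y m..y (Suc m)} (\<lambda>x. \<kappa> x - \<kappa> (y (Suc m)))) \<le> L * \<delta> * (y (Suc m) - y m)"
    proof (rule integral_bound[OF le(2)])
      show "continuous_on {y m..y (Suc m)} (\<lambda>x. \<kappa> x - \<kappa> (y (Suc m)))" by (intro continuous_intros cont)
      fix t assume t: "t \<in> {y m..y (Suc m)}"
      have "\<bar>\<kappa> t - \<kappa> (y (Suc m))\<bar> \<le> L * \<bar>t - y (Suc m)\<bar>" by (rule lip)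
      also have "\<dots> \<le> L * \<delta>" using t dy L by (intro mult_left_mono) auto
      finally show "norm (\<kappa> t - \<kappa> (y (Suc m))) \<le> L * \<delta>" by simp
    qed
    ultimately have "\<bar>integral {y m..y (Suc m)} \<kappa> - \<kappa> (y (Suc m)) * (y (Suc m) - y m)\<bar> \<le> L * \<delta> * \<delta>"
      using dy by simp
    thus ?case using Suc 1 by (simp add: algebra_simps)
  qed
  from this[of N] have "\<bar>integral {a..b} \<kappa> - (\<Sum>j<N. \<kappa> (y (Suc j)) * (y (Suc j) - y j))\<bar> \<le> real N * (L * \<delta> * \<delta>)"
    using yN by (simp add: y_def)
  also have "real N * (L * \<delta> * \<delta>) = L * (b - a) * ((b - a) / real N)"
    using N by (simp add: \<delta>_def field_simps)
  finally show ?thesis .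
qed

text \<open>A Lipschitz function need not be differentiable everywhere, so integration by parts is replaced by
  summation by parts on an equidistant grid, whose mesh then tends to zero.\<close>

lemma stieltjes_by_parts_bound:
  fixes \<kappa> :: "real \<Rightarrow> real" and c x :: "'i \<Rightarrow> real"
  assumes ab: "a < b" and fin: "finite I"
    and lip: "\<And>x y. \<bar>\<kappa> x - \<kappa> y\<bar> \<le> L * \<bar>x - y\<bar>"
    and supp: "\<And>x. x \<le> a \<or> b \<le> x \<Longrightarrow> \<kappa> x = 0"
    and W: "\<And>t. a \<le> t \<Longrightarrow> t < b \<Longrightarrow> \<bar>(\<Sum>k\<in>I. c k * (if x k \<le> t then 1 else 0)) - r * t - w\<bar> \<le> B"
  shows "\<bar>(\<Sum>k\<in>I. c k * \<kappa> (x k)) - r * integral {a..b} \<kappa>\<bar> \<le> B * L * (b - a)"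
proof -
  have L: "L \<ge> 0" using lip[of 0 1] by simp
  define E where "E = (\<Sum>k\<in>I. \<bar>c k\<bar>) * (L * (b - a)) + \<bar>r\<bar> * (L * (b - a) * (b - a))"
  have main: "\<bar>(\<Sum>k\<in>I. c k * \<kappa> (x k)) - r * integral {a..b} \<kappa>\<bar> \<le> B * L * (b - a) + E / real N"
    if N: "N > 0" for N
  proof -
    define y where "y = (\<lambda>j. a + real j * ((b - a) / real N))"
    define Wf where "Wf = (\<lambda>t. (\<Sum>k\<in>I. c k * (if x k \<le> t then 1 else 0)) - r * t - w)"
    define st where "st = (\<lambda>k. \<Sum>j<N. \<kappa> (y (Suc j)) * ((if x k \<le> y (Suc j) then 1 else 0) - (if x k \<le> y j then 1 else 0)))"
    define rs where "rs = (\<Sum>j<N. \<kappa> (y (Suc j)) * (y (Suc j) - y j))"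
    have tri: "\<bar>s1 - j1\<bar> \<le> e1 + (e2 + e3)" if "\<bar>p1\<bar> \<le> e1" "p1 = s2 - r1" "\<bar>s1 - s2\<bar> \<le> e2" "\<bar>j1 - r1\<bar> \<le> e3"
      for p1 s1 s2 j1 r1 e1 e2 e3 :: real using that by linarith
    have bnd: "\<bar>\<Sum>j<N. \<kappa> (y (Suc j)) * (Wf (y (Suc j)) - Wf (y j))\<bar> \<le> real N * (B * (L * ((b - a) / real N)))"
    proof (rule abel_sum_bound[where \<kappa> = "\<lambda>j. \<kappa> (y j)" and W = "\<lambda>j. Wf (y j)"])
      show "\<kappa> (y 0) = 0" "\<kappa> (y N) = 0" using supp N by (auto simp: y_def)
      fix j assume j: "j < N"
      have "(b - a) * real j < (b - a) * real N" using j ab by simp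
      hence "y j < b" using ab N by (auto simp: y_def field_simps)
      moreover have "a \<le> y j" using ab by (simp add: y_def)
      ultimately show "\<bar>Wf (y j)\<bar> \<le> B" using W unfolding Wf_def by auto
      have "\<bar>\<kappa> (y (Suc j)) - \<kappa> (y j)\<bar> \<le> L * \<bar>y (Suc j) - y j\<bar>" by (rule lip)
      also have "y (Suc j) - y j = (b - a) / real N" by (simp add: y_def distrib_right add_divide_distrib)
      finally show "\<bar>\<kappa> (y (Suc j)) - \<kappa> (y j)\<bar> \<le> L * ((b - a) / real N)" using ab by simp
    qed
    \<comment> \<open>\<open>w\<close> cancels because only increments of \<open>Wf\<close> enter.
      So the step function may be recentred at any point, and its local oscillation suffices instead
      of its supremum.\<close>
    have eq: "(\<Sum>j<N. \<kappa> (y (Suc j)) * (Wf (y (Suc j)) - Wf (y j))) = (\<Sum>k\<in>I. c k * st k) - r * rs"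
    proof -
      define \<iota> :: "'i \<Rightarrow> real \<Rightarrow> real" where "\<iota> = (\<lambda>k t. if x k \<le> t then 1 else 0)"
      have st: "st k = (\<Sum>j<N. \<kappa> (y (Suc j)) * (\<iota> k (y (Suc j)) - \<iota> k (y j)))" for k
        by (simp only: st_def \<iota>_def)
      have Wf: "Wf t = (\<Sum>k\<in>I. c k * \<iota> k t) - r * t - w" for t
        by (simp only: Wf_def \<iota>_def)
      have "(\<Sum>k\<in>I. c k * st k) = (\<Sum>j<N. \<Sum>k\<in>I. c k * (\<kappa> (y (Suc j)) * (\<iota> k (y (Suc j)) - \<iota> k (y j))))"
        unfolding st sum_distrib_left by (rule sum.swap)
      also have "\<dots> = (\<Sum>j<N. \<kappa> (y (Suc j)) * ((\<Sum>k\<in>I. c k * \<iota> k (y (Suc j))) - (\<Sum>k\<in>I. c k * \<iota> k (y j))))"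
        unfolding sum_subtractf[symmetric] sum_distrib_left
        by (intro sum.cong refl) (simp add: algebra_simps)
      finally have "(\<Sum>k\<in>I. c k * st k) - r * rs
          = (\<Sum>j<N. \<kappa> (y (Suc j)) * ((\<Sum>k\<in>I. c k * \<iota> k (y (Suc j))) - (\<Sum>k\<in>I. c k * \<iota> k (y j)))
                - r * (\<kappa> (y (Suc j)) * (y (Suc j) - y j)))"
        unfolding rs_def sum_distrib_left[of r] by (simp only: sum_subtractf)
      also have "\<dots> = (\<Sum>j<N. \<kappa> (y (Suc j)) * (Wf (y (Suc j)) - Wf (y j)))"
        unfolding Wf by (intro sum.cong refl) (simp add: algebra_simps)
      finally show ?thesis by (rule sym)
    qed
    have e2: "\<bar>(\<Sum>k\<in>I. c k * \<kappa> (x k)) - (\<Sum>k\<in>I. c k * st k)\<bar> \<le> (\<Sum>k\<in>I. \<bar>c k\<bar> * (L * ((b - a) / real N)))"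
      unfolding sum_subtractf[symmetric]
    proof (rule order_trans[OF sum_abs], rule sum_mono)
      fix k
      have "\<bar>\<kappa> (x k) - st k\<bar> \<le> L * ((b - a) / real N)"
        unfolding st_def y_def using stieltjes_sum_approx[OF ab N lip supp] .
      thus "\<bar>c k * \<kappa> (x k) - c k * st k\<bar> \<le> \<bar>c k\<bar> * (L * ((b - a) / real N))"
        unfolding right_diff_distrib[symmetric] abs_mult by (intro mult_left_mono) auto
    qed
    have e3: "\<bar>r * integral {a..b} \<kappa> - r * rs\<bar> \<le> \<bar>r\<bar> * (L * (b - a) * ((b - a) / real N))"
      unfolding right_diff_distrib[symmetric] abs_mult rs_def y_def
      using riemann_sum_approx[OF ab N lip] by (intro mult_left_mono) auto
    have E: "E / real N = (\<Sum>k\<in>I. \<bar>c k\<bar> * (L * ((b - a) / real N))) + \<bar>r\<bar> * (L * (b - a) * ((b - a) / real N))"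
      unfolding sum_distrib_right[symmetric] E_def add_divide_distrib by simp
    have e1: "real N * (B * (L * ((b - a) / real N))) = B * L * (b - a)" using N by simp
    show ?thesis using tri[OF bnd eq e2 e3] unfolding E e1 .
  qed
  have "(\<lambda>N. B * L * (b - a) + E / real N) \<longlonglongrightarrow> B * L * (b - a) + 0"
    by (intro tendsto_add tendsto_const lim_const_over_n)
  moreover have "eventually (\<lambda>N. \<bar>(\<Sum>k\<in>I. c k * \<kappa> (x k)) - r * integral {a..b} \<kappa>\<bar> \<le> B * L * (b - a) + E / real N) sequentially"
    using main by (intro eventually_sequentiallyI[of 1]) auto
  ultimately have "\<bar>(\<Sum>k\<in>I. c k * \<kappa> (x k)) - r * integral {a..b} \<kappa>\<bar> \<le> B * L * (b - a) + 0"
    by (rule tendsto_lowerbound) simp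
  thus ?thesis by simp
qed

subsection \<open>Order statistics and the empirical distribution function\<close>

lemma length_filter_map_upt:
  "length (filter P (map x [1..<n+1])) = card {i \<in> {1..n}. P (x i)}"
proof -
  have "length (filter P (map x [1..<n+1])) = length (filter (\<lambda>i. P (x i)) [1..<n+1])"
    by (simp add: filter_map comp_def)
  also have "\<dots> = card (set (filter (\<lambda>i. P (x i)) [1..<n+1]))"
    by (rule distinct_card[symmetric]) simp
  also have "set (filter (\<lambda>i. P (x i)) [1..<n+1]) = {i \<in> {1..n}. P (x i)}" by auto
  finally show ?thesis .
qed

lemma length_filter_sort: "length (filter P (sort xs)) = length (filter P xs)"
  by (metis mset_filter mset_sort size_mset)

lemma order_stat_mono:
  assumes "i \<le> j" "j \<le> n" "1 \<le> n"
  shows "order_stat x n i \<le> order_stat x n j"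
  unfolding order_stat_def using assms by (intro sorted_nth_mono) auto

lemma order_stat_eq_sample:
  assumes "1 \<le> i" "i \<le> n"
  shows "\<exists>j\<in>{1..n}. order_stat x n i = x j"
proof -
  have "order_stat x n i \<in> set (sort (map x [1..<n+1]))"
    unfolding order_stat_def using assms by (intro nth_mem) simp
  thus ?thesis by auto
qed

lemma order_stat_comp_mono:
  assumes "mono f" "1 \<le> i" "i \<le> n"
  shows "order_stat (\<lambda>j. f (x j)) n i = f (order_stat x n i)"
proof -
  have "sort (map (\<lambda>j. f (x j)) [1..<n+1]) = map f (sort (map x [1..<n+1]))"
  proof (rule properties_for_sort)
    have "mset (map f (sort (map x [1..<n+1]))) = image_mset f (mset (map x [1..<n+1]))"
      by (simp only: mset_map mset_sort)
    also have "\<dots> = mset (map (\<lambda>j. f (x j)) [1..<n+1])"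
      by (simp only: mset_map image_mset.compositionality comp_def)
    finally show "mset (map f (sort (map x [1..<n+1]))) = mset (map (\<lambda>j. f (x j)) [1..<n+1])" .
    have "sorted (sort (map x [1..<n+1]))" by simp
    thus "sorted (map f (sort (map x [1..<n+1])))"
      unfolding sorted_map
      by (rule sorted_wrt_mono_rel[rotated]) (use \<open>mono f\<close> in \<open>auto dest: monoD\<close>)
  qed
  thus ?thesis unfolding order_stat_def using assms by simp
qed

text \<open>With its strict counterpart \<open>card_less_order_stat\<close> this replaces the
  inverse relation between the empirical distribution function and the order statistics. Both allow
  ties, so distinctness of the sample never has to be proved and the bounds on \<open>Qhat\<close>
  carry no correction of size 1/n.\<close>

lemma card_le_order_stat:
  assumes "1 \<le> k" "k \<le> n"
  shows "k \<le> card {i \<in> {1..n}. x i \<le> order_stat x n k}"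
proof -
  define ys where "ys = sort (map x [1..<n+1])"
  have len: "length ys = n" by (simp add: ys_def)
  have "k = length (take k ys)" using assms len by simp
  also have "take k ys = filter (\<lambda>y. y \<le> order_stat x n k) (take k ys)"
  proof (rule sym, rule filter_True, rule ballI)
    fix y assume "y \<in> set (take k ys)"
    then obtain j where "j < k" "y = ys ! j" using len assms by (auto simp: in_set_conv_nth)
    thus "y \<le> order_stat x n k"
      unfolding order_stat_def ys_def[symmetric] using len assms
      by (simp, intro sorted_nth_mono) (auto simp: ys_def)
  qed
  also have "length \<dots> \<le> length (filter (\<lambda>y. y \<le> order_stat x n k) ys)"
    by (metis append_take_drop_id filter_append le_add1 length_append)
  also have "\<dots> = card {i \<in> {1..n}. x i \<le> order_stat x n k}"
    unfolding ys_def length_filter_sort length_filter_map_upt ..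
  finally show ?thesis .
qed

lemma card_less_order_stat:
  assumes "1 \<le> k" "k \<le> n"
  shows "card {i \<in> {1..n}. x i < order_stat x n k} < k"
proof -
  define ys where "ys = sort (map x [1..<n+1])"
  have len: "length ys = n" by (simp add: ys_def)
  let ?P = "\<lambda>y. y < order_stat x n k"
  have "filter ?P (drop (k - 1) ys) = []"
  proof (rule filter_False, rule ballI)
    fix y assume "y \<in> set (drop (k - 1) ys)"
    then obtain j where j: "j < length (drop (k - 1) ys)" "y = drop (k - 1) ys ! j"
      unfolding in_set_conv_nth by blast
    hence "j + (k - 1) < n" "y = ys ! (k - 1 + j)" using len assms by auto
    thus "\<not> ?P y"
      unfolding order_stat_def ys_def[symmetric] using len assms
      by (simp add: not_less, intro sorted_nth_mono) (auto simp: ys_def)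
  qed
  hence "length (filter ?P ys) \<le> length (take (k - 1) ys)"
    by (metis append_take_drop_id append_Nil2 filter_append length_filter_le)
  also have "\<dots> < k" using assms len by simp
  finally show ?thesis unfolding ys_def length_filter_sort length_filter_map_upt .
qed

section \<open>Inversion of the empirical distribution function\<close>

definition ecdf :: "(nat \<Rightarrow> real) \<Rightarrow> nat \<Rightarrow> real \<Rightarrow> real" where
  "ecdf x n t = real (card {i \<in> {1..n}. x i \<le> t}) / real n"

lemma ecdf_mono: "s \<le> t \<Longrightarrow> ecdf x n s \<le> ecdf x n t"
  unfolding ecdf_def by (intro divide_right_mono of_nat_mono card_mono) auto

lemma ecdf_eq_sum: "ecdf x n t = (\<Sum>i = 1..n. 1 / real n * (if x i \<le> t then 1 else 0))"
proof -
  have "(\<Sum>i = 1..n. 1 / real n * (if x i \<le> t then 1 else 0)) = (\<Sum>i \<in> {i \<in> {1..n}. x i \<le> t}. 1 / real n)"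
    by (subst sum.inter_filter) (auto intro!: sum.cong)
  thus ?thesis by (simp add: ecdf_def)
qed

lemma floor_index:
  assumes "0 \<le> u" "u < 1" "1 \<le> n"
  defines "k \<equiv> nat \<lfloor>real n * u\<rfloor> + 1"
  shows "1 \<le> k" "k \<le> n" "real n * u < real k" "real k - 1 \<le> real n * u"
proof -
  have "real n * u < real n" using assms by simp
  hence "\<lfloor>real n * u\<rfloor> < int n" by (simp add: floor_less_iff)
  moreover have "0 \<le> \<lfloor>real n * u\<rfloor>" using assms by simp
  ultimately show "1 \<le> k" "k \<le> n" "real n * u < real k" "real k - 1 \<le> real n * u" unfolding k_def by linarith+
qed

text \<open>At t = Qhat the empirical distribution function is at least u, and at every s < t it is
  at most u. Each fact, compared with the identity up to D, gives one inequality.\<close>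

lemma Qhat_near_argument:
  fixes U :: "nat \<Rightarrow> real"
  assumes n: "1 \<le> n" and U: "\<And>i. 1 \<le> i \<Longrightarrow> 0 < U i \<and> U i \<le> 1" and u: "0 \<le> u" "u \<le> 1"
    and D: "\<And>t. 0 \<le> t \<Longrightarrow> t \<le> 1 \<Longrightarrow> \<bar>ecdf U n t - t\<bar> \<le> D"
  shows "\<bar>Qhat U n u - u\<bar> \<le> D"
proof -
  define k where "k = (if u < 1 then nat \<lfloor>real n * u\<rfloor> + 1 else n)"
  have k: "1 \<le> k" "k \<le> n" "real n * u \<le> real k" "real k - 1 \<le> real n * u"
    using floor_index[of u n] u n unfolding k_def by (auto simp: not_less)
  define t where "t = order_stat U n k"
  have Q: "Qhat U n u = t" by (simp add: Qhat_def t_def k_def)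
  obtain j where "t = U j" "1 \<le> j" using order_stat_eq_sample[OF k(1,2), of U] by (auto simp: t_def)
  hence t: "0 < t" "t \<le> 1" using U by auto
  have "real k \<le> real n * ecdf U n t"
    using card_le_order_stat[OF k(1,2), of U] n by (simp add: ecdf_def t_def)
  hence "real n * u \<le> real n * ecdf U n t" using k by linarith
  hence "u \<le> ecdf U n t" using n by simp
  hence lo: "u - D \<le> t" using D[of t] t by simp
  \<comment> \<open>At t itself the empirical distribution function may jump above u, so the
    estimate is made at points s < t and passed to the limit.\<close>
  have "s \<le> u + D" if s: "0 < s" "s < t" for s
  proof -
    have "card {i \<in> {1..n}. U i \<le> s} \<le> card {i \<in> {1..n}. U i < t}" using s by (intro card_mono) auto
    also have "\<dots> < k" using card_less_order_stat[OF k(1,2), of U] by (simp add: t_def)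
    finally have "real (card {i \<in> {1..n}. U i \<le> s}) \<le> real n * u" using k by linarith
    hence "ecdf U n s \<le> u" using n by (simp add: ecdf_def field_simps)
    thus ?thesis using D[of s] s t by simp
  qed
  hence "t \<le> u + D" using dense_le_bounded[of 0 t "u + D"] t by simp
  thus ?thesis using lo Q by simp
qed

text \<open>The empirical distribution function crosses the level \<open>u\<close> at \<open>t = Qhat U n u\<close>, so the Bahadur--Kiefer
  remainder is an increment of \<open>ecdf U n - id\<close> between \<open>u\<close> and \<open>t\<close>.\<close>

lemma bahadur_kiefer_le_oscillation:
  fixes U :: "nat \<Rightarrow> real"
  assumes n: "1 \<le> n" and U: "\<And>i. 1 \<le> i \<Longrightarrow> 0 < U i \<and> U i \<le> 1" and u: "0 \<le> u" "u < 1"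
    and D: "\<And>t. 0 \<le> t \<Longrightarrow> t \<le> 1 \<Longrightarrow> \<bar>ecdf U n t - t\<bar> \<le> D" and "D < a"
    and osc: "\<And>s t. 0 \<le> s \<Longrightarrow> s \<le> 1 \<Longrightarrow> 0 \<le> t \<Longrightarrow> t \<le> 1 \<Longrightarrow> \<bar>s - t\<bar> \<le> a \<Longrightarrow>
                \<bar>(ecdf U n s - s) - (ecdf U n t - t)\<bar> \<le> B"
  shows "\<bar>Qhat U n u + ecdf U n u - 2 * u\<bar> \<le> B"
proof -
  define k where "k = nat \<lfloor>real n * u\<rfloor> + 1"
  have k: "1 \<le> k" "k \<le> n" "real n * u < real k" "real k - 1 \<le> real n * u"
    using floor_index[OF u n] unfolding k_def by auto
  define t where "t = order_stat U n k"
  have Q: "Qhat U n u = t" using u by (simp add: Qhat_def t_def k_def)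
  obtain j where "t = U j" "1 \<le> j" using order_stat_eq_sample[OF k(1,2), of U] by (auto simp: t_def)
  hence t: "0 < t" "t \<le> 1" using U by auto
  have tu: "\<bar>t - u\<bar> \<le> D" using Qhat_near_argument[OF n U _ _ D, of u] u Q by simp
  have "real k \<le> real n * ecdf U n t"
    using card_le_order_stat[OF k(1,2), of U] n by (simp add: ecdf_def t_def)
  hence "real n * u \<le> real n * ecdf U n t" using k by linarith
  hence "u \<le> ecdf U n t" using n by simp
  moreover have "\<bar>(ecdf U n u - u) - (ecdf U n t - t)\<bar> \<le> B" using tu \<open>D < a\<close> t u by (intro osc) auto
  ultimately have lo: "- B \<le> t + ecdf U n u - 2 * u" by linarith
  \<comment> \<open>For s in (l, t) both |t - u| <= D and t - s <= a - D hold, so s stays within a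
    of u and the oscillation bound applies. D < a and t > 0 make this interval nonempty.\<close>
  define l where "l = max 0 (t - (a - D))"
  have l: "l < t" using t \<open>D < a\<close> by (simp add: l_def)
  have "s \<le> 2 * u - ecdf U n u + B" if s: "l < s" "s < t" for s
  proof -
    have s0: "0 < s" "t - s \<le> a - D" using s by (auto simp: l_def)
    have "card {i \<in> {1..n}. U i \<le> s} \<le> card {i \<in> {1..n}. U i < t}" using s by (intro card_mono) auto
    also have "\<dots> < k" using card_less_order_stat[OF k(1,2), of U] by (simp add: t_def)
    finally have "real (card {i \<in> {1..n}. U i \<le> s}) \<le> real n * u" using k by linarith
    hence "ecdf U n s \<le> u" using n by (simp add: ecdf_def field_simps)
    moreover have "\<bar>(ecdf U n u - u) - (ecdf U n s - s)\<bar> \<le> B" using tu \<open>D < a\<close> t u s s0 by (intro osc) auto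
    ultimately show ?thesis by linarith
  qed
  hence "t \<le> 2 * u - ecdf U n u + B" by (rule dense_le_bounded[OF l])
  thus ?thesis using lo Q by simp
qed

text \<open>This identifies the sum defining \<open>qhat\<close> as a Stieltjes sum of the kernel
  against the step function \<open>Qhat\<close>: the jump at i/n is the i-th spacing, and i/n <= u
  holds exactly for the indices below the one chosen by the floor.\<close>

lemma sum_spacings_eq_Qhat:
  assumes n: "1 \<le> n" and u: "0 \<le> u" "u < 1"
  shows "(\<Sum>i = 1..n - 1. (order_stat U n (i + 1) - order_stat U n i) * (if real i / real n \<le> u then 1 else 0))
     = Qhat U n u - order_stat U n 1"
proof -
  define k where "k = nat \<lfloor>real n * u\<rfloor> + 1"
  have k: "1 \<le> k" "k \<le> n" "real n * u < real k" "real k - 1 \<le> real n * u"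
    using floor_index[OF u n] unfolding k_def by auto
  have eq: "real i / real n \<le> u \<longleftrightarrow> i < k" for i
  proof -
    have "real i / real n \<le> u \<longleftrightarrow> real i \<le> real n * u" using n by (simp add: field_simps)
    also have "\<dots> \<longleftrightarrow> i < k" using k by linarith
    finally show ?thesis .
  qed
  have "(\<Sum>i = 1..n - 1. (order_stat U n (i + 1) - order_stat U n i) * (if real i / real n \<le> u then 1 else 0))
      = (\<Sum>i \<in> {i\<in>{1..n-1}. i < k}. order_stat U n (i + 1) - order_stat U n i)"
    unfolding eq by (subst sum.inter_filter) (auto intro!: sum.cong)
  also have "{i\<in>{1..n-1}. i < k} = {1..<k}" using k by auto
  also have "(\<Sum>i = 1..<k. order_stat U n (i + 1) - order_stat U n i) = order_stat U n k - order_stat U n 1"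
    using sum_Suc_diff'[of 1 k "order_stat U n"] k by simp
  finally show ?thesis using u by (simp add: Qhat_def k_def)
qed

subsection \<open>Exponential inequalities for uniform samples\<close>

text \<open>Doob's maximal inequality for the submartingale of partial products, by induction on N.
  The expectation is restricted to the event that c has been reached. The next factor is independent
  of that event and of the product so far and has mean at least 1, so it does not decrease this
  expectation; where c is reached for the first time, the new product itself is at least c.\<close>

lemma (in prob_space) maximal_inequality_indep_prod:
  fixes X :: "nat \<Rightarrow> 'a \<Rightarrow> real"
  assumes ind: "indep_vars (\<lambda>_. borel) X {1..}"
    and nonneg: "\<And>i \<omega>. 0 \<le> X i \<omega>" and bdd: "\<And>i \<omega>. X i \<omega> \<le> C"
    and mean: "\<And>i. 1 \<le> i \<Longrightarrow> 1 \<le> expectation (X i)" and c: "0 \<le> c"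
  shows "c * prob {\<omega>\<in>space M. \<exists>n\<in>{1..N}. c \<le> (\<Prod>i = 1..n. X i \<omega>)} \<le> expectation (\<lambda>\<omega>. \<Prod>i = 1..N. X i \<omega>)"
proof -
  have X[measurable]: "X i \<in> borel_measurable M" if "1 \<le> i" for i
    using ind that by (auto simp: indep_vars_def)
  have P[measurable]: "(\<lambda>\<omega>. \<Prod>i = 1..n. X i \<omega>) \<in> borel_measurable M" for n
    by (intro borel_measurable_prod) auto
  define A where "A = (\<lambda>N. {\<omega>\<in>space M. \<exists>n\<in>{1..N}. c \<le> (\<Prod>i = 1..n. X i \<omega>)})"
  have A[measurable]: "A N \<in> sets M" for N unfolding A_def by measurable
  have C: "0 \<le> C" using nonneg[of 0] bdd[of 0] order_trans by blast
  have P0: "0 \<le> (\<Prod>i = 1..n. X i \<omega>)" for n \<omega> by (intro prod_nonneg) (auto simp: nonneg)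
  have PC: "(\<Prod>i = 1..n. X i \<omega>) \<le> C ^ n" for n \<omega>
    using prod_mono[of "{1..n}" "\<lambda>i. X i \<omega>" "\<lambda>_. C"] nonneg bdd by simp
  have int: "integrable M (\<lambda>\<omega>. \<Prod>i = 1..n. X i \<omega>)" for n
    by (rule integrable_const_bound[where B = "C ^ n"]) (use P0 PC in auto)
  have intA: "integrable M (\<lambda>\<omega>. (\<Prod>i = 1..n. X i \<omega>) * indicator (A m) \<omega>)" for n m
    using integrable_mult_indicator[OF A int, of m n] by (simp add: mult.commute)
  have intX: "integrable M (X i)" if "1 \<le> i" for i
    by (rule integrable_const_bound[where B = C]) (use nonneg bdd X[OF that] in auto)
  have "c * prob (A N) \<le> expectation (\<lambda>\<omega>. (\<Prod>i = 1..N. X i \<omega>) * indicator (A N) \<omega>)" for N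
  proof (induction N)
    case 0
    have "A 0 = {}" by (auto simp: A_def)
    thus ?case by simp
  next
    case (Suc N)
    \<comment> \<open>Product and stopping event are written as one function of the first N
      coordinates, so that independence of the blocks {1..N} and {Suc N} applies to them
      jointly.\<close>
    define f :: "(nat \<Rightarrow> real) \<Rightarrow> real" where
      "f = (\<lambda>z. (\<Prod>i = 1..N. z i) * indicator (\<Union>n\<in>{1..N}. {z. c \<le> (\<Prod>i = 1..n. z i)}) z)"
    have pm: "(\<lambda>z. \<Prod>i = 1..n. z i) \<in> borel_measurable (PiM {1..N} (\<lambda>_. borel :: real measure))" if "n \<le> N" for n
      using that by (intro borel_measurable_prod measurable_component_singleton) auto
    have fm: "f \<in> borel_measurable (PiM {1..N} (\<lambda>_. borel))"
    proof -
      let ?P = "PiM {1..N} (\<lambda>_. borel :: real measure)"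
      have "{z\<in>space ?P. c \<le> (\<Prod>i = 1..n. z i)} \<in> sets ?P" if "n \<in> {1..N}" for n
      proof -
        have [measurable]: "(\<lambda>z. \<Prod>i = 1..n. z i) \<in> borel_measurable ?P" using that pm by simp
        show ?thesis by measurable
      qed
      hence S: "(\<Union>n\<in>{1..N}. {z\<in>space ?P. c \<le> (\<Prod>i = 1..n. z i)}) \<in> sets ?P" by auto
      have "(\<lambda>z. (\<Prod>i = 1..N. z i) * indicator (\<Union>n\<in>{1..N}. {z\<in>space ?P. c \<le> (\<Prod>i = 1..n. z i)}) z) \<in> borel_measurable ?P"
        using S pm[of N] by (intro borel_measurable_times borel_measurable_indicator) auto
      also have "?this \<longleftrightarrow> f \<in> borel_measurable ?P"
        by (rule measurable_cong) (auto simp: f_def indicator_def)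
      finally show ?thesis .
    qed
    have "indep_var (PiM {1..N} (\<lambda>_. borel)) (\<lambda>\<omega>. restrict (\<lambda>i. X i \<omega>) {1..N})
        (PiM {Suc N} (\<lambda>_. borel)) (\<lambda>\<omega>. restrict (\<lambda>i. X i \<omega>) {Suc N})"
      by (rule indep_var_restrict[OF ind]) auto
    hence "indep_var borel (f \<circ> (\<lambda>\<omega>. restrict (\<lambda>i. X i \<omega>) {1..N})) borel ((\<lambda>z. z (Suc N)) \<circ> (\<lambda>\<omega>. restrict (\<lambda>i. X i \<omega>) {Suc N}))"
      by (rule indep_var_compose[OF _ fm]) (rule measurable_component_singleton, simp)
    moreover have fe: "f (restrict (\<lambda>i. X i \<omega>) {1..N}) = f (\<lambda>i. X i \<omega>)" for \<omega>
    proof -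
      have "(\<Prod>i = 1..n. restrict (\<lambda>i. X i \<omega>) {1..N} i) = (\<Prod>i = 1..n. X i \<omega>)" if "n \<le> N" for n
        using that by (intro prod.cong) auto
      thus ?thesis by (auto simp: f_def indicator_def)
    qed
    ultimately have iv: "indep_var borel (\<lambda>\<omega>. f (\<lambda>i. X i \<omega>)) borel (X (Suc N))"
      by (simp add: comp_def)
    have fA: "f (\<lambda>i. X i \<omega>) = (\<Prod>i = 1..N. X i \<omega>) * indicator (A N) \<omega>" if "\<omega> \<in> space M" for \<omega>
      using that by (auto simp: f_def A_def indicator_def)
    have intf: "integrable M (\<lambda>\<omega>. f (\<lambda>i. X i \<omega>))"
      using intA[of N N] by (subst Bochner_Integration.integrable_cong[OF refl fA]) auto
    have f0: "0 \<le> expectation (\<lambda>\<omega>. f (\<lambda>i. X i \<omega>))"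
      by (rule integral_nonneg_AE) (use P0 in \<open>auto simp: f_def\<close>)
    have "expectation (\<lambda>\<omega>. (\<Prod>i = 1..Suc N. X i \<omega>) * indicator (A N) \<omega>)
        = expectation (\<lambda>\<omega>. f (\<lambda>i. X i \<omega>) * X (Suc N) \<omega>)"
      by (rule Bochner_Integration.integral_cong) (auto simp: fA)
    also have "\<dots> = expectation (\<lambda>\<omega>. f (\<lambda>i. X i \<omega>)) * expectation (X (Suc N))"
      by (rule indep_var_lebesgue_integral[OF iv intf intX]) simp
    also have "\<dots> \<ge> expectation (\<lambda>\<omega>. f (\<lambda>i. X i \<omega>))"
      using mult_left_mono[OF mean[of "Suc N"] f0] by simp
    also (xtrans) have "expectation (\<lambda>\<omega>. f (\<lambda>i. X i \<omega>)) = expectation (\<lambda>\<omega>. (\<Prod>i = 1..N. X i \<omega>) * indicator (A N) \<omega>)"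
      by (rule Bochner_Integration.integral_cong) (auto simp: fA)
    finally have 1: "c * prob (A N) \<le> expectation (\<lambda>\<omega>. (\<Prod>i = 1..Suc N. X i \<omega>) * indicator (A N) \<omega>)"
      using Suc.IH by linarith
    have sub: "A N \<subseteq> A (Suc N)" by (auto simp: A_def)
    have "expectation (\<lambda>\<omega>. c * indicator (A (Suc N) - A N) \<omega>) \<le> expectation (\<lambda>\<omega>. (\<Prod>i = 1..Suc N. X i \<omega>) * indicator (A (Suc N) - A N) \<omega>)"
    proof (rule integral_mono)
      show "integrable M (\<lambda>\<omega>. c * indicator (A (Suc N) - A N) \<omega>)" by (auto simp: emeasure_eq_measure)
      show "integrable M (\<lambda>\<omega>. (\<Prod>i = 1..Suc N. X i \<omega>) * indicator (A (Suc N) - A N) \<omega>)"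
        using integrable_mult_indicator[OF _ int, of "A (Suc N) - A N" "Suc N"] by (simp add: mult.commute)
      fix \<omega> assume "\<omega> \<in> space M"
      have "c \<le> (\<Prod>i = 1..Suc N. X i \<omega>)" if "\<omega> \<in> A (Suc N) - A N"
        using that by (auto simp: A_def elim!: le_SucE simp del: prod.cl_ivl_Suc)
      thus "c * indicator (A (Suc N) - A N) \<omega> \<le> (\<Prod>i = 1..Suc N. X i \<omega>) * indicator (A (Suc N) - A N) \<omega>"
        by (simp add: indicator_def del: prod.cl_ivl_Suc)
    qed
    also have "expectation (\<lambda>\<omega>. c * indicator (A (Suc N) - A N) \<omega>) = c * prob (A (Suc N) - A N)"
      using A by (simp add: Int_absorb2 sets.sets_into_space)
    also have "prob (A (Suc N) - A N) = prob (A (Suc N)) - prob (A N)"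
      by (rule finite_measure_Diff[OF A A sub])
    finally have 2: "c * (prob (A (Suc N)) - prob (A N)) \<le> expectation (\<lambda>\<omega>. (\<Prod>i = 1..Suc N. X i \<omega>) * indicator (A (Suc N) - A N) \<omega>)" .
    have "expectation (\<lambda>\<omega>. (\<Prod>i = 1..Suc N. X i \<omega>) * indicator (A (Suc N)) \<omega>)
       = expectation (\<lambda>\<omega>. (\<Prod>i = 1..Suc N. X i \<omega>) * indicator (A N) \<omega> + (\<Prod>i = 1..Suc N. X i \<omega>) * indicator (A (Suc N) - A N) \<omega>)"
      using sub by (intro Bochner_Integration.integral_cong) (auto simp: indicator_def)
    also have "\<dots> = expectation (\<lambda>\<omega>. (\<Prod>i = 1..Suc N. X i \<omega>) * indicator (A N) \<omega>) + expectation (\<lambda>\<omega>. (\<Prod>i = 1..Suc N. X i \<omega>) * indicator (A (Suc N) - A N) \<omega>)"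
    proof (rule Bochner_Integration.integral_add[OF intA])
      show "integrable M (\<lambda>\<omega>. (\<Prod>i = 1..Suc N. X i \<omega>) * indicator (A (Suc N) - A N) \<omega>)"
        using integrable_mult_indicator[OF _ int, of "A (Suc N) - A N" "Suc N"] by (simp add: mult.commute)
    qed
    finally show ?case using 1 2 by (simp add: algebra_simps del: prod.cl_ivl_Suc)
  qed
  also have "expectation (\<lambda>\<omega>. (\<Prod>i = 1..N. X i \<omega>) * indicator (A N) \<omega>) \<le> expectation (\<lambda>\<omega>. \<Prod>i = 1..N. X i \<omega>)"
    using P0 by (intro integral_mono intA int) (auto simp: indicator_def)
  finally show ?thesis unfolding A_def .
qed

lemma exp_le_quadratic:
  fixes x :: real assumes "\<bar>x\<bar> \<le> 1" shows "exp x - 1 - x \<le> x\<^sup>2"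
proof (cases "0 \<le> x")
  case True thus ?thesis using exp_bound[of x] assms by simp
next
  case False
  define y where "y = - x"
  have y: "0 < y" using False by (simp add: y_def)
  have "1 + y \<le> exp y" by (rule exp_ge_add_one_self)
  hence "exp x \<le> 1 / (1 + y)" using y by (simp add: y_def exp_minus field_simps)
  also have "\<dots> \<le> 1 - y + y\<^sup>2"
  proof -
    have "1 + y ^ 3 = (1 - y + y\<^sup>2) * (1 + y)" by (simp add: algebra_simps power2_eq_square power3_eq_cube)
    thus ?thesis using y by (simp add: divide_le_eq) (metis add_increasing2 le_add_same_cancel1 less_imp_le zero_le_power)
  qed
  finally show ?thesis by (simp add: y_def)
qed

locale uniform_sample = prob_space +
  fixes U :: "nat \<Rightarrow> 'a \<Rightarrow> real"
  assumes indep: "indep_vars (\<lambda>_. borel) U {1..}"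
    and unif: "\<And>i t. 1 \<le> i \<Longrightarrow> 0 \<le> t \<Longrightarrow> t \<le> 1 \<Longrightarrow> prob {\<omega>\<in>space M. U i \<omega> \<le> t} = t"
begin

lemma measurable_U[measurable]: "1 \<le> i \<Longrightarrow> U i \<in> borel_measurable M"
  using indep by (auto simp: indep_vars_def)

lemma prob_interval:
  assumes "1 \<le> i" "0 \<le> s" "s \<le> t" "t \<le> 1"
  shows "prob {\<omega>\<in>space M. s < U i \<omega> \<and> U i \<omega> \<le> t} = t - s"
proof -
  have [measurable]: "U i \<in> borel_measurable M" using assms by simp
  have "prob ({\<omega>\<in>space M. U i \<omega> \<le> t} - {\<omega>\<in>space M. U i \<omega> \<le> s}) = t - s"
    using assms by (subst finite_measure_Diff) (auto simp: unif)
  also have "{\<omega>\<in>space M. U i \<omega> \<le> t} - {\<omega>\<in>space M. U i \<omega> \<le> s} = {\<omega>\<in>space M. s < U i \<omega> \<and> U i \<omega> \<le> t}"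
    by auto
  finally show ?thesis .
qed

definition centred_count :: "real \<Rightarrow> real \<Rightarrow> nat \<Rightarrow> 'a \<Rightarrow> real" where
  "centred_count s t n \<omega> = (\<Sum>i = 1..n. indicator {s<..t} (U i \<omega>) - (t - s))"

lemma measurable_centred_count[measurable]: "centred_count s t n \<in> borel_measurable M"
  unfolding centred_count_def
  by (intro borel_measurable_sum borel_measurable_diff borel_measurable_const
       measurable_compose[OF measurable_U borel_measurable_indicator]) auto

lemma centred_count_eq_ecdf:
  assumes "1 \<le> n" "s \<le> t"
  shows "centred_count s t n \<omega> = real n * ((ecdf (\<lambda>i. U i \<omega>) n t - t) - (ecdf (\<lambda>i. U i \<omega>) n s - s))"
proof -
  have "real n * (ecdf (\<lambda>i. U i \<omega>) n t - ecdf (\<lambda>i. U i \<omega>) n s)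
     = (\<Sum>i = 1..n. (if U i \<omega> \<le> t then 1 else 0) - (if U i \<omega> \<le> s then 1 else 0))"
    using assms unfolding ecdf_eq_sum sum_distrib_left[symmetric] sum_subtractf by (simp add: right_diff_distrib)
  also have "\<dots> = (\<Sum>i = 1..n. indicator {s<..t} (U i \<omega>))"
    using assms by (intro sum.cong) (auto simp: indicator_def)
  moreover have "centred_count s t n \<omega> = (\<Sum>i = 1..n. indicator {s<..t} (U i \<omega>)) - real n * (t - s)"
    unfolding centred_count_def by (subst sum_subtractf) simp
  ultimately show ?thesis by (simp add: algebra_simps)
qed

text \<open>The exponentials of the summands are independent with mean at least 1 (convexity of exp)
  and at most exp (p (exp \<theta> - 1 - \<theta>)), p = t - s. The maximal inequality therefore
  controls all n <= N at the price of N alone. The sign of \<theta> is free, so both tails are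
  covered.\<close>

lemma maximal_chernoff:
  assumes st: "0 \<le> s" "s \<le> t" "t \<le> 1"
  shows "prob {\<omega>\<in>space M. \<exists>n\<in>{1..N}. y \<le> \<theta> * centred_count s t n \<omega>}
       \<le> exp (real N * (t - s) * (exp \<theta> - 1 - \<theta>) - y)"
proof -
  define p where "p = t - s"
  define X where "X = (\<lambda>i \<omega>. exp (\<theta> * (indicator {s<..t} (U i \<omega>) - p)))"
  have p: "0 \<le> p" "p \<le> 1" using st by (auto simp: p_def)
  have XC: "X i \<omega> \<le> exp \<bar>\<theta>\<bar>" for i \<omega>
  proof -
    have "\<theta> * (indicator {s<..t} (U i \<omega>) - p) \<le> \<bar>\<theta>\<bar> * \<bar>indicator {s<..t} (U i \<omega>) - p\<bar>"
      by (metis abs_ge_self abs_mult)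
    also have "\<dots> \<le> \<bar>\<theta>\<bar> * 1" using p by (intro mult_left_mono) (auto simp: indicator_def)
    finally show ?thesis by (simp add: X_def)
  qed
  have ind: "indep_vars (\<lambda>_. borel) X {1..}"
    unfolding X_def by (rule indep_vars_compose2[OF indep]) measurable
  have mean: "expectation (X i) = exp (- \<theta> * p) * (1 + p * (exp \<theta> - 1))" if "1 \<le> i" for i
  proof -
    have [measurable]: "U i \<in> borel_measurable M" using that by simp
    have "expectation (X i) = expectation (\<lambda>\<omega>. exp (- \<theta> * p) + exp (- \<theta> * p) * (exp \<theta> - 1) * indicator {\<omega>\<in>space M. s < U i \<omega> \<and> U i \<omega> \<le> t} \<omega>)"
    proof (rule Bochner_Integration.integral_cong[OF refl])
      fix \<omega> assume "\<omega> \<in> space M"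
      have "exp (\<theta> * (1 - p)) = exp (- \<theta> * p) * exp \<theta>" by (simp add: mult_exp_exp algebra_simps)
      thus "X i \<omega> = exp (- \<theta> * p) + exp (- \<theta> * p) * (exp \<theta> - 1) * indicator {\<omega>\<in>space M. s < U i \<omega> \<and> U i \<omega> \<le> t} \<omega>"
        using \<open>\<omega> \<in> space M\<close> by (cases "s < U i \<omega> \<and> U i \<omega> \<le> t") (auto simp: X_def right_diff_distrib)
    qed
    also have "\<dots> = exp (- \<theta> * p) + exp (- \<theta> * p) * (exp \<theta> - 1) * p"
      using prob_interval[OF that st] by (subst Bochner_Integration.integral_add) (auto simp: p_def emeasure_eq_measure prob_space)
    finally show ?thesis by (simp add: algebra_simps)
  qed
  have mean1: "1 \<le> expectation (X i)" if i: "1 \<le> i" for i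
  proof -
    have "convex_on UNIV (exp :: real \<Rightarrow> real)" by (rule exp_convex)
    hence "exp (\<theta> * p) \<le> 1 + p * (exp \<theta> - 1)"
      using convex_onD[OF \<open>convex_on UNIV exp\<close>, of p 0 \<theta>] p by (simp add: algebra_simps)
    hence "exp (- \<theta> * p) * exp (\<theta> * p) \<le> exp (- \<theta> * p) * (1 + p * (exp \<theta> - 1))" by (intro mult_left_mono) auto
    thus ?thesis using mean[OF i] by (simp add: exp_add[symmetric])
  qed
  have mean2: "expectation (X i) \<le> exp (p * (exp \<theta> - 1 - \<theta>))" if i: "1 \<le> i" for i
  proof -
    have "1 + p * (exp \<theta> - 1) \<le> exp (p * (exp \<theta> - 1))" by (rule exp_ge_add_one_self)
    hence "exp (- \<theta> * p) * (1 + p * (exp \<theta> - 1)) \<le> exp (- \<theta> * p) * exp (p * (exp \<theta> - 1))" by (intro mult_left_mono) auto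
    also have "\<dots> = exp (p * (exp \<theta> - 1 - \<theta>))" by (simp add: exp_add[symmetric] algebra_simps)
    finally show ?thesis using mean[OF i] by simp
  qed
  have Xint: "integrable M (X i)" if "1 \<le> i" for i
  proof (rule integrable_const_bound[where B = "exp \<bar>\<theta>\<bar>"])
    show "AE x in M. norm (X i x) \<le> exp \<bar>\<theta>\<bar>" using XC by (auto simp: X_def)
    show "X i \<in> borel_measurable M" using ind that by (auto simp: indep_vars_def)
  qed
  have "expectation (\<lambda>\<omega>. \<Prod>i = 1..N. X i \<omega>) = (\<Prod>i = 1..N. expectation (X i))"
  proof (rule indep_vars_lebesgue_integral)
    show "indep_vars (\<lambda>_. borel) X {1..N}" by (rule indep_vars_subset[OF ind]) auto
  qed (use Xint in auto)
  also have "\<dots> \<le> (\<Prod>i = 1..N. exp (p * (exp \<theta> - 1 - \<theta>)))"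
    using mean1 mean2 by (intro prod_mono) (auto intro: order_trans[of 0 1])
  also have "\<dots> = exp (real N * p * (exp \<theta> - 1 - \<theta>))" by (simp add: exp_of_nat_mult[symmetric] mult.assoc)
  finally have E: "expectation (\<lambda>\<omega>. \<Prod>i = 1..N. X i \<omega>) \<le> exp (real N * p * (exp \<theta> - 1 - \<theta>))" .
  have "exp y * prob {\<omega>\<in>space M. \<exists>n\<in>{1..N}. exp y \<le> (\<Prod>i = 1..n. X i \<omega>)} \<le> expectation (\<lambda>\<omega>. \<Prod>i = 1..N. X i \<omega>)"
    by (rule maximal_inequality_indep_prod[OF ind _ XC mean1]) (auto simp: X_def)
  moreover have "(\<Prod>i = 1..n. X i \<omega>) = exp (\<theta> * centred_count s t n \<omega>)" for n \<omega>
    by (simp add: X_def exp_sum[symmetric] centred_count_def sum_distrib_left p_def)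
  ultimately have "exp y * prob {\<omega>\<in>space M. \<exists>n\<in>{1..N}. y \<le> \<theta> * centred_count s t n \<omega>} \<le> exp (real N * p * (exp \<theta> - 1 - \<theta>))"
    using E by simp
  hence "prob {\<omega>\<in>space M. \<exists>n\<in>{1..N}. y \<le> \<theta> * centred_count s t n \<omega>} \<le> exp (real N * p * (exp \<theta> - 1 - \<theta>)) / exp y"
    by (simp add: pos_le_divide_eq mult.commute)
  thus ?thesis by (simp only: p_def exp_diff)
qed

text \<open>\<open>maximal_chernoff\<close> at \<theta> and -\<theta>, with the exponent made
  quadratic by |\<theta>| <= 1. The tilt is left open because each application balances variance and
  deviation differently.\<close>

lemma maximal_bernstein:
  assumes st: "0 \<le> s" "s \<le> t" "t \<le> 1" and l: "0 < \<theta>" "\<theta> \<le> 1"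
  shows "prob {\<omega>\<in>space M. \<exists>n\<in>{1..N}. y \<le> \<bar>centred_count s t n \<omega>\<bar>}
       \<le> 2 * exp (real N * (t - s) * \<theta>\<^sup>2 - \<theta> * y)"
proof -
  let ?E = "\<lambda>\<mu>. {\<omega>\<in>space M. \<exists>n\<in>{1..N}. \<theta> * y \<le> \<mu> * centred_count s t n \<omega>}"
  have E: "prob (?E \<mu>) \<le> exp (real N * (t - s) * \<theta>\<^sup>2 - \<theta> * y)" if "\<bar>\<mu>\<bar> = \<theta>" for \<mu>
  proof -
    have "real N * (t - s) * (exp \<mu> - 1 - \<mu>) \<le> real N * (t - s) * \<mu>\<^sup>2"
      using that l st by (intro mult_left_mono exp_le_quadratic) auto
    also have "\<mu>\<^sup>2 = \<theta>\<^sup>2" using that by (metis power2_abs)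
    finally show ?thesis using maximal_chernoff[OF st, of N "\<theta> * y" \<mu>] by (meson diff_right_mono exp_le_cancel_iff order_trans)
  qed
  have "\<theta> * y \<le> \<theta> * z \<or> \<theta> * y \<le> - \<theta> * z" if "y \<le> \<bar>z\<bar>" for z
    using that l abs_eq_iff mult_left_mono by fastforce
  hence "{\<omega>\<in>space M. \<exists>n\<in>{1..N}. y \<le> \<bar>centred_count s t n \<omega>\<bar>} \<subseteq> ?E \<theta> \<union> ?E (- \<theta>)"
    by blast
  hence "prob {\<omega>\<in>space M. \<exists>n\<in>{1..N}. y \<le> \<bar>centred_count s t n \<omega>\<bar>} \<le> prob (?E \<theta> \<union> ?E (- \<theta>))"
    by (intro finite_measure_mono) auto
  also have "\<dots> \<le> prob (?E \<theta>) + prob (?E (- \<theta>))" by (intro measure_Un_le) auto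
  finally show ?thesis using E[of \<theta>] E[of "- \<theta>"] l by simp
qed

end

subsection \<open>Almost sure bounds for the empirical process\<close>

lemma (in prob_space) AE_eventually_not:
  assumes meas: "\<And>n. {\<omega>\<in>space M. P n \<omega>} \<in> events"
    and le: "\<forall>\<^sub>F n in sequentially. prob {\<omega>\<in>space M. P n \<omega>} \<le> f n" and sm: "summable f"
  shows "AE \<omega> in M. \<forall>\<^sub>F n in sequentially. \<not> P n \<omega>"
proof -
  have "summable (\<lambda>n. prob {\<omega>\<in>space M. P n \<omega>})"
    using le by (intro summable_comparison_test_ev[OF _ sm]) simp
  hence "AE \<omega> in M. \<forall>\<^sub>F n in sequentially. \<omega> \<in> space M - {\<omega>\<in>space M. P n \<omega>}"
    by (intro borel_cantelli_AE1[OF meas]) (auto simp: emeasure_eq_measure)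
  thus ?thesis
  proof (rule AE_mp, intro AE_I2 impI)
    fix \<omega> assume "\<forall>\<^sub>F n in sequentially. \<omega> \<in> space M - {\<omega>\<in>space M. P n \<omega>}"
    thus "\<forall>\<^sub>F n in sequentially. \<not> P n \<omega>" by (rule eventually_mono) auto
  qed
qed

lemma inverse_square_summable_mult: "summable (\<lambda>n. C / (real n)\<^sup>2)"
  using summable_mult[OF inverse_power_summable[of 2, where 'a = real], of C] by (simp add: divide_inverse)

text \<open>For the upper bound s is rounded down and t up, for the lower bound s up and t down;
  monotonicity of \<open>ecdf\<close> makes both directions safe, and rounding costs 2/n. If inward
  rounding makes the ends cross, then t - s <= 2/n and monotonicity alone is enough.\<close>

lemma oscillation_from_grid:
  assumes n: "1 \<le> n" and st: "0 \<le> s" "s \<le> t" "t \<le> 1" "t - s \<le> a" and B: "0 \<le> B"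
    and grid: "\<And>j k. j \<le> k \<Longrightarrow> k \<le> n \<Longrightarrow> real (k - j) / real n \<le> a + 2 / real n \<Longrightarrow>
      \<bar>(ecdf x n (real k / real n) - real k / real n) - (ecdf x n (real j / real n) - real j / real n)\<bar> \<le> B"
  shows "\<bar>(ecdf x n t - t) - (ecdf x n s - s)\<bar> \<le> B + 2 / real n"
proof -
  have n0: "0 < real n" using n by simp
  define js ks jl kl where "js = nat \<lfloor>real n * s\<rfloor>" and "ks = nat \<lceil>real n * t\<rceil>"
    and "jl = nat \<lceil>real n * s\<rceil>" and "kl = nat \<lfloor>real n * t\<rfloor>"
  have ns: "0 \<le> real n * s" "real n * s \<le> real n * t" "real n * t \<le> real n"
    using st n0 by (auto simp: mult_left_le)
  have js: "real js \<le> real n * s" "real n * s < real js + 1" using ns unfolding js_def by linarith+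
  have ks: "real n * t \<le> real ks" "real ks < real n * t + 1" using ns unfolding ks_def by linarith+
  have jl: "real n * s \<le> real jl" "real jl < real n * s + 1" using ns unfolding jl_def by linarith+
  have kl: "real kl \<le> real n * t" "real n * t < real kl + 1" using ns unfolding kl_def by linarith+
  have ksn: "ks \<le> n" using ns unfolding ks_def by linarith
  have kln: "kl \<le> n" using ns kl by linarith
  have na: "real n * t - real n * s \<le> real n * a"
    using mult_left_mono[OF st(4), of "real n"] n0 by (simp add: right_diff_distrib)
  have dv: "y / real n \<le> a + 2 / real n" if "y \<le> real n * a + 2" for y
    using that n0 by (simp add: field_simps)
  have qd: "x1 / real n - x2 / real n \<le> y1 + 2 / real n" if "x1 - x2 \<le> real n * y1 + 2" for x1 x2 y1
    using divide_right_mono[OF that, of "real n"] n0 by (simp add: diff_divide_distrib add_divide_distrib)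
  have up: "(ecdf x n t - t) - (ecdf x n s - s) \<le> B + 2 / real n"
  proof -
    have jk: "js \<le> ks" using js ks ns by linarith
    have "ecdf x n t \<le> ecdf x n (real ks / real n)" "ecdf x n (real js / real n) \<le> ecdf x n s"
      using ks js n0 by (auto intro!: ecdf_mono simp: field_simps)
    moreover have "\<bar>(ecdf x n (real ks / real n) - real ks / real n) - (ecdf x n (real js / real n) - real js / real n)\<bar> \<le> B"
    proof (rule grid[OF jk ksn], rule dv)
      show "real (ks - js) \<le> real n * a + 2" using jk js ks na by (simp add: of_nat_diff)
    qed
    moreover have "real ks / real n - real js / real n \<le> t - s + 2 / real n"
      by (rule qd) (use js ks in \<open>simp add: right_diff_distrib\<close>)
    ultimately show ?thesis by linarith
  qed
  have lo: "- (B + 2 / real n) \<le> (ecdf x n t - t) - (ecdf x n s - s)"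
  proof (cases "jl \<le> kl")
    case True
    have "ecdf x n (real kl / real n) \<le> ecdf x n t" "ecdf x n s \<le> ecdf x n (real jl / real n)"
      using kl jl n0 by (auto intro!: ecdf_mono simp: field_simps)
    moreover have "\<bar>(ecdf x n (real kl / real n) - real kl / real n) - (ecdf x n (real jl / real n) - real jl / real n)\<bar> \<le> B"
    proof (rule grid[OF True kln], rule dv)
      show "real (kl - jl) \<le> real n * a + 2" using True jl kl na by (simp add: of_nat_diff)
    qed
    moreover have "real jl / real n - real kl / real n \<le> (s - t) + 2 / real n"
      by (rule qd) (use jl kl in \<open>simp add: right_diff_distrib\<close>)
    ultimately show ?thesis by linarith
  next
    case False
    hence "real kl + 1 \<le> real jl" by simp
    hence "real n * t - real n * s \<le> 2" using jl kl by linarith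
    hence "t - s \<le> 2 / real n" using n0 by (simp add: field_simps)
    moreover have "ecdf x n s \<le> ecdf x n t" using st by (intro ecdf_mono)
    ultimately show ?thesis using B by linarith
  qed
  show ?thesis using up lo by linarith
qed

text \<open>The point m / 2^r is reached from (m div 2) / 2^(r - 1) by at most one increment of
  level r, so a path from 0 uses at most one increment per level.\<close>

lemma dyadic_chaining:
  fixes g :: "real \<Rightarrow> real"
  assumes "\<And>q j. q \<le> r \<Longrightarrow> j < 2 ^ q \<Longrightarrow> \<bar>g (real (Suc j) / 2 ^ q) - g (real j / 2 ^ q)\<bar> \<le> y q"
    and "m \<le> 2 ^ r" and "\<And>q. 0 \<le> y q"
  shows "\<bar>g (real m / 2 ^ r) - g 0\<bar> \<le> (\<Sum>q\<le>r. y q)"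
  using assms(1,2)
proof (induction r arbitrary: m)
  case 0
  hence "m = 0 \<or> m = 1" by auto
  thus ?case using 0(1)[of 0 0] assms(3)[of 0] by auto
next
  case (Suc r)
  define m' where "m' = m div 2"
  have m': "m' \<le> 2 ^ r" using Suc.prems(2) unfolding m'_def by simp
  have IH: "\<bar>g (real m' / 2 ^ r) - g 0\<bar> \<le> (\<Sum>q\<le>r. y q)"
    by (rule Suc.IH[OF _ m']) (use Suc.prems(1) in auto)
  show ?case
  proof (cases "even m")
    case True
    hence "real m / 2 ^ Suc r = real m' / 2 ^ r" by (auto simp: m'_def elim!: evenE)
    thus ?thesis using IH assms(3)[of "Suc r"] by simp
  next
    case False
    then obtain l where l: "m = 2 * l + 1" by (auto elim!: oddE)
    hence ml: "m' = l" by (simp add: m'_def)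
    have "2 * l < 2 ^ Suc r" using Suc.prems(2) l by simp
    hence "\<bar>g (real (Suc (2 * l)) / 2 ^ Suc r) - g (real (2 * l) / 2 ^ Suc r)\<bar> \<le> y (Suc r)"
      by (intro Suc.prems(1)) auto
    moreover have "real (2 * l) / 2 ^ Suc r = real m' / 2 ^ r" by (simp add: ml)
    moreover have "real (Suc (2 * l)) = real m" by (simp add: l)
    ultimately show ?thesis using IH by simp
  qed
qed

context uniform_sample
begin

lemma AE_sample_in_unit: "AE \<omega> in M. \<forall>i\<ge>1. 0 < U i \<omega> \<and> U i \<omega> \<le> 1"
proof -
  have "AE \<omega> in M. 0 < U i \<omega> \<and> U i \<omega> \<le> 1" if i: "1 \<le> i" for i
  proof -
    have [measurable]: "U i \<in> borel_measurable M" using i by simp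
    have "AE \<omega> in M. \<omega> \<in> {\<omega>\<in>space M. 0 < U i \<omega> \<and> U i \<omega> \<le> 1}"
      by (rule AE_prob_1) (use prob_interval[OF i, of 0 1] in simp)
    thus ?thesis by (rule AE_mp) (auto intro!: AE_I2)
  qed
  hence "\<forall>i. AE \<omega> in M. 1 \<le> i \<longrightarrow> 0 < U i \<omega> \<and> U i \<omega> \<le> 1" by auto
  thus ?thesis by (subst AE_all_countable)
qed

text \<open>Bernstein's inequality on the O(n^2) pairs of grid points k/n. The hypothesis a n >= ln
  n / n is exactly what keeps the tilt at most 1. In the final constant 10, the grid contributes 8
  and rounding 2.\<close>

lemma oscillation_ecdf:
  assumes a: "\<forall>\<^sub>F n in sequentially. ln (real n) / real n \<le> a n"
  shows "AE \<omega> in M. \<forall>\<^sub>F n in sequentially. \<forall>s\<in>{0..1}. \<forall>t\<in>{0..1}. \<bar>s - t\<bar> \<le> a n \<longrightarrow>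
     \<bar>(ecdf (\<lambda>i. U i \<omega>) n s - s) - (ecdf (\<lambda>i. U i \<omega>) n t - t)\<bar> \<le> 10 * sqrt (a n * ln (real n) / real n)"
proof -
  \<comment> \<open>Rounding to the grid lengthens an interval to at most a n + 2/n, and 1/n <= ln n
    / n <= a n bounds this by 3 a n.\<close>
  define I where "I = (\<lambda>n. {(j, k). j \<le> k \<and> k \<le> n \<and> real (k - j) / real n \<le> 3 * a n})"
  define bad where "bad = (\<lambda>n \<omega>. \<exists>jk\<in>I n. \<exists>l\<in>{n..n}. 8 * sqrt (real n * a n * ln (real n))
      \<le> \<bar>centred_count (real (fst jk) / real n) (real (snd jk) / real n) l \<omega>\<bar>)"
  have Isub: "I n \<subseteq> {0..n} \<times> {0..n}" for n by (auto simp: I_def)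
  have Ifin: "finite (I n)" for n by (rule finite_subset[OF Isub]) simp
  have Icard: "real (card (I n)) \<le> (real n + 1)\<^sup>2" for n
  proof -
    have "card (I n) \<le> card ({0..n} \<times> {0..n})" by (rule card_mono[OF _ Isub]) simp
    also have "\<dots> = (n + 1)\<^sup>2" by (simp add: power2_eq_square)
    finally have "real (card (I n)) \<le> real ((n + 1)\<^sup>2)" by (rule of_nat_mono)
    thus ?thesis by (simp add: algebra_simps)
  qed
  have "AE \<omega> in M. \<forall>\<^sub>F n in sequentially. \<not> bad n \<omega>"
  proof (rule AE_eventually_not)
    show "{\<omega>\<in>space M. bad n \<omega>} \<in> events" for n
      unfolding bad_def using Ifin[of n] by measurable
    show "summable (\<lambda>n. 8 / (real n)\<^sup>2)" by (rule inverse_square_summable_mult)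
    show "\<forall>\<^sub>F n in sequentially. prob {\<omega>\<in>space M. bad n \<omega>} \<le> 8 / (real n)\<^sup>2"
      using a eventually_ge_at_top[of 3]
    proof eventually_elim
      case (elim n)
      have n: "n \<ge> 3" by fact
      have ln1: "1 \<le> ln (real n)" using n exp_le by (subst ln_ge_iff) auto
      have n0: "0 < real n" using n by simp
      have an: "ln (real n) \<le> real n * a n" using elim n0 by (simp add: field_simps)
      hence an0: "0 < real n * a n" using ln1 by linarith
      \<comment> \<open>This tilt makes the variance term at most 3 ln n and the deviation term
        equal to 8 ln n, so each pair has probability at most 2 / n^5, enough against the (n + 1)^2
        pairs.\<close>
      define \<theta> where "\<theta> = sqrt (ln (real n) / (real n * a n))"
      have t: "0 < \<theta>" "\<theta> \<le> 1" using ln1 an an0 by (auto simp: \<theta>_def)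
      have t2: "\<theta>\<^sup>2 = ln (real n) / (real n * a n)" unfolding \<theta>_def using ln1 an0 by (intro real_sqrt_pow2) simp
      have ty: "\<theta> * sqrt (real n * a n * ln (real n)) = ln (real n)"
      proof -
        have "l / z * (z * l) = l\<^sup>2" if "0 < z" for l z :: real using that by (simp add: power2_eq_square)
        from this[OF an0, of "ln (real n)"] show ?thesis
          unfolding \<theta>_def real_sqrt_mult[symmetric] using ln1 by simp
      qed
      have one: "prob {\<omega>\<in>space M. \<exists>l\<in>{n..n}. 8 * sqrt (real n * a n * ln (real n))
          \<le> \<bar>centred_count (real (fst jk) / real n) (real (snd jk) / real n) l \<omega>\<bar>} \<le> 2 / real n ^ 5"
        if jk: "jk \<in> I n" for jk
      proof -
        obtain j k where [simp]: "jk = (j, k)" by (cases jk)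
        have jk: "j \<le> k" "k \<le> n" "real (k - j) / real n \<le> 3 * a n" using jk by (auto simp: I_def)
        let ?p = "real k / real n - real j / real n"
        have p: "?p \<le> 3 * a n" using jk by (simp add: of_nat_diff diff_divide_distrib)
        have "prob {\<omega>\<in>space M. \<exists>l\<in>{n..n}. 8 * sqrt (real n * a n * ln (real n))
          \<le> \<bar>centred_count (real j / real n) (real k / real n) l \<omega>\<bar>}
          \<le> prob {\<omega>\<in>space M. \<exists>l\<in>{1..n}. 8 * sqrt (real n * a n * ln (real n))
          \<le> \<bar>centred_count (real j / real n) (real k / real n) l \<omega>\<bar>}"
          using n by (intro finite_measure_mono) auto
        also have "\<dots> \<le> 2 * exp (real n * ?p * \<theta>\<^sup>2 - \<theta> * (8 * sqrt (real n * a n * ln (real n))))"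
          using jk n0 t by (intro maximal_bernstein) (auto simp: divide_right_mono)
        also have "\<dots> \<le> 2 * exp (- 5 * ln (real n))"
        proof -
          have "real n * ?p * \<theta>\<^sup>2 \<le> real n * (3 * a n) * \<theta>\<^sup>2"
            using p n0 by (intro mult_right_mono mult_left_mono) auto
          also have "\<dots> = 3 * ln (real n)" using zero_less_mult_pos[OF an0 n0] n0 by (simp add: t2)
          finally show ?thesis using ty by simp
        qed
        also have "exp (- 5 * ln (real n)) = 1 / real n ^ 5"
          using exp_of_nat_mult[of 5 "ln (real n)"] n0 by (simp add: exp_minus inverse_eq_divide)
        finally show ?thesis by simp
      qed
      have "prob {\<omega>\<in>space M. bad n \<omega>} \<le> prob (\<Union>jk\<in>I n. {\<omega>\<in>space M. \<exists>l\<in>{n..n}. 8 * sqrt (real n * a n * ln (real n))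
          \<le> \<bar>centred_count (real (fst jk) / real n) (real (snd jk) / real n) l \<omega>\<bar>})"
        using Ifin[of n] by (intro finite_measure_mono) (auto simp: bad_def)
      also have "\<dots> \<le> (\<Sum>jk\<in>I n. prob {\<omega>\<in>space M. \<exists>l\<in>{n..n}. 8 * sqrt (real n * a n * ln (real n))
          \<le> \<bar>centred_count (real (fst jk) / real n) (real (snd jk) / real n) l \<omega>\<bar>})"
        by (rule measure_UNION_le[OF Ifin]) measurable
      also have "\<dots> \<le> (\<Sum>jk\<in>I n. 2 / real n ^ 5)" by (rule sum_mono[OF one])
      also have "\<dots> \<le> (real n + 1)\<^sup>2 * (2 / real n ^ 5)"
        using mult_right_mono[OF Icard[of n], of "2 / real n ^ 5"] by simp
      also have "\<dots> \<le> (2 * real n)\<^sup>2 * (2 / real n ^ 5)"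
        using n0 n by (intro mult_right_mono power_mono) auto
      also have "\<dots> = 8 / real n ^ 3"
      proof -
        have e: "real n ^ 5 = (real n)\<^sup>2 * real n ^ 3" by (simp flip: power_add)
        have "2\<^sup>2 * u * (2 / (u * v)) = 8 / v" if "0 < u" for u v :: real using that by simp
        thus ?thesis unfolding e power_mult_distrib using n0 by (metis zero_less_power)
      qed
      also have "\<dots> \<le> 8 / real n ^ 2" using n by (intro divide_left_mono power_increasing) auto
      finally show ?case .
    qed
  qed
  thus ?thesis
  proof (rule AE_mp, intro AE_I2 impI)
    fix \<omega> assume "\<forall>\<^sub>F n in sequentially. \<not> bad n \<omega>"
    thus "\<forall>\<^sub>F n in sequentially. \<forall>s\<in>{0..1}. \<forall>t\<in>{0..1}. \<bar>s - t\<bar> \<le> a n \<longrightarrow>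
     \<bar>(ecdf (\<lambda>i. U i \<omega>) n s - s) - (ecdf (\<lambda>i. U i \<omega>) n t - t)\<bar> \<le> 10 * sqrt (a n * ln (real n) / real n)"
      using a eventually_ge_at_top[of 3]
    proof eventually_elim
      case (elim n)
      have n: "n \<ge> 3" by fact
      have ln1: "1 \<le> ln (real n)" using n exp_le by (subst ln_ge_iff) auto
      have n0: "0 < real n" using n by simp
      have an: "ln (real n) \<le> real n * a n" using elim n0 by (simp add: field_simps)
      have an1: "1 / real n \<le> a n" using an ln1 n0 by (simp add: field_simps)
      define x where "x = (\<lambda>i. U i \<omega>)"
      define R where "R = sqrt (a n * ln (real n) / real n)"
      have Rn: "sqrt (real n * a n * ln (real n)) = real n * R"
      proof -
        have "real n * a n * ln (real n) = (real n)\<^sup>2 * (a n * ln (real n) / real n)"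
          using n0 by (simp add: power2_eq_square)
        thus ?thesis using n0 unfolding R_def by (simp only: real_sqrt_mult) simp
      qed
      have a0: "0 < a n" using an1 n0 by (meson divide_pos_pos less_le_trans zero_less_one)
      hence R0: "0 \<le> R" using n0 ln1 by (simp add: R_def)
      have nR: "1 / real n \<le> R"
      proof -
        have "1 / real n * (1 / real n) \<le> a n * (ln (real n) / real n)"
          using n0 ln1 a0 by (intro mult_mono an1 divide_right_mono) auto
        hence "(1 / real n)\<^sup>2 \<le> a n * ln (real n) / real n" by (simp add: power2_eq_square)
        thus ?thesis unfolding R_def by (rule real_le_rsqrt)
      qed
      have main: "\<bar>(ecdf x n t - t) - (ecdf x n s - s)\<bar> \<le> 8 * R + 2 / real n"
        if st: "0 \<le> s" "s \<le> t" "t \<le> 1" "t - s \<le> a n" for s t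
      proof (rule oscillation_from_grid[OF _ st])
        show "1 \<le> n" using n by simp
        show "0 \<le> 8 * R" using R0 by simp
        fix j k assume jk: "j \<le> k" "k \<le> n" "real (k - j) / real n \<le> a n + 2 / real n"
        have "(j, k) \<in> I n" using jk an1 by (auto simp: I_def)
        hence "\<bar>centred_count (real j / real n) (real k / real n) n \<omega>\<bar> < 8 * (real n * R)"
          using elim(1) Rn unfolding bad_def not_le[symmetric] by fastforce
        moreover have "centred_count (real j / real n) (real k / real n) n \<omega>
           = real n * ((ecdf x n (real k / real n) - real k / real n) - (ecdf x n (real j / real n) - real j / real n))"
          unfolding x_def using jk n by (intro centred_count_eq_ecdf) (auto simp: divide_right_mono)
        ultimately have "real n * \<bar>(ecdf x n (real k / real n) - real k / real n) - (ecdf x n (real j / real n) - real j / real n)\<bar> < real n * (8 * R)"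
          using n0 by (simp add: abs_mult mult.left_commute)
        thus "\<bar>(ecdf x n (real k / real n) - real k / real n) - (ecdf x n (real j / real n) - real j / real n)\<bar> \<le> 8 * R"
          using n0 by simp
      qed
      show ?case unfolding x_def[symmetric] R_def[symmetric]
      proof (intro ballI impI)
        fix s t :: real assume st: "s \<in> {0..1}" "t \<in> {0..1}" "\<bar>s - t\<bar> \<le> a n"
        show "\<bar>(ecdf x n s - s) - (ecdf x n t - t)\<bar> \<le> 10 * R"
          using main[of s t] main[of t s] st nR by (cases "s \<le> t") auto
      qed
    qed
  qed
qed

end

section \<open>Uniform deviation of the empirical distribution function\<close>

lemma ecdf_dyadic_bracket:
  assumes n: "1 \<le> n" and t: "0 \<le> t" "t \<le> 1"
    and B: "\<And>m. m \<le> 2 ^ k \<Longrightarrow> \<bar>ecdf x n (real m / 2 ^ k) - real m / 2 ^ k\<bar> \<le> B"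
  shows "\<bar>ecdf x n t - t\<bar> \<le> B + 1 / 2 ^ k"
proof -
  define m where "m = nat \<lfloor>2 ^ k * t\<rfloor>"
  have m: "real m \<le> 2 ^ k * t" "2 ^ k * t < real m + 1" using t unfolding m_def by auto
  have "2 ^ k * t \<le> 2 ^ k" using t by simp
  hence "real m \<le> 2 ^ k" using m by linarith
  hence m2: "m \<le> 2 ^ k" by (metis of_nat_le_iff of_nat_numeral of_nat_power)
  have mt: "real m / 2 ^ k \<le> t" "t < real m / 2 ^ k + 1 / 2 ^ k"
    using m by (auto simp: field_simps)
  have lo: "ecdf x n (real m / 2 ^ k) \<le> ecdf x n t" using mt by (intro ecdf_mono)
  have up: "ecdf x n t - t \<le> B + 1 / 2 ^ k"
  proof (cases "m = 2 ^ k")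
    case True
    hence "t = 1" using mt t by simp
    thus ?thesis using B[of m] True by simp (smt (verit) zero_less_divide_iff zero_less_power)
  next
    case False
    hence "Suc m \<le> 2 ^ k" using m2 by simp
    hence "\<bar>ecdf x n (real (Suc m) / 2 ^ k) - real (Suc m) / 2 ^ k\<bar> \<le> B" by (rule B)
    moreover have "ecdf x n t \<le> ecdf x n (real (Suc m) / 2 ^ k)" using mt by (intro ecdf_mono) (simp add: add_divide_distrib)
    moreover have "real (Suc m) / 2 ^ k = real m / 2 ^ k + 1 / 2 ^ k" by (simp add: add_divide_distrib)
    ultimately show ?thesis using mt by linarith
  qed
  show ?thesis using up lo mt B[OF m2] by linarith
qed

lemma four_power_block:
  assumes "2 \<le> n" shows "\<exists>k. 4 ^ k < n \<and> n \<le> (4::nat) ^ Suc k"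
proof -
  have "\<exists>k. n \<le> (4::nat) ^ k"
  proof
    show "n \<le> 4 ^ n" by (rule less_imp_le, rule power_gt_expt) simp
  qed
  define k where "k = (LEAST k. n \<le> (4::nat) ^ k)"
  have k: "n \<le> 4 ^ k" unfolding k_def using \<open>\<exists>k. n \<le> 4 ^ k\<close> by (rule LeastI_ex)
  have "k \<noteq> 0" using k assms by (intro notI) simp
  then obtain l where l: "k = Suc l" by (cases k) auto
  have "\<not> n \<le> 4 ^ l" using not_less_Least[of l "\<lambda>k. n \<le> (4::nat) ^ k"] l unfolding k_def by simp
  thus ?thesis using k l by (intro exI[of _ l]) simp
qed

context uniform_sample
begin

text \<open>Chung--Smirnov upper bound without the sharp constant. On the block \<open>4 ^ (k-1) < n \<le> 4 ^ k\<close> dyadic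
  increments of level \<open>r \<le> k\<close> are controlled with deviation proportional to \<open>(7/8) ^ r\<close> and
  exponential tilt proportional to \<open>(4/3) ^ r\<close>: since \<open>(4/3)\<^sup>2 \<le> 2\<close> the variance term stays bounded, and since
  \<open>4/3 \<cdot> 7/8 = 7/6 > 1\<close> the tail beats the \<open>2 ^ r\<close> increments of level \<open>r\<close>.\<close>

lemma chung_smirnov_block:
  fixes k :: nat
  defines "y \<equiv> (\<lambda>r. 24 * (2 ^ k * sqrt (ln (real k))) * (7 / 8) ^ r)"
  assumes k: "3 \<le> k"
  shows "prob {\<omega>\<in>space M. \<exists>r\<in>{..k}. \<exists>j\<in>{..<2 ^ r}. \<exists>n\<in>{1..4 ^ k}.
      y r \<le> \<bar>centred_count (real j / 2 ^ r) (real (Suc j) / 2 ^ r) n \<omega>\<bar>} \<le> 4 / (real k)\<^sup>2"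
proof -
  have ln1: "1 \<le> ln (real k)" using k exp_le by (subst ln_ge_iff) auto
  have lnk: "ln (real k) \<le> real k" using k ln_le_minus_one[of "real k"] by simp
  define E where "E = (\<lambda>r j. {\<omega>\<in>space M. \<exists>n\<in>{1..4 ^ k}.
      y r \<le> \<bar>centred_count (real j / 2 ^ r) (real (Suc j) / 2 ^ r) n \<omega>\<bar>})"
  have E[measurable]: "E r j \<in> events" for r j unfolding E_def by measurable
  have one: "prob (E r j) \<le> 2 * (1 / (real k)\<^sup>2 * (1 / 4) ^ r)" if r: "r \<le> k" and j: "j < 2 ^ r" for r j
  proof -
    define \<theta> where "\<theta> = sqrt (ln (real k)) / 2 ^ k * (4 / 3) ^ r"
    have t0: "0 < \<theta>" using ln1 by (simp add: \<theta>_def)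
    have t2: "\<theta>\<^sup>2 = ln (real k) / 4 ^ k * (16 / 9) ^ r"
    proof -
      have "(2::real) ^ k * 2 ^ k = 4 ^ k" "(4 / 3 :: real) ^ r * (4 / 3) ^ r = (16 / 9) ^ r"
        by (simp_all flip: power_mult_distrib)
      moreover have "(u / v * w)\<^sup>2 = u\<^sup>2 / (v * v) * (w * w)" for u v w :: real
        by (simp add: power_mult_distrib power_divide power2_eq_square)
      ultimately show ?thesis using ln1 by (simp add: \<theta>_def)
    qed
    \<comment> \<open>The worst level is r = k. There 16/9 * 9/4 = 4 and ln k <= k <= (9/4)^k, the
      latter from Bernoulli's inequality; this is why the chaining may be carried down to mesh
      2^(-k).\<close>
    have "\<theta> \<le> 1"
    proof -
      have "real k \<le> (9 / 4) ^ k"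
        using Bernoulli_inequality[of "5/4 :: real" k] by simp
      hence "ln (real k) * (16 / 9) ^ k \<le> (9 / 4) ^ k * (16 / 9) ^ k"
        using lnk by (intro mult_right_mono) auto
      also have "\<dots> = 4 ^ k" by (simp flip: power_mult_distrib)
      finally have "ln (real k) / 4 ^ k * (16 / 9) ^ k \<le> 1" by (simp add: field_simps)
      moreover have "ln (real k) / 4 ^ k * (16 / 9) ^ r \<le> ln (real k) / 4 ^ k * (16 / 9) ^ k"
        using r ln1 by (intro mult_left_mono power_increasing) auto
      ultimately have "\<theta>\<^sup>2 \<le> 1\<^sup>2" unfolding t2 one_power2 by (rule order_trans[rotated])
      thus ?thesis by (rule power2_le_imp_le) simp
    qed
    have "real (Suc j) \<le> 2 ^ r" using j by (metis Suc_leI of_nat_le_iff of_nat_numeral of_nat_power)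
    hence st: "0 \<le> real j / 2 ^ r" "real j / 2 ^ r \<le> real (Suc j) / 2 ^ r" "real (Suc j) / 2 ^ r \<le> 1"
      by (auto simp: divide_right_mono)
    have "prob (E r j) \<le> 2 * exp (real (4 ^ k) * (real (Suc j) / 2 ^ r - real j / 2 ^ r) * \<theta>\<^sup>2 - \<theta> * y r)"
      unfolding E_def by (rule maximal_bernstein[OF st t0 \<open>\<theta> \<le> 1\<close>])
    also have "real (4 ^ k) * (real (Suc j) / 2 ^ r - real j / 2 ^ r) * \<theta>\<^sup>2 = ln (real k) * (8 / 9) ^ r"
    proof -
      have "real (Suc j) / 2 ^ r - real j / 2 ^ r = 1 / 2 ^ r" by (simp add: add_divide_distrib)
      moreover have "(16 / 9 :: real) ^ r / 2 ^ r = (8 / 9) ^ r" by (simp flip: power_divide)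
      moreover have "A * (1 / v) * (l / A * w) = l * (w / v)" if "0 < A" for A v l w :: real using that by simp
      from this[of "4 ^ k"] have "4 ^ k * (1 / 2 ^ r) * (ln (real k) / 4 ^ k * (16 / 9) ^ r) = ln (real k) * ((16 / 9) ^ r / 2 ^ r)" by simp
      ultimately show ?thesis unfolding t2 by (simp only: of_nat_power of_nat_numeral)
    qed
    also have "\<theta> * y r = 24 * ln (real k) * (7 / 6) ^ r"
    proof -
      have "(4 / 3 :: real) ^ r * (7 / 8) ^ r = (7 / 6) ^ r" by (simp flip: power_mult_distrib)
      moreover have "sqrt (ln (real k)) * sqrt (ln (real k)) = ln (real k)" using ln1 by simp
      ultimately show ?thesis unfolding \<theta>_def y_def by (simp add: mult_ac)
    qed
    \<comment> \<open>Here 24 * (1/6) = 4: Bernoulli's inequality turns the growth of (7/6)^r into 4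
      r ln k, whose exponential beats the 2^r increments of level r, and the remaining multiple of
      ln k gives the summable factor 1 / k^2.\<close>
    also have "ln (real k) * (8 / 9) ^ r - 24 * ln (real k) * (7 / 6) ^ r \<le> - 2 * ln (real k) - 4 * real r"
    proof -
      have "ln (real k) * (8 / 9) ^ r \<le> ln (real k) * 1" using ln1 by (intro mult_left_mono power_le_one) auto
      moreover have "1 + real r * (1 / 6) \<le> (7 / 6 :: real) ^ r"
        using Bernoulli_inequality[of "1/6 :: real" r] by simp
      hence "24 * ln (real k) * (1 + real r * (1 / 6)) \<le> 24 * ln (real k) * (7 / 6) ^ r"
        using ln1 by (intro mult_left_mono) auto
      moreover have "4 * real r * 1 \<le> 4 * real r * ln (real k)" using ln1 by (intro mult_left_mono) auto
      moreover have "24 * ln (real k) * (1 + real r * (1 / 6)) = 24 * ln (real k) + 4 * real r * ln (real k)"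
        by (simp add: algebra_simps)
      ultimately show ?thesis using ln1 by linarith
    qed
    hence "2 * exp (ln (real k) * (8 / 9) ^ r - 24 * ln (real k) * (7 / 6) ^ r) \<le> 2 * exp (- 2 * ln (real k) - 4 * real r)"
      by simp
    also have "exp (- 2 * ln (real k) - 4 * real r) = 1 / (real k)\<^sup>2 * exp (- 4) ^ r"
    proof -
      have "exp (2 * ln (real k)) = (real k)\<^sup>2" using exp_of_nat_mult[of 2 "ln (real k)"] k by simp
      thus ?thesis using exp_of_nat_mult[of r "- 4 :: real"]
        by (simp add: exp_diff exp_minus divide_inverse power_inverse mult.commute)
    qed
    also have "\<dots> \<le> 1 / (real k)\<^sup>2 * (1 / 4) ^ r"
    proof -
      have "(4::real) \<le> exp 4" using exp_ge_add_one_self[of "4::real"] by linarith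
      hence "exp (- 4) \<le> (1 / 4 :: real)" by (simp add: exp_minus field_simps)
      thus ?thesis by (intro mult_left_mono power_mono) auto
    qed
    finally show ?thesis by simp
  qed
  have "prob {\<omega>\<in>space M. \<exists>r\<in>{..k}. \<exists>j\<in>{..<2 ^ r}. \<exists>n\<in>{1..4 ^ k}.
      y r \<le> \<bar>centred_count (real j / 2 ^ r) (real (Suc j) / 2 ^ r) n \<omega>\<bar>} \<le> prob (\<Union>r\<in>{..k}. \<Union>j\<in>{..<2 ^ r}. E r j)"
    by (intro finite_measure_mono) (auto simp: E_def)
  also have "\<dots> \<le> (\<Sum>r\<in>{..k}. prob (\<Union>j\<in>{..<2 ^ r}. E r j))" by (rule measure_UNION_le) auto
  also have "\<dots> \<le> (\<Sum>r\<in>{..k}. \<Sum>j\<in>{..<2 ^ r}. prob (E r j))" by (intro sum_mono measure_UNION_le) auto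
  also have "\<dots> \<le> (\<Sum>r\<in>{..k}. \<Sum>j\<in>{..<(2::nat) ^ r}. 2 * (1 / (real k)\<^sup>2 * (1 / 4) ^ r))" by (intro sum_mono one) auto
  also have "\<dots> = (\<Sum>r\<in>{..k}. 2 / (real k)\<^sup>2 * (1 / 2) ^ r)"
  proof (rule sum.cong[OF refl])
    fix r
    have "(2::real) ^ r * (1 / 4) ^ r = (1 / 2) ^ r" by (simp flip: power_mult_distrib)
    thus "(\<Sum>j\<in>{..<(2::nat) ^ r}. 2 * (1 / (real k)\<^sup>2 * (1 / 4) ^ r)) = 2 / (real k)\<^sup>2 * (1 / 2) ^ r" by (simp add: field_simps)
  qed
  also have "\<dots> = 2 / (real k)\<^sup>2 * (\<Sum>r\<le>k. (1 / 2) ^ r)" by (simp only: sum_distrib_left)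
  also have "\<dots> \<le> 2 / (real k)\<^sup>2 * 2"
  proof (rule mult_left_mono)
    show "(\<Sum>r\<le>k. (1 / 2 :: real) ^ r) \<le> 2"
      using sum_gp_basic[of "1/2 :: real" k] by simp
  qed simp
  finally show ?thesis by simp
qed

text \<open>On a block 2^k is comparable with sqrt n, and ln k with ln ln n. The level bounds sum to
  at most 24 * 8 = 192 times 2^k sqrt(ln k), the dyadic mesh adds 1, and 2^k <= 2 sqrt n doubles the
  result: 386 = 2 * 193.\<close>

lemma chung_smirnov:
  "AE \<omega> in M. \<forall>\<^sub>F n in sequentially. \<forall>t\<in>{0..1}.
     \<bar>ecdf (\<lambda>i. U i \<omega>) n t - t\<bar> \<le> 386 * sqrt (ln (ln (real n)) / real n)"
proof -
  define y where "y = (\<lambda>k r. 24 * (2 ^ k * sqrt (ln (real k))) * (7 / 8 :: real) ^ r)"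
  define bad where "bad = (\<lambda>k \<omega>. \<exists>r\<in>{..k}. \<exists>j\<in>{..<2 ^ r}. \<exists>n\<in>{1..4 ^ k}.
      y k r \<le> \<bar>centred_count (real j / 2 ^ r) (real (Suc j) / 2 ^ r) n \<omega>\<bar>)"
  have "AE \<omega> in M. \<forall>\<^sub>F k in sequentially. \<not> bad k \<omega>"
  proof (rule AE_eventually_not)
    show "{\<omega>\<in>space M. bad k \<omega>} \<in> events" for k unfolding bad_def by measurable
    show "\<forall>\<^sub>F k in sequentially. prob {\<omega>\<in>space M. bad k \<omega>} \<le> 4 / (real k)\<^sup>2"
      unfolding bad_def y_def using chung_smirnov_block by (intro eventually_sequentiallyI[of 3])
  qed (rule inverse_square_summable_mult)
  thus ?thesis using AE_sample_in_unit
  proof eventually_elim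
    case (elim \<omega>)
    then obtain k0 where k0: "\<And>k. k0 \<le> k \<Longrightarrow> \<not> bad k \<omega>" by (auto simp: eventually_sequentially)
    define x where "x = (\<lambda>i. U i \<omega>)"
    have ecdf0: "ecdf x n 0 = 0" for n
    proof -
      have "{i\<in>{1..n}. x i \<le> 0} = {}" using elim(2) by (force simp: x_def)
      thus ?thesis by (simp add: ecdf_def)
    qed
    \<comment> \<open>The threshold places n in a block with k >= k0 + 4. Besides k >= k0 this
      yields l = k - 1 >= 3, hence k <= 4 l / 3 <= 2 l ln 2 <= ln n below.\<close>
    have "\<bar>ecdf x n t - t\<bar> \<le> 386 * sqrt (ln (ln (real n)) / real n)"
      if n: "4 ^ (k0 + 4) \<le> n" and t: "t \<in> {0..1}" for n t
    proof -
      have n256: "256 \<le> n" using n power_increasing[of 4 "k0 + 4" "4::nat"] by simp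
      hence n0: "0 < real n" by simp
      obtain l where l: "4 ^ l < n" "n \<le> 4 ^ Suc l" using four_power_block[of n] n256 by auto
      define k where "k = Suc l"
      have "(4::nat) ^ (k0 + 4) \<le> 4 ^ Suc l" using n l by linarith
      hence kk: "k0 + 4 \<le> k" unfolding k_def by (subst (asm) power_increasing_iff) auto
      have good: "\<not> bad k \<omega>" using kk by (intro k0) simp
      have ln1: "1 \<le> ln (real k)" using kk exp_le by (subst ln_ge_iff) auto
      define g where "g = (\<lambda>t. real n * (ecdf x n t - t))"
      have "\<bar>g (real m / 2 ^ k) - g 0\<bar> \<le> (\<Sum>q\<le>k. y k q)" if m: "m \<le> 2 ^ k" for m
      proof (rule dyadic_chaining[OF _ m])
        show "0 \<le> y k q" for q using ln1 by (simp add: y_def)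
        fix q j assume qj: "q \<le> k" "j < (2::nat) ^ q"
        have "n \<in> {1..4 ^ k}" using n256 l by (auto simp: k_def)
        hence "\<bar>centred_count (real j / 2 ^ q) (real (Suc j) / 2 ^ q) n \<omega>\<bar> < y k q"
          using good qj unfolding bad_def by (force simp: not_le)
        moreover have "centred_count (real j / 2 ^ q) (real (Suc j) / 2 ^ q) n \<omega> = g (real (Suc j) / 2 ^ q) - g (real j / 2 ^ q)"
          using n256 by (subst centred_count_eq_ecdf) (auto simp: g_def x_def right_diff_distrib divide_right_mono)
        ultimately show "\<bar>g (real (Suc j) / 2 ^ q) - g (real j / 2 ^ q)\<bar> \<le> y k q" by simp
      qed
      moreover have "g 0 = 0" by (simp add: g_def ecdf0)
      moreover have "(\<Sum>q\<le>k. y k q) \<le> 192 * (2 ^ k * sqrt (ln (real k)))"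
      proof -
        have "(\<Sum>q\<le>k. (7 / 8 :: real) ^ q) \<le> 8" using sum_gp_basic[of "7/8 :: real" k] by simp
        hence "24 * (2 ^ k * sqrt (ln (real k))) * (\<Sum>q\<le>k. (7 / 8) ^ q) \<le> 24 * (2 ^ k * sqrt (ln (real k))) * 8"
          using ln1 by (intro mult_left_mono) auto
        thus ?thesis unfolding y_def by (simp add: sum_distrib_left)
      qed
      ultimately have gb: "\<bar>g (real m / 2 ^ k)\<bar> \<le> 192 * (2 ^ k * sqrt (ln (real k)))" if "m \<le> 2 ^ k" for m
        using that by force
      define B where "B = 192 * (2 ^ k * sqrt (ln (real k))) / real n"
      have "\<bar>ecdf x n t - t\<bar> \<le> B + 1 / 2 ^ k"
      proof (rule ecdf_dyadic_bracket)
        fix m assume m: "m \<le> (2::nat) ^ k"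
        have "real n * \<bar>ecdf x n (real m / 2 ^ k) - real m / 2 ^ k\<bar> \<le> 192 * (2 ^ k * sqrt (ln (real k)))"
          using gb[OF m] n0 by (simp add: g_def abs_mult)
        thus "\<bar>ecdf x n (real m / 2 ^ k) - real m / 2 ^ k\<bar> \<le> B"
          using n0 by (simp add: B_def pos_le_divide_eq mult.commute)
      qed (use t n256 in auto)
      also have "1 / 2 ^ k \<le> 2 ^ k / real n"
      proof -
        have "real n \<le> real (4 ^ k)" using l unfolding k_def by (intro of_nat_mono)
        also have "\<dots> = 2 ^ k * 2 ^ k" by (simp flip: power_mult_distrib)
        finally show ?thesis using n0 by (simp add: field_simps)
      qed
      also have "2 ^ k / real n \<le> 2 ^ k * sqrt (ln (real k)) / real n"
        using ln1 n0 by (intro divide_right_mono) auto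
      finally have "\<bar>ecdf x n t - t\<bar> \<le> 193 * (2 ^ k * sqrt (ln (real k)) / real n)" by (simp add: B_def mult.commute)
      also have "\<dots> \<le> 193 * (2 * sqrt (real n) * sqrt (ln (ln (real n))) / real n)"
      proof -
        have "(2 ^ l)\<^sup>2 = (4::real) ^ l" by (simp add: power2_eq_square flip: power_mult_distrib)
        also have "(4::real) ^ l = real (4 ^ l)" by simp
        also have "\<dots> \<le> real n" using l by (intro of_nat_mono) simp
        finally have "2 ^ l \<le> sqrt (real n)" by (rule real_le_rsqrt)
        hence p: "2 ^ k \<le> 2 * sqrt (real n)" by (simp add: k_def)
        have "ln (real (4 ^ l)) \<le> ln (real n)" using l by (subst ln_le_cancel_iff) auto
        moreover have "ln (real (4 ^ l)) = real l * (2 * ln 2)"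
          using ln_realpow[of 4 l] ln_realpow[of 2 2] by simp
        moreover have "real l * (2 * (2 / 3)) \<le> real l * (2 * ln 2)" using ln2_ge_two_thirds by (intro mult_left_mono) auto
        moreover have "real k \<le> real l * (2 * (2 / 3))" using kk by (simp add: k_def)
        ultimately have "real k \<le> ln (real n)" by linarith
        hence "ln (real k) \<le> ln (ln (real n))" using kk by (subst ln_le_cancel_iff) auto
        thus ?thesis using p n0 ln1 by (intro mult_left_mono divide_right_mono mult_mono) auto
      qed
      also have "2 * sqrt (real n) * sqrt (ln (ln (real n))) / real n = 2 * sqrt (ln (ln (real n)) / real n)"
      proof -
        have "2 * u * v / (u * u) = 2 * (v / u)" if "0 < u" for u v :: real using that by simp
        from this[of "sqrt (real n)"] show ?thesis using n0 by (simp add: real_sqrt_divide)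
      qed
      finally show ?thesis by simp
    qed
    thus ?case unfolding x_def eventually_sequentially by blast
  qed
qed

end

section \<open>Lower bound for sums of consecutive spacings\<close>

lemma card_between_order_stats:
  assumes "1 \<le> i" "i + m \<le> n" "s < order_stat x n i" "order_stat x n (i + m) \<le> t"
  shows "real m \<le> (\<Sum>k = 1..n. indicator {s<..t} (x k))"
proof -
  let ?lo = "order_stat x n i" and ?hi = "order_stat x n (i + m)"
  have "{k\<in>{1..n}. x k \<le> ?hi} \<subseteq> {k\<in>{1..n}. x k < ?lo} \<union> {k\<in>{1..n}. x k \<in> {s<..t}}"
    using assms by auto
  hence "card {k\<in>{1..n}. x k \<le> ?hi} \<le> card ({k\<in>{1..n}. x k < ?lo} \<union> {k\<in>{1..n}. x k \<in> {s<..t}})"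
    by (intro card_mono) auto
  also have "\<dots> \<le> card {k\<in>{1..n}. x k < ?lo} + card {k\<in>{1..n}. x k \<in> {s<..t}}" by (rule card_Un_le)
  finally have "m \<le> card {k\<in>{1..n}. x k \<in> {s<..t}}"
    using card_less_order_stat[of i n x] card_le_order_stat[of "i + m" n x] assms by linarith
  moreover have "(\<Sum>k = 1..n. indicator {s<..t} (x k) :: real) = (\<Sum>k\<in>{k\<in>{1..n}. x k \<in> {s<..t}}. 1)"
    unfolding indicator_def of_bool_def by (rule sum.inter_filter[symmetric]) simp
  ultimately show ?thesis by simp
qed

context uniform_sample
begin

text \<open>If \<open>m\<close> consecutive spacings are shorter than \<open>w\<close> in total, one of the cells \<open>((j-1)w, (j+1)w]\<close> contains
  more than \<open>m\<close> points; \<open>w\<close> is chosen so that the Chernoff bound for each cell is \<open>n ^ (-4)\<close>.\<close>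

lemma spacings_lower_bound:
  fixes m :: "nat \<Rightarrow> nat"
  assumes m: "\<forall>\<^sub>F n in sequentially. 4 \<le> m n"
  defines "w \<equiv> (\<lambda>n. real (m n) / (2 * real n * exp (1 + 4 * ln (real n) / real (m n))))"
  shows "AE \<omega> in M. \<forall>\<^sub>F n in sequentially. \<forall>i\<ge>1. i + m n \<le> n \<longrightarrow>
     w n < order_stat (\<lambda>i. U i \<omega>) n (i + m n) - order_stat (\<lambda>i. U i \<omega>) n i"
proof -
  \<comment> \<open>Chosen together with \<open>w\<close>: \<theta> m = m + 4 ln n, while 2 n w exp
    \<theta> = m. A cell has length at most 2 w, so its Chernoff exponent is at most m - \<theta> m
    = - 4 ln n.\<close>
  define \<theta> where "\<theta> = (\<lambda>n. 1 + 4 * ln (real n) / real (m n))"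
  \<comment> \<open>The cells overlap and have twice the width w, so a window of length w whose left
    end lies in ((j - 1) w, j w] is contained in cell j; the last cells are cut off at 1.\<close>
  define lo hi where "lo = (\<lambda>n j. (real j - 1) * w n)" and "hi = (\<lambda>n j. min 1 ((real j + 1) * w n))"
  define J where "J = (\<lambda>n. nat \<lceil>1 / w n\<rceil>)"
  define cell where "cell = (\<lambda>n j \<omega>. \<theta> n * (real (m n) - real n * (hi n j - lo n j)) \<le> \<theta> n * centred_count (lo n j) (hi n j) n \<omega>)"
  define bad where "bad = (\<lambda>n \<omega>. \<exists>j\<in>{1..J n}. cell n j \<omega>)"
  have cell_meas[measurable]: "{\<omega>\<in>space M. cell n j \<omega>} \<in> events" for n j unfolding cell_def by measurable
  have basic: "0 < w n \<and> 1 / w n \<le> 2 * (real n)\<^sup>2 \<and> 2 * real n * w n * exp (\<theta> n) = real (m n) \<and> 1 \<le> \<theta> n"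
    if "4 \<le> m n" "3 \<le> n" for n
  proof -
    have m0: "0 < real (m n)" "0 < real n" using that by auto
    have ln0: "0 \<le> ln (real n)" using that by simp
    have "4 * ln (real n) / real (m n) \<le> ln (real n)"
      using that m0 ln0 mult_right_mono[of 4 "real (m n)" "ln (real n)"] by (simp add: field_simps)
    hence "exp (\<theta> n) \<le> exp (1 + ln (real n))" by (simp add: \<theta>_def)
    also have "\<dots> = exp 1 * real n" using m0 by (simp add: exp_add)
    also have "\<dots> \<le> 3 * real n" using exp_le by (intro mult_right_mono) auto
    finally have "exp (\<theta> n) \<le> 3 * real n" .
    moreover have "1 / w n = 2 * real n * exp (\<theta> n) / real (m n)" by (simp add: w_def \<theta>_def)
    moreover have "2 * real n * exp (\<theta> n) / real (m n) \<le> 2 * real n * exp (\<theta> n) / 4"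
      using that by (intro divide_left_mono) auto
    ultimately have "1 / w n \<le> 2 * real n * (3 * real n) / 4"
      using m0 by (smt (verit) divide_right_mono mult_left_mono)
    also have "\<dots> \<le> 2 * (real n)\<^sup>2" by (simp add: power2_eq_square)
    finally show ?thesis using m0 ln0 by (simp add: w_def \<theta>_def)
  qed
  have "AE \<omega> in M. \<forall>\<^sub>F n in sequentially. \<not> bad n \<omega>"
  proof (rule AE_eventually_not)
    show "{\<omega>\<in>space M. bad n \<omega>} \<in> events" for n unfolding bad_def cell_def by measurable
    show "summable (\<lambda>n. 3 / (real n)\<^sup>2)" by (rule inverse_square_summable_mult)
    show "\<forall>\<^sub>F n in sequentially. prob {\<omega>\<in>space M. bad n \<omega>} \<le> 3 / (real n)\<^sup>2"
      using m eventually_ge_at_top[of 3]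
    proof eventually_elim
      case (elim n)
      have w0: "0 < w n" and J1: "1 / w n \<le> 2 * (real n)\<^sup>2" and wt: "2 * real n * w n * exp (\<theta> n) = real (m n)" and t1: "1 \<le> \<theta> n"
        using basic[OF elim] by auto
      have n0: "0 < real n" using elim by simp
      have one: "prob {\<omega>\<in>space M. cell n j \<omega>} \<le> 1 / real n ^ 4" if j: "j \<in> {1..J n}" for j
      proof -
        have "real j - 1 < 1 / w n" using j unfolding J_def by simp linarith
        hence lo1: "lo n j < 1" using w0 by (simp add: lo_def field_simps)
        have lo0: "0 \<le> lo n j" using j w0 by (simp add: lo_def)
        have lohi: "lo n j \<le> hi n j" using lo1 w0 by (simp add: hi_def lo_def)
        have hi1: "hi n j \<le> 1" by (simp add: hi_def)
        let ?p = "hi n j - lo n j"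
        have p: "?p \<le> 2 * w n" by (simp add: hi_def lo_def min_def algebra_simps)
        have "prob {\<omega>\<in>space M. cell n j \<omega>} \<le> prob {\<omega>\<in>space M. \<exists>l\<in>{1..n}. \<theta> n * (real (m n) - real n * ?p) \<le> \<theta> n * centred_count (lo n j) (hi n j) l \<omega>}"
          using elim by (intro finite_measure_mono) (auto simp: cell_def intro!: bexI[of _ n])
        also have "\<dots> \<le> exp (real n * ?p * (exp (\<theta> n) - 1 - \<theta> n) - \<theta> n * (real (m n) - real n * ?p))"
          by (rule maximal_chernoff[OF lo0 lohi hi1])
        also have "\<dots> \<le> exp (- 4 * ln (real n))"
        proof -
          have "real n * ?p * exp (\<theta> n) \<le> real n * (2 * w n) * exp (\<theta> n)"
            using p by (intro mult_right_mono mult_left_mono) auto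
          also have "\<dots> = real (m n)" using wt by (simp add: mult_ac)
          finally have 1: "real n * ?p * exp (\<theta> n) \<le> real (m n)" .
          have 2: "0 \<le> real n * ?p" using lohi by simp
          have 3: "\<theta> n * real (m n) = real (m n) + 4 * ln (real n)" using elim by (simp add: \<theta>_def distrib_right)
          have "real n * ?p * (exp (\<theta> n) - 1 - \<theta> n) - \<theta> n * (real (m n) - real n * ?p)
             = real n * ?p * exp (\<theta> n) - real n * ?p - \<theta> n * real (m n)" by (simp add: algebra_simps)
          also have "\<dots> \<le> - 4 * ln (real n)" using 1 2 3 by linarith
          finally show ?thesis by simp
        qed
        also have "\<dots> = 1 / real n ^ 4"
          using exp_of_nat_mult[of 4 "ln (real n)"] n0 by (simp add: exp_minus inverse_eq_divide)
        finally show ?thesis .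
      qed
      have "prob {\<omega>\<in>space M. bad n \<omega>} \<le> prob (\<Union>j\<in>{1..J n}. {\<omega>\<in>space M. cell n j \<omega>})"
        by (intro finite_measure_mono) (auto simp: bad_def)
      also have "\<dots> \<le> (\<Sum>j\<in>{1..J n}. prob {\<omega>\<in>space M. cell n j \<omega>})" by (rule measure_UNION_le) auto
      also have "\<dots> \<le> (\<Sum>j\<in>{1..J n}. 1 / real n ^ 4)" by (rule sum_mono[OF one])
      also have "\<dots> = real (J n) * (1 / real n ^ 4)" by simp
      also have "\<dots> \<le> 3 * (real n)\<^sup>2 * (1 / real n ^ 4)"
      proof (rule mult_right_mono)
        have "0 < 1 / w n" using w0 by simp
        hence "real (J n) \<le> 1 / w n + 1" unfolding J_def by linarith
        moreover have "1 \<le> (real n)\<^sup>2" using elim by simp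
        ultimately show "real (J n) \<le> 3 * (real n)\<^sup>2" using J1 by linarith
      qed simp
      also have "\<dots> = 3 / (real n)\<^sup>2"
      proof -
        have e: "real n ^ 4 = (real n)\<^sup>2 * (real n)\<^sup>2" by (simp flip: power_add)
        have "3 * u * (1 / (u * u)) = 3 / u" if "0 < u" for u :: real using that by simp
        thus ?thesis unfolding e using n0 by (metis zero_less_power)
      qed
      finally show ?case .
    qed
  qed
  thus ?thesis using AE_sample_in_unit
  proof eventually_elim
    case (elim \<omega>)
    note pos = elim(2)
    show ?case using elim(1) m eventually_ge_at_top[of 3]
    proof eventually_elim
      case (elim n)
      have w0: "0 < w n" and t1: "1 \<le> \<theta> n" using basic[OF elim(2,3)] by auto
      define x where "x = (\<lambda>i. U i \<omega>)"
      show ?case unfolding x_def[symmetric]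
      proof (intro allI impI, rule ccontr)
        fix i assume i: "1 \<le> i" "i + m n \<le> n" and "\<not> w n < order_stat x n (i + m n) - order_stat x n i"
        hence short: "order_stat x n (i + m n) \<le> order_stat x n i + w n" by simp
        have os: "0 < order_stat x n k \<and> order_stat x n k \<le> 1" if "1 \<le> k" "k \<le> n" for k
          using order_stat_eq_sample[OF that, of x] pos by (auto simp: x_def)
        define j where "j = nat \<lceil>order_stat x n i / w n\<rceil>"
        have q: "0 < order_stat x n i / w n" using os[of i] i w0 by simp
        hence j: "real j - 1 < order_stat x n i / w n" "order_stat x n i / w n \<le> real j" unfolding j_def by linarith+
        have "1 \<le> j" using q unfolding j_def by linarith
        moreover have "j \<le> J n"
          unfolding j_def J_def using os[of i] i w0 by (intro nat_mono ceiling_mono divide_right_mono) auto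
        ultimately have jJ: "j \<in> {1..J n}" by simp
        have lo: "lo n j < order_stat x n i" using j w0 by (simp add: lo_def field_simps)
        have "order_stat x n i \<le> real j * w n" using j w0 by (simp add: field_simps)
        hence hi: "order_stat x n (i + m n) \<le> hi n j"
          using short os[of "i + m n"] i by (simp add: hi_def distrib_right)
        have "real (m n) \<le> (\<Sum>k = 1..n. indicator {lo n j<..hi n j} (x k))"
          by (rule card_between_order_stats[OF i lo hi])
        moreover have "centred_count (lo n j) (hi n j) n \<omega> = (\<Sum>k = 1..n. indicator {lo n j<..hi n j} (x k)) - real n * (hi n j - lo n j)"
          unfolding centred_count_def x_def by (subst sum_subtractf) simp
        ultimately have "cell n j \<omega>" using t1 unfolding cell_def by (intro mult_left_mono) auto
        thus False using elim(1) jJ unfolding bad_def by blast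
      qed
    qed
  qed
qed

end

subsection \<open>Kernel estimators\<close>

locale kernel =
  fixes K :: "real \<Rightarrow> real" and L :: real
  assumes nonneg: "\<And>z. 0 \<le> K z"
    and lip: "\<And>x y. \<bar>K x - K y\<bar> \<le> L * \<bar>x - y\<bar>"
    and supp: "\<And>z. z \<notin> {-1..1} \<Longrightarrow> K z = 0"
    and int1: "(K has_integral 1) UNIV"
begin

lemma L_nonneg: "0 \<le> L"
  using lip[of 0 1] by simp

text \<open>\<open>supp\<close> only covers points outside the closed interval. At the endpoints a
  positive value would persist a little further out by the Lipschitz property. Summation by parts
  needs these zeros, since its boundary terms sit at u - h and u + h. The \<open>L + 1\<close> in
  \<open>e\<close> avoids division by zero.\<close>

lemma K_zero: assumes "1 \<le> \<bar>z\<bar>" shows "K z = 0"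
proof (rule ccontr)
  assume "K z \<noteq> 0"
  hence k: "0 < K z" using nonneg[of z] by simp
  define e where "e = K z / 2 / (L + 1)"
  have e: "0 < e" using k L_nonneg by (simp add: e_def)
  define z' where "z' = z + sgn z * e"
  have "z' \<notin> {-1..1}" using assms e by (auto simp: z'_def sgn_if abs_if split: if_splits)
  hence "K z' = 0" by (rule supp)
  hence "K z \<le> L * \<bar>z - z'\<bar>" using lip[of z z'] k by simp
  also have "\<bar>z - z'\<bar> = e" using assms e by (auto simp: z'_def sgn_if)
  also have "L * e \<le> (L + 1) * e" using e by simp
  also have "\<dots> = K z / 2" unfolding e_def using L_nonneg by (intro nonzero_mult_div_cancel_left[THEN trans[OF times_divide_eq_right]]) simp
  finally show False using k by simp
qed

lemma Kh_nonneg: "0 < h \<Longrightarrow> 0 \<le> Kh K h z"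
  using nonneg by (simp add: Kh_def)

lemma Kh_zero: assumes "0 < h" "h \<le> \<bar>z\<bar>" shows "Kh K h z = 0"
  using assms K_zero[of "z / h"] by (simp add: Kh_def)

lemma Kh_lip: assumes "0 < h" shows "\<bar>Kh K h (u - x) - Kh K h (u - y)\<bar> \<le> L / h\<^sup>2 * \<bar>x - y\<bar>"
proof -
  have "\<bar>K ((u - x) / h) - K ((u - y) / h)\<bar> \<le> L * \<bar>(u - x) / h - (u - y) / h\<bar>" by (rule lip)
  also have "(u - x) / h - (u - y) / h = - ((x - y) / h)" by (simp add: diff_divide_distrib)
  also have "\<bar>- ((x - y) / h)\<bar> = \<bar>x - y\<bar> / h" using assms by simp
  finally have "\<bar>K ((u - x) / h) - K ((u - y) / h)\<bar> / h \<le> L * (\<bar>x - y\<bar> / h) / h"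
    using assms by (intro divide_right_mono) auto
  thus ?thesis using assms by (simp add: Kh_def power2_eq_square diff_divide_distrib[symmetric])
qed

lemma Kh_has_integral:
  assumes h: "0 < h" shows "((\<lambda>x. Kh K h (u - x)) has_integral 1) {u - h..u + h}"
proof -
  have "(\<lambda>x. if x \<in> {-1..1} then K x else 0) = K" using supp by auto
  hence "(K has_integral 1) {-1..1}"
    using int1 has_integral_restrict_UNIV[of "{-1..1}" K 1] by simp
  hence "((\<lambda>x. K ((- 1 / h) *\<^sub>R x + u / h)) has_integral (1 / \<bar>- 1 / h\<bar> ^ DIM(real)) *\<^sub>R 1)
     ((\<lambda>x. (1 / (- 1 / h)) *\<^sub>R x + - ((1 / (- 1 / h)) *\<^sub>R (u / h))) ` cbox (-1) 1)"
    using h by (intro has_integral_affinity) auto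
  also have "(\<lambda>x. (1 / (- 1 / h)) *\<^sub>R x + - ((1 / (- 1 / h)) *\<^sub>R (u / h))) ` cbox (-1) (1::real) = {u - h..u + h}"
    using h image_affinity_atLeastAtMost[of "- h" u "-1" 1] by simp
  also have "(1 / \<bar>- 1 / h\<bar> ^ DIM(real)) *\<^sub>R (1::real) = h" using h by simp
  finally have "((\<lambda>x. K ((- 1 / h) *\<^sub>R x + u / h)) has_integral h) {u - h..u + h}" .
  hence "((\<lambda>x. K ((- 1 / h) *\<^sub>R x + u / h) / h) has_integral h / h) {u - h..u + h}"
    by (rule has_integral_divide)
  moreover have "(\<lambda>x. K ((- 1 / h) *\<^sub>R x + u / h) / h) = (\<lambda>x. Kh K h (u - x))"
    by (simp add: Kh_def diff_divide_distrib)
  ultimately show ?thesis using h by simp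
qed

text \<open>The kernel may vanish near 0, so the window for the lower bound on \<open>qhat\<close>
  is placed around some \<open>z0\<close> with \<open>K z0\<close> positive; the Lipschitz property
  keeps K above half that value there.\<close>

lemma exists_positive_interval:
  "\<exists>z0 \<rho> c. 0 < \<rho> \<and> 0 < c \<and> (\<forall>z. \<bar>z - z0\<bar> \<le> \<rho> \<longrightarrow> c \<le> K z)"
proof -
  have "\<exists>z0. K z0 \<noteq> 0"
  proof (rule ccontr)
    assume "\<not> ?thesis"
    hence "K = (\<lambda>_. 0)" by auto
    thus False using int1 by (metis has_integral_0_eq zero_neq_one)
  qed
  then obtain z0 where z0: "0 < K z0" using nonneg by (metis less_eq_real_def)
  define \<rho> where "\<rho> = K z0 / 2 / (L + 1)"
  have r: "0 < \<rho>" using z0 L_nonneg by (simp add: \<rho>_def)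
  have "K z0 / 2 \<le> K z" if "\<bar>z - z0\<bar> \<le> \<rho>" for z
  proof -
    have "\<bar>K z - K z0\<bar> \<le> L * \<bar>z - z0\<bar>" by (rule lip)
    also have "\<dots> \<le> (L + 1) * \<rho>" using that L_nonneg by (intro mult_mono) auto
    also have "\<dots> = K z0 / 2" unfolding \<rho>_def using L_nonneg by (intro nonzero_mult_div_cancel_left[THEN trans[OF times_divide_eq_right]]) simp
    finally show ?thesis by linarith
  qed
  thus ?thesis using r z0 by (intro exI[of _ z0] exI[of _ \<rho>] exI[of _ "K z0 / 2"]) auto
qed

text \<open>By parts against \<open>ecdf U n\<close> minus the identity, recentred at u: only the
  oscillation over distance h enters, not the supremum. This makes the deviation of order sqrt(ln n
  / (n h)) when n h >= ln n, and so its square affordable.\<close>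

lemma kernel_density_deviation:
  fixes U :: "nat \<Rightarrow> real"
  assumes n: "1 \<le> n" and h: "0 < h" and u: "h \<le> u" "u \<le> 1 - h"
    and osc: "\<And>t. 0 \<le> t \<Longrightarrow> t \<le> 1 \<Longrightarrow> \<bar>t - u\<bar> \<le> h \<Longrightarrow> \<bar>(ecdf U n t - t) - (ecdf U n u - u)\<bar> \<le> B"
  shows "\<bar>1 / real n * (\<Sum>i = 1..n. Kh K h (u - U i)) - 1\<bar> \<le> 2 * L * B / h"
proof -
  have "\<bar>(\<Sum>i\<in>{1..n}. 1 / real n * Kh K h (u - U i)) - 1 * integral {u - h..u + h} (\<lambda>x. Kh K h (u - x))\<bar>
      \<le> B * (L / h\<^sup>2) * ((u + h) - (u - h))"
  proof (rule stieltjes_by_parts_bound[where w = "ecdf U n u - u"])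
    show "u - h < u + h" using h by simp
    show "\<bar>Kh K h (u - x) - Kh K h (u - y)\<bar> \<le> L / h\<^sup>2 * \<bar>x - y\<bar>" for x y by (rule Kh_lip[OF h])
    show "Kh K h (u - x) = 0" if "x \<le> u - h \<or> u + h \<le> x" for x using that h by (intro Kh_zero) auto
    show "\<bar>(\<Sum>i\<in>{1..n}. 1 / real n * (if U i \<le> t then 1 else 0)) - 1 * t - (ecdf U n u - u)\<bar> \<le> B"
      if "u - h \<le> t" "t < u + h" for t
      using osc[of t] that u h unfolding ecdf_eq_sum[symmetric] by simp
  qed simp
  also have "integral {u - h..u + h} (\<lambda>x. Kh K h (u - x)) = 1" using Kh_has_integral[OF h] by (rule integral_unique)
  also have "B * (L / h\<^sup>2) * ((u + h) - (u - h)) = 2 * L * B / h" using h by (simp add: power2_eq_square)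
  finally show ?thesis by (simp add: sum_distrib_left)
qed

text \<open>The two kernel sums form one Stieltjes sum against \<open>Qhat\<close> +
  \<open>ecdf\<close>, which up to a constant differs from 2 t by the Bahadur--Kiefer remainder
  alone: the first order fluctuations of both cancel before the kernel is applied.\<close>

lemma spacing_density_plus_kernel_density:
  fixes U :: "nat \<Rightarrow> real"
  assumes n: "1 \<le> n" and h: "0 < h" and u: "h \<le> u" "u \<le> 1 - h"
    and U: "\<And>i. 1 \<le> i \<Longrightarrow> 0 < U i \<and> U i \<le> 1"
    and D: "\<And>t. 0 \<le> t \<Longrightarrow> t \<le> 1 \<Longrightarrow> \<bar>ecdf U n t - t\<bar> \<le> D" and "D < a"
    and osc: "\<And>s t. 0 \<le> s \<Longrightarrow> s \<le> 1 \<Longrightarrow> 0 \<le> t \<Longrightarrow> t \<le> 1 \<Longrightarrow> \<bar>s - t\<bar> \<le> a \<Longrightarrow>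
                \<bar>(ecdf U n s - s) - (ecdf U n t - t)\<bar> \<le> B"
  shows "\<bar>qhat K h U n u + 1 / real n * (\<Sum>i = 1..n. Kh K h (u - U i)) - 2\<bar> \<le> 2 * L * B / h"
proof -
  let ?I = "{1..n - 1} <+> {1..n}"
  define c :: "nat + nat \<Rightarrow> real" where "c = (\<lambda>k. case k of Inl i \<Rightarrow> order_stat U n (i + 1) - order_stat U n i | Inr i \<Rightarrow> 1 / real n)"
  define x :: "nat + nat \<Rightarrow> real" where "x = (\<lambda>k. case k of Inl i \<Rightarrow> real i / real n | Inr i \<Rightarrow> U i)"
  have sm: "(\<Sum>k\<in>?I. c k * f (x k)) = (\<Sum>i = 1..n - 1. (order_stat U n (i + 1) - order_stat U n i) * f (real i / real n))
      + (\<Sum>i = 1..n. 1 / real n * f (U i))" for f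
    by (subst sum.Plus) (auto simp: c_def x_def)
  have "\<bar>(\<Sum>k\<in>?I. c k * Kh K h (u - x k)) - 2 * integral {u - h..u + h} (\<lambda>x. Kh K h (u - x))\<bar>
      \<le> B * (L / h\<^sup>2) * ((u + h) - (u - h))"
  proof (rule stieltjes_by_parts_bound[where w = "- order_stat U n 1"])
    show "u - h < u + h" using h by simp
    show "\<bar>Kh K h (u - x) - Kh K h (u - y)\<bar> \<le> L / h\<^sup>2 * \<bar>x - y\<bar>" for x y by (rule Kh_lip[OF h])
    show "Kh K h (u - x) = 0" if "x \<le> u - h \<or> u + h \<le> x" for x using that h by (intro Kh_zero) auto
    show "\<bar>(\<Sum>k\<in>?I. c k * (if x k \<le> t then 1 else 0)) - 2 * t - - order_stat U n 1\<bar> \<le> B"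
      if t: "u - h \<le> t" "t < u + h" for t
    proof -
      have t': "0 \<le> t" "t < 1" using t u by auto
      have "(\<Sum>k\<in>?I. c k * (if x k \<le> t then 1 else 0)) = Qhat U n t - order_stat U n 1 + ecdf U n t"
        using sm[of "\<lambda>y. if y \<le> t then 1 else 0"] unfolding sum_spacings_eq_Qhat[OF n t'] ecdf_eq_sum .
      thus ?thesis using bahadur_kiefer_le_oscillation[OF n U t' D \<open>D < a\<close> osc] by (simp add: algebra_simps)
    qed
  qed simp
  also have "integral {u - h..u + h} (\<lambda>x. Kh K h (u - x)) = 1" using Kh_has_integral[OF h] by (rule integral_unique)
  also have "B * (L / h\<^sup>2) * ((u + h) - (u - h)) = 2 * L * B / h" using h by (simp add: power2_eq_square)
  also have "(\<Sum>k\<in>?I. c k * Kh K h (u - x k)) = qhat K h U n u + 1 / real n * (\<Sum>i = 1..n. Kh K h (u - U i))"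
    using sm[of "\<lambda>y. Kh K h (u - y)"] unfolding qhat_def sum_distrib_left by (simp only: mult.commute)
  finally show ?thesis by simp
qed

end

section \<open>From spacings of the uniform sample to spacings of the bids\<close>

lemma spacing_transform_MVT:
  fixes Q q :: "real \<Rightarrow> real"
  assumes "0 \<le> s" "s \<le> t" "t \<le> 1"
    and Q: "\<And>u. u \<in> {0..1} \<Longrightarrow> (Q has_real_derivative q u) (at u within {0..1})"
  shows "\<exists>\<xi>\<in>{s..t}. Q t - Q s = q \<xi> * (t - s)"
proof (cases "s = t")
  case True thus ?thesis using assms by auto
next
  case False
  hence "s < t" using assms by simp
  moreover have "(Q has_derivative (*) (q x)) (at x within {s..t})" if "s \<le> x" "x \<le> t" for x
  proof -
    have "(Q has_real_derivative q x) (at x within {s..t})"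
      using that assms by (intro DERIV_subset[OF Q]) auto
    thus ?thesis by (simp add: has_field_derivative_def)
  qed
  ultimately have "\<exists>x\<in>{s<..<t}. Q t - Q s = q x * (t - s)"
    by (rule mvt_simple)
  thus ?thesis by force
qed

text \<open>Each spacing of x is q(\<xi>) times the corresponding uniform spacing. If its kernel
  weight is nonzero, i/n is within h of u, and the ends of the uniform spacing lie within D of (i -
  1)/n and i/n; hence |\<xi> - u| <= h + D + 1/n. Nonnegative weights make the error relative to
  \<open>qhat K h U n u\<close>.\<close>

lemma (in kernel) qhat_linearization:
  fixes U x Q q
  assumes n: "1 \<le> n" and h: "0 < h" and u: "h \<le> u" "u \<le> 1 - h"
    and U: "\<And>i. 1 \<le> i \<Longrightarrow> 0 < U i \<and> U i \<le> 1"
    and D: "\<And>t. 0 \<le> t \<Longrightarrow> t \<le> 1 \<Longrightarrow> \<bar>ecdf U n t - t\<bar> \<le> D"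
    and Q: "\<And>u. u \<in> {0..1} \<Longrightarrow> (Q has_real_derivative q u) (at u within {0..1})"
    and q: "\<And>s t. s \<in> {0..1} \<Longrightarrow> t \<in> {0..1} \<Longrightarrow> \<bar>q s - q t\<bar> \<le> Lq * \<bar>s - t\<bar>"
    and x: "\<And>i. 1 \<le> i \<Longrightarrow> i \<le> n \<Longrightarrow> order_stat x n i = Q (order_stat U n i)"
  shows "\<bar>qhat K h x n u - q u * qhat K h U n u\<bar> \<le> Lq * (h + D + 1 / real n) * qhat K h U n u"
proof -
  define V where "V = order_stat U n"
  have Lq: "0 \<le> Lq" using q[of 0 1] by simp
  have V01: "0 < V i \<and> V i \<le> 1" if "1 \<le> i" "i \<le> n" for i
    using order_stat_eq_sample[OF that, of U] U by (auto simp: V_def)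
  have Vnear: "\<bar>V (Suc i) - real i / real n\<bar> \<le> D" if "i < n" for i
  proof -
    have "Qhat U n (real i / real n) = V (Suc i)" using that n by (simp add: Qhat_def V_def)
    thus ?thesis using Qhat_near_argument[OF n U _ _ D, of "real i / real n"] that n by simp
  qed
  have summand: "\<bar>Kh K h (u - real i / real n) * (order_stat x n (i + 1) - order_stat x n i)
       - q u * (Kh K h (u - real i / real n) * (V (i + 1) - V i))\<bar>
     \<le> Lq * (h + D + 1 / real n) * (Kh K h (u - real i / real n) * (V (i + 1) - V i))"
    if i: "i \<in> {1..n - 1}" for i
  proof (cases "Kh K h (u - real i / real n) = 0")
    case True thus ?thesis by simp
  next
    case False
    hence near: "\<bar>u - real i / real n\<bar> < h" using Kh_zero[OF h] by (metis not_le)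
    have i': "1 \<le> i" "i < n" using i n by auto
    have le: "V i \<le> V (i + 1)" unfolding V_def using i' n by (intro order_stat_mono) auto
    have "0 \<le> V i" "V (i + 1) \<le> 1" using V01[of i] V01[of "i + 1"] i' by auto
    then obtain \<xi> where xi: "\<xi> \<in> {V i..V (i + 1)}" "Q (V (i + 1)) - Q (V i) = q \<xi> * (V (i + 1) - V i)"
      using spacing_transform_MVT[OF _ le _ Q] by blast
    have "\<bar>V i - real (i - 1) / real n\<bar> \<le> D" using Vnear[of "i - 1"] i' by simp
    moreover have "real (i - 1) / real n = real i / real n - 1 / real n" using i' by (simp add: of_nat_diff diff_divide_distrib)
    moreover have "\<bar>V (i + 1) - real i / real n\<bar> \<le> D" using Vnear[of i] i' by simp
    moreover have "0 \<le> 1 / real n" by simp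
    ultimately have "\<bar>\<xi> - u\<bar> \<le> h + D + 1 / real n" using xi(1) near unfolding atLeastAtMost_iff by linarith
    moreover have "\<xi> \<in> {0..1}" "u \<in> {0..1}" using xi \<open>0 \<le> V i\<close> \<open>V (i + 1) \<le> 1\<close> u h by auto
    ultimately have "\<bar>q \<xi> - q u\<bar> \<le> Lq * (h + D + 1 / real n)"
      using q[of \<xi> u] mult_left_mono[of "\<bar>\<xi> - u\<bar>" "h + D + 1 / real n" Lq] Lq by linarith
    hence "\<bar>q \<xi> - q u\<bar> * (Kh K h (u - real i / real n) * (V (i + 1) - V i)) \<le> Lq * (h + D + 1 / real n) * (Kh K h (u - real i / real n) * (V (i + 1) - V i))"
      using Kh_nonneg[OF h] le by (intro mult_right_mono) auto
    moreover have "order_stat x n (i + 1) - order_stat x n i = q \<xi> * (V (i + 1) - V i)"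
      using x[of i] x[of "i + 1"] i' xi by (simp add: V_def)
    moreover have "Kh K h (u - real i / real n) * (q \<xi> * (V (i + 1) - V i)) - q u * (Kh K h (u - real i / real n) * (V (i + 1) - V i))
        = (q \<xi> - q u) * (Kh K h (u - real i / real n) * (V (i + 1) - V i))" by (simp add: algebra_simps)
    ultimately show ?thesis using Kh_nonneg[OF h, of "u - real i / real n"] le by (simp add: abs_mult)
  qed
  have "\<bar>qhat K h x n u - q u * qhat K h U n u\<bar> \<le> (\<Sum>i = 1..n - 1. \<bar>Kh K h (u - real i / real n) * (order_stat x n (i + 1) - order_stat x n i)
       - q u * (Kh K h (u - real i / real n) * (V (i + 1) - V i))\<bar>)"
    unfolding qhat_def V_def[symmetric] sum_distrib_left sum_subtractf[symmetric] by (rule sum_abs)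
  also have "\<dots> \<le> (\<Sum>i = 1..n - 1. Lq * (h + D + 1 / real n) * (Kh K h (u - real i / real n) * (V (i + 1) - V i)))"
    by (rule sum_mono[OF summand])
  also have "\<dots> = Lq * (h + D + 1 / real n) * qhat K h U n u"
    unfolding qhat_def V_def[symmetric] sum_distrib_left ..
  finally show ?thesis .
qed

text \<open>Only m consecutive indices inside the window where K >= c are kept. Their weights are at
  least c / h and their spacings telescope to a single m-spacing, which \<open>sp\<close> bounds
  from below and \<open>Q\<close> stretches by at least q0.\<close>

lemma (in kernel) qhat_lower_bound:
  fixes U x Q q and m n :: nat
  assumes n: "1 \<le> n" and h: "0 < h" and u: "h \<le> u" "u \<le> 1 - h"
    and U: "\<And>i. 1 \<le> i \<Longrightarrow> 0 < U i \<and> U i \<le> 1"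
    and Q: "\<And>u. u \<in> {0..1} \<Longrightarrow> (Q has_real_derivative q u) (at u within {0..1})"
    and q: "\<And>u. u \<in> {0..1} \<Longrightarrow> q0 \<le> q u" and q0: "0 < q0"
    and x: "\<And>i. 1 \<le> i \<Longrightarrow> i \<le> n \<Longrightarrow> order_stat x n i = Q (order_stat U n i)"
    and K: "\<And>z. \<bar>z - z0\<bar> \<le> \<rho> \<Longrightarrow> c \<le> K z" "0 < c" "0 < \<rho>"
    and m: "1 \<le> m" "real m \<le> \<rho> * (real n * h)"
    and sp: "\<And>i. 1 \<le> i \<Longrightarrow> i + m \<le> n \<Longrightarrow> w \<le> order_stat U n (i + m) - order_stat U n i"
  shows "c / h * (q0 * w) \<le> qhat K h x n u"
proof -
  have n0: "0 < real n" using n by simp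
  \<comment> \<open>A point where K >= c > 0 cannot be at distance 1 or more from 0. The strict
    inequalities keep the chosen indices between 1 and n - 1 for every u in [h, 1 - h].\<close>
  have z1: "\<bar>z0 + \<rho>\<bar> < 1" "\<bar>z0 - \<rho>\<bar> < 1"
    using K(1)[of "z0 + \<rho>"] K(1)[of "z0 - \<rho>"] K(2,3) K_zero[of "z0 + \<rho>"] K_zero[of "z0 - \<rho>"] by force+
  \<comment> \<open>This is n times the left end of the window |(u - t) / h - z0| <= \<rho>. The
    window has length 2 \<rho> h, and the m indices from \<open>i0\<close> on advance at most \<rho>
    h beyond its left end after division by n, so they stay in its left half.\<close>
  define y where "y = real n * (u - h * (z0 + \<rho>))"
  define i0 where "i0 = nat \<lceil>y\<rceil>"
  have "h * (z0 + \<rho>) < h * 1" using z1 h by (intro mult_strict_left_mono) auto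
  hence y0: "0 < y" using u n0 by (simp add: y_def)
  have i0: "y \<le> real i0" "real i0 < y + 1" "1 \<le> i0" using y0 unfolding i0_def by linarith+
  have in_window: "\<bar>(u - real i / real n) / h - z0\<bar> \<le> \<rho>" if i: "i0 \<le> i" "i < i0 + m" for i
  proof -
    have "y \<le> real i" "real i \<le> y + real m" using i i0 by linarith+
    hence i1: "y \<le> real i" "real i \<le> y + \<rho> * (real n * h)" using m by linarith+
    have "real n * (u - h * z0 - h * \<rho>) \<le> real i" using i1 by (simp add: y_def algebra_simps)
    hence a: "u - h * z0 - h * \<rho> \<le> real i / real n" using n0 by (simp add: field_simps)
    have "real i \<le> real n * (u - h * z0)" using i1 by (simp add: y_def algebra_simps)
    hence b: "real i / real n \<le> u - h * z0" using n0 by (simp add: field_simps)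
    have "(u - real i / real n) / h - z0 = (u - real i / real n - h * z0) / h" using h by (simp add: diff_divide_distrib)
    moreover have "(u - real i / real n - h * z0) / h \<le> \<rho>" using a h by (simp add: pos_divide_le_eq algebra_simps)
    moreover have "0 \<le> (u - real i / real n - h * z0) / h" using b h by simp
    ultimately show ?thesis by simp
  qed
  have im: "i0 + m \<le> n"
  proof -
    have "\<bar>(u - real (i0 + m - 1) / real n) / h - z0\<bar> \<le> \<rho>" using m by (intro in_window) auto
    hence "z0 - \<rho> \<le> (u - real (i0 + m - 1) / real n) / h" by linarith
    hence "-1 < (u - real (i0 + m - 1) / real n) / h" using z1 by linarith
    hence "- h < u - real (i0 + m - 1) / real n" using h by (simp add: field_simps)
    hence "real (i0 + m - 1) / real n < 1" using u by linarith
    hence "real (i0 + m - 1) < real n" using n0 by (simp add: pos_divide_less_eq)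
    thus ?thesis by linarith
  qed
  have incr: "0 \<le> order_stat x n (i + 1) - order_stat x n i" if "1 \<le> i" "i < n" for i
    using order_stat_mono[of i "i + 1" n x] that by simp
  have tele: "(\<Sum>i = i0..<i0 + m. order_stat x n (i + 1) - order_stat x n i) = order_stat x n (i0 + m) - order_stat x n i0"
    using sum_Suc_diff'[of i0 "i0 + m" "order_stat x n"] by simp
  have "q0 * w \<le> order_stat x n (i0 + m) - order_stat x n i0"
  proof -
    let ?s = "order_stat U n i0" and ?t = "order_stat U n (i0 + m)"
    have st: "?s \<le> ?t" using im n by (intro order_stat_mono) auto
    have "0 \<le> ?s" using order_stat_eq_sample[of i0 n U] U i0 im by (metis atLeastAtMost_iff le_add1 less_imp_le order_trans)
    moreover have "?t \<le> 1" using order_stat_eq_sample[of "i0 + m" n U] U i0 im by (metis atLeastAtMost_iff le_add1 order_trans)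
    ultimately obtain \<xi> where xi: "\<xi> \<in> {?s..?t}" "Q ?t - Q ?s = q \<xi> * (?t - ?s)"
      using spacing_transform_MVT[OF _ st _ Q] by blast
    have "q0 * w \<le> q0 * (?t - ?s)" using sp[of i0] i0 im q0 by (intro mult_left_mono) auto
    also have "\<dots> \<le> q \<xi> * (?t - ?s)" using xi \<open>0 \<le> ?s\<close> \<open>?t \<le> 1\<close> st by (intro mult_right_mono q) auto
    also have "\<dots> = order_stat x n (i0 + m) - order_stat x n i0" using x[of i0] x[of "i0 + m"] i0 im xi by simp
    finally show ?thesis .
  qed
  hence "c / h * (q0 * w) \<le> c / h * (\<Sum>i = i0..<i0 + m. order_stat x n (i + 1) - order_stat x n i)"
    unfolding tele using K h by (intro mult_left_mono) auto
  also have "\<dots> \<le> (\<Sum>i = i0..<i0 + m. Kh K h (u - real i / real n) * (order_stat x n (i + 1) - order_stat x n i))"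
    unfolding sum_distrib_left
  proof (rule sum_mono)
    fix i assume i: "i \<in> {i0..<i0 + m}"
    have "c \<le> K ((u - real i / real n) / h)" using i by (intro K in_window) auto
    hence "c / h \<le> Kh K h (u - real i / real n)" unfolding Kh_def using h by (intro divide_right_mono) auto
    thus "c / h * (order_stat x n (i + 1) - order_stat x n i) \<le> Kh K h (u - real i / real n) * (order_stat x n (i + 1) - order_stat x n i)"
      using i i0 im by (intro mult_right_mono incr) auto
  qed
  also have "\<dots> \<le> qhat K h x n u"
    unfolding qhat_def
  proof (rule sum_mono2)
    show "{i0..<i0 + m} \<subseteq> {1..n - 1}" using i0 im by auto
    show "0 \<le> Kh K h (u - real i / real n) * (order_stat x n (i + 1) - order_stat x n i)" if "i \<in> {1..n - 1} - {i0..<i0 + m}" for i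
      using that n by (intro mult_nonneg_nonneg Kh_nonneg h incr) auto
  qed simp
  finally show ?thesis .
qed

subsection \<open>The plug-in functional and the quantile transform\<close>

lemma C1_imp_lipschitz:
  fixes f f' :: "real \<Rightarrow> real"
  assumes d: "\<And>u. u \<in> {0..1} \<Longrightarrow> (f has_real_derivative f' u) (at u within {0..1})"
    and c: "continuous_on {0..1} f'"
  obtains C where "\<And>s t. s \<in> {0..1} \<Longrightarrow> t \<in> {0..1} \<Longrightarrow> \<bar>f s - f t\<bar> \<le> C * \<bar>s - t\<bar>"
proof -
  have "bounded (f' ` {0..1})" by (intro compact_imp_bounded compact_continuous_image c) simp
  then obtain C where "\<forall>u\<in>{0..1}. norm (f' u) \<le> C" by (auto simp: bounded_iff)
  hence "norm (f s - f t) \<le> C * norm (s - t)" if "s \<in> {0..1}" "t \<in> {0..1}" for s t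
    using field_differentiable_bound[of "{0..1}" f f' C s t] d that by auto
  thus ?thesis by (intro that[of C]) auto
qed

lemma continuous_on_unit_bounded:
  fixes f :: "real \<Rightarrow> real"
  assumes "continuous_on {0..1} f"
  obtains C where "0 < C" "\<And>u. u \<in> {0..1} \<Longrightarrow> \<bar>f u\<bar> \<le> C"
proof -
  have "bounded (f ` {0..1})" by (intro compact_imp_bounded compact_continuous_image assms) simp
  then obtain C where "0 < C" "\<forall>u\<in>{0..1}. norm (f u) \<le> C" by (auto simp: bounded_pos)
  thus ?thesis by (intro that[of C]) auto
qed

text \<open>A two-sided derivative is needed even at 0 and 1 because \<open>chi\<close> is stated
  with \<open>deriv\<close>. It exists since \<open>A1\<close> is a polynomial whose derivative does
  not vanish there.\<close>

lemma Afun_C1: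
  assumes nz: "\<And>u. u \<in> {0..1} \<Longrightarrow> deriv (A1 p M) u \<noteq> 0"
  obtains A' where "continuous_on {0..1} A'"
    "\<And>u. u \<in> {0..1} \<Longrightarrow> (Afun p M has_real_derivative A' u) (at u)"
proof -
  define P where "P = (\<Sum>m = 1..M. monom (p m) (m - 1))"
  have A1: "A1 p M = poly P" by (auto simp: A1_def P_def poly_sum poly_monom)
  have d: "deriv (A1 p M) = poly (pderiv P)" unfolding A1 by (intro ext DERIV_imp_deriv poly_DERIV)
  have A: "Afun p M = (\<lambda>u. poly P u / poly (pderiv P) u)" by (simp add: fun_eq_iff Afun_def d) (simp add: A1)
  define A' where "A' = (\<lambda>u. (poly (pderiv P) u * poly (pderiv P) u - poly P u * poly (pderiv (pderiv P)) u)
      / (poly (pderiv P) u * poly (pderiv P) u))"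
  show ?thesis
  proof (rule that[of A'])
    show "continuous_on {0..1} A'" unfolding A'_def
      using nz unfolding d by (intro continuous_intros) auto
    show "(Afun p M has_real_derivative A' u) (at u)" if "u \<in> {0..1}" for u
      unfolding A A'_def using nz[OF that] unfolding d
      by (intro DERIV_divide poly_DERIV) auto
  qed
qed

lemma Qhat_step_sum:
  assumes n: "1 \<le> n" and u: "0 \<le> u" "u \<le> 1"
  shows "Qhat x n u = order_stat x n 1
     + (\<Sum>i = 1..n - 1. (order_stat x n (i + 1) - order_stat x n i) * (if real i / real n \<le> u then 1 else 0))"
proof (cases "u < 1")
  case True thus ?thesis using sum_spacings_eq_Qhat[OF n u(1) True, of x] by simp
next
  case False
  hence "u = 1" using u by simp
  have "(\<Sum>i = 1..n - 1. (order_stat x n (i + 1) - order_stat x n i) * (if real i / real n \<le> u then 1 else 0))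
      = (\<Sum>i = 1..<n. order_stat x n (Suc i) - order_stat x n i)"
    unfolding \<open>u = 1\<close> using n by (intro sum.cong) auto
  also have "\<dots> = order_stat x n n - order_stat x n 1" using n by (rule sum_Suc_diff')
  finally show ?thesis using \<open>u = 1\<close> by (simp add: Qhat_def)
qed

lemma continuous_times_Qhat_integrable:
  assumes n: "1 \<le> n" and a: "0 \<le> a" and c: "continuous_on {0..1} \<xi>"
  shows "(\<lambda>u. \<xi> u * Qhat x n u) integrable_on {a..1}"
proof -
  have step: "(\<lambda>u. d * (if s \<le> u then \<xi> u else 0)) integrable_on {a..1}" for d s :: real
  proof (rule integrable_on_mult_right)
    have "\<xi> integrable_on ({s..} \<inter> {a..1})"
    proof -
      have "{s..} \<inter> {a..1} = {max s a..1}" by auto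
      thus ?thesis using a by (auto intro!: integrable_continuous_interval continuous_on_subset[OF c])
    qed
    thus "(\<lambda>u. if s \<le> u then \<xi> u else 0) integrable_on {a..1}"
      using integrable_restrict_Int[of "{s..}" \<xi> "{a..1}"] by simp
  qed
  have "(\<lambda>u. order_stat x n 1 * \<xi> u + (\<Sum>i = 1..n - 1. (order_stat x n (i + 1) - order_stat x n i) * (if real i / real n \<le> u then \<xi> u else 0))) integrable_on {a..1}"
    using a by (intro integrable_add integrable_sum step integrable_on_mult_right integrable_continuous_interval continuous_on_subset[OF c]) auto
  moreover have "\<xi> u * Qhat x n u = order_stat x n 1 * \<xi> u + (\<Sum>i = 1..n - 1. (order_stat x n (i + 1) - order_stat x n i) * (if real i / real n \<le> u then \<xi> u else 0))"
    if "u \<in> {a..1}" for u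
  proof -
    have "u \<ge> 0" "u \<le> 1" using that a by auto
    note e = Qhat_step_sum[OF n this, of x]
    show ?thesis unfolding e distrib_left sum_distrib_left by (intro arg_cong2[where f = "(+)"] sum.cong) auto
  qed
  ultimately show ?thesis by (subst integrable_cong) auto
qed

text \<open>Since \<psi> v = (A \<psi> Q)' + chi Q, integration by parts removes q from the
  integral, and \<open>Shat\<close> is the resulting formula with \<open>Qhat\<close> in place of
  \<open>Q\<close>. Being linear in the quantile function, its error is controlled by sup |Qhat -
  Q|, free of any bandwidth.\<close>

lemma Shat_error:
  fixes A A' \<psi> \<psi>' Q q :: "real \<Rightarrow> real"
  assumes n: "1 \<le> n" and us: "0 \<le> us" "us \<le> 1"
    and A': "continuous_on {0..1} A'" "\<And>u. u \<in> {0..1} \<Longrightarrow> (A has_real_derivative A' u) (at u)"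
    and \<psi>: "\<And>u. u \<in> {0..1} \<Longrightarrow> (\<psi> has_real_derivative \<psi>' u) (at u within {0..1})"
    and \<psi>': "continuous_on {0..1} \<psi>'"
    and Q: "\<And>u. u \<in> {0..1} \<Longrightarrow> (Q has_real_derivative q u) (at u within {0..1})"
    and q: "continuous_on {0..1} q"
    and E: "\<And>u. u \<in> {0..1} \<Longrightarrow> \<bar>Qhat x n u - Q u\<bar> \<le> E"
    and C1: "\<And>u. u \<in> {0..1} \<Longrightarrow> \<bar>chi A \<psi> \<psi>' u\<bar> \<le> C1" and C2: "\<And>u. u \<in> {0..1} \<Longrightarrow> \<bar>A u * \<psi> u\<bar> \<le> C2"
  shows "\<bar>Shat A \<psi> \<psi>' x n us - integral {us..1} (\<lambda>t. \<psi> t * vfun A Q q t)\<bar> \<le> (C1 + 2 * C2) * E"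
proof -
  have E0: "0 \<le> E" using E[of 0] by simp
  have C0: "0 \<le> C1" using C1[of 0] by simp
  have dA: "deriv A u = A' u" if "u \<in> {0..1}" for u using A'(2)[OF that] by (rule DERIV_imp_deriv)
  have Aw: "(A has_real_derivative A' u) (at u within S)" if "u \<in> {0..1}" for u S
    using A'(2)[OF that] by (rule has_field_derivative_at_within)
  have cQ: "continuous_on {0..1} Q" by (rule DERIV_continuous_on[OF Q])
  have cA: "continuous_on {0..1} A" by (rule DERIV_continuous_on[OF Aw])
  have c\<psi>: "continuous_on {0..1} \<psi>" by (rule DERIV_continuous_on[OF \<psi>])
  define \<xi> where "\<xi> = (\<lambda>u. (1 - A' u) * \<psi> u - A u * \<psi>' u)"
  have chi: "chi A \<psi> \<psi>' u = \<xi> u" if "u \<in> {0..1}" for u using dA[OF that] by (simp add: chi_def \<xi>_def)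
  have c\<xi>: "continuous_on {0..1} \<xi>" unfolding \<xi>_def by (intro continuous_intros A'(1) cA c\<psi> \<psi>')
  have sub: "{us..1} \<subseteq> {0..1}" using us by auto
  define H where "H = (\<lambda>u. A u * \<psi> u * Q u)"
  define H' where "H' = (\<lambda>u. A' u * \<psi> u * Q u + A u * \<psi>' u * Q u + A u * \<psi> u * q u)"
  have "(H has_vector_derivative H' u) (at u within {us..1})" if "u \<in> {us..1}" for u
  proof -
    have u: "u \<in> {0..1}" using that sub by auto
    have "(H has_real_derivative H' u) (at u within {0..1})"
      unfolding H_def H'_def by (rule derivative_eq_intros Aw[OF u] \<psi>[OF u] Q[OF u] refl)+ (simp add: algebra_simps)
    hence "(H has_real_derivative H' u) (at u within {us..1})" by (rule DERIV_subset[OF _ sub])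
    thus ?thesis by (simp add: has_real_derivative_iff_has_vector_derivative)
  qed
  hence H: "(H' has_integral (H 1 - H us)) {us..1}" using us by (intro fundamental_theorem_of_calculus) auto
  have i\<xi>Q: "(\<lambda>u. \<xi> u * Q u) integrable_on {us..1}"
    by (intro integrable_continuous_interval continuous_on_subset[OF _ sub] continuous_intros c\<xi> cQ)
  have "((\<lambda>u. H' u + \<xi> u * Q u) has_integral (H 1 - H us + integral {us..1} (\<lambda>u. \<xi> u * Q u))) {us..1}"
    by (intro has_integral_add H integrable_integral i\<xi>Q)
  moreover have "(\<lambda>u. H' u + \<xi> u * Q u) = (\<lambda>t. \<psi> t * vfun A Q q t)"
    by (auto simp: H'_def \<xi>_def vfun_def algebra_simps)
  ultimately have S: "integral {us..1} (\<lambda>t. \<psi> t * vfun A Q q t) = H 1 - H us + integral {us..1} (\<lambda>u. \<xi> u * Q u)"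
    by (simp add: integral_unique)
  have i\<xi>h: "(\<lambda>u. \<xi> u * Qhat x n u) integrable_on {us..1}"
    by (rule continuous_times_Qhat_integrable[OF n us(1) c\<xi>])
  have "integral {us..1} (\<lambda>u. chi A \<psi> \<psi>' u * Qhat x n u) = integral {us..1} (\<lambda>u. \<xi> u * Qhat x n u)"
    using sub chi by (intro Henstock_Kurzweil_Integration.integral_cong) auto
  hence "integral {us..1} (\<lambda>u. chi A \<psi> \<psi>' u * Qhat x n u) - integral {us..1} (\<lambda>u. \<xi> u * Q u)
      = integral {us..1} (\<lambda>u. \<xi> u * Qhat x n u - \<xi> u * Q u)"
    using integral_diff[OF i\<xi>h i\<xi>Q] by simp
  moreover have "norm (integral {us..1} (\<lambda>u. \<xi> u * Qhat x n u - \<xi> u * Q u)) \<le> integral {us..1} (\<lambda>u. C1 * E)"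
  proof (rule integral_norm_bound_integral)
    show "(\<lambda>u. \<xi> u * Qhat x n u - \<xi> u * Q u) integrable_on {us..1}" by (rule integrable_diff[OF i\<xi>h i\<xi>Q])
    fix u assume "u \<in> {us..1}"
    hence u: "u \<in> {0..1}" using sub by auto
    have "\<bar>\<xi> u\<bar> * \<bar>Qhat x n u - Q u\<bar> \<le> C1 * E" using C1[OF u] E[OF u] C0 unfolding chi[OF u] by (intro mult_mono) auto
    thus "norm (\<xi> u * Qhat x n u - \<xi> u * Q u) \<le> C1 * E" by (simp add: abs_mult flip: right_diff_distrib)
  qed (rule integrable_const_ivl)
  moreover have "integral {us..1} (\<lambda>u. C1 * E) \<le> C1 * E"
    using us mult_right_mono[of "1 - us" 1 "C1 * E"] C0 E0 by (simp add: mult_ac)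
  moreover have "\<bar>A u * \<psi> u * (Qhat x n u - Q u)\<bar> \<le> C2 * E" if "u \<in> {0..1}" for u
    unfolding abs_mult[of _ "Qhat x n u - Q u"] using C2[OF that] E[OF that] by (intro mult_mono) auto
  hence "\<bar>A us * \<psi> us * (Qhat x n us - Q us)\<bar> \<le> C2 * E" "\<bar>A 1 * \<psi> 1 * (Qhat x n 1 - Q 1)\<bar> \<le> C2 * E"
    using us by auto
  ultimately show ?thesis unfolding Shat_def S H_def by (simp add: algebra_simps)
qed

text \<open>Here \<open>qh\<close> is the quantile density estimate, \<open>g\<close> the same estimate computed from the uniform sample and \<open>\<gamma>\<close> the
  centred kernel density of the uniform sample. The point is the identity
  \<open>qh - q + \<gamma> qh = (qh - q g)(1 + \<gamma>) + q (g - 1 + \<gamma>) + q \<gamma> (g - 1)\<close>.\<close>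

lemma studentized_quantile_density_error:
  fixes qh q g \<gamma> :: real
  assumes q: "q0 \<le> q" "q \<le> q1" "0 < q0" and qh: "c \<le> qh" "0 < c"
    and lin: "\<bar>qh - q * g\<bar> \<le> \<epsilon> * g" and eps: "0 \<le> \<epsilon>" "\<epsilon> \<le> q0 / 2"
    and g: "\<bar>g - 1 + \<gamma>\<bar> \<le> \<delta>" and \<gamma>: "\<bar>\<gamma>\<bar> \<le> \<Gamma>"
  shows "\<bar>(qh - q) / qh + \<gamma>\<bar> \<le> 2 / q0 * \<epsilon> * (1 + \<Gamma>) + q1 / c * (\<delta> * (1 + \<Gamma>) + \<Gamma>\<^sup>2)"
proof -
  have qh0: "0 < qh" using qh by simp
  have \<delta>0: "0 \<le> \<delta>" and \<Gamma>0: "0 \<le> \<Gamma>" using g \<gamma> by auto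
  have q1: "0 < q1" using q by simp
  have g0: "0 \<le> g"
  proof (rule ccontr)
    assume "\<not> 0 \<le> g"
    hence "\<epsilon> * g \<le> 0" "q * g \<le> 0" using eps q by (auto simp: mult_nonneg_nonpos)
    thus False using lin qh0 by linarith
  qed
  \<comment> \<open>Since \<epsilon> <= q0 / 2, the linearisation error cannot outweigh q g, so g <=
    2 qh / q0 and the first term of the identity is proportional to qh. Dividing it by qh therefore
    costs no factor 1 / c.\<close>
  have "\<epsilon> * g \<le> q0 / 2 * g" using eps g0 by (intro mult_right_mono)
  moreover have "q0 * g \<le> q * g" using q g0 by (intro mult_right_mono)
  ultimately have "q0 / 2 * g \<le> qh" using lin by linarith
  hence "g \<le> 2 / q0 * qh" using q by (simp add: field_simps)
  from mult_left_mono[OF this eps(1)] have eg: "\<epsilon> * g \<le> 2 / q0 * \<epsilon> * qh" by (simp add: mult_ac)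
  have "\<bar>(qh - q * g) * (1 + \<gamma>)\<bar> \<le> 2 / q0 * \<epsilon> * qh * (1 + \<Gamma>)"
    unfolding abs_mult using lin eg \<gamma> \<Gamma>0 by (intro mult_mono) auto
  moreover have "\<bar>q * (g - 1 + \<gamma>)\<bar> \<le> q1 * \<delta>"
    unfolding abs_mult using q g by (intro mult_mono) auto
  moreover have "\<bar>q * (\<gamma> * (g - 1))\<bar> \<le> q1 * (\<Gamma> * (\<Gamma> + \<delta>))"
    unfolding abs_mult using q g \<gamma> \<Gamma>0 by (intro mult_mono) auto
  moreover have "qh - q + \<gamma> * qh = (qh - q * g) * (1 + \<gamma>) + q * (g - 1 + \<gamma>) + q * (\<gamma> * (g - 1))"
    by (simp add: algebra_simps)
  ultimately have "\<bar>qh - q + \<gamma> * qh\<bar> \<le> 2 / q0 * \<epsilon> * qh * (1 + \<Gamma>) + (q1 * \<delta> + q1 * (\<Gamma> * (\<Gamma> + \<delta>)))" by linarith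
  also have "q1 * \<delta> + q1 * (\<Gamma> * (\<Gamma> + \<delta>)) = q1 * (\<delta> * (1 + \<Gamma>) + \<Gamma>\<^sup>2)"
    by (simp add: algebra_simps power2_eq_square)
  finally have "\<bar>qh - q + \<gamma> * qh\<bar> / qh \<le> (2 / q0 * \<epsilon> * qh * (1 + \<Gamma>) + q1 * (\<delta> * (1 + \<Gamma>) + \<Gamma>\<^sup>2)) / qh"
    using qh0 by (intro divide_right_mono) auto
  also have "\<dots> = 2 / q0 * \<epsilon> * (1 + \<Gamma>) + q1 * (\<delta> * (1 + \<Gamma>) + \<Gamma>\<^sup>2) / qh"
    using qh0 by (simp add: add_divide_distrib)
  also have "q1 * (\<delta> * (1 + \<Gamma>) + \<Gamma>\<^sup>2) / qh \<le> q1 * (\<delta> * (1 + \<Gamma>) + \<Gamma>\<^sup>2) / c"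
    using qh qh0 q1 \<delta>0 \<Gamma>0 by (intro divide_left_mono) auto
  also have "\<bar>qh - q + \<gamma> * qh\<bar> / qh = \<bar>(qh - q + \<gamma> * qh) / qh\<bar>" using qh0 by simp
  also have "(qh - q + \<gamma> * qh) / qh = (qh - q) / qh + \<gamma>" using qh0 by (simp add: add_divide_distrib)
  finally show ?thesis by simp
qed

context uniform_sample
begin

lemma expectation_continuous:
  assumes i: "1 \<le> i" and g: "continuous_on UNIV (g :: real \<Rightarrow> real)"
  shows "expectation (\<lambda>\<omega>. g (U i \<omega>)) = integral {0..1} g"
proof -
  have D: "distributed M lborel (U i) (\<lambda>x. indicator {0..1::real} x / measure lborel {0..1::real})"
    by (rule uniform_distrI_borel_atLeastAtMost) (use unif[OF i] i in auto)
  have gm: "g \<in> borel_measurable borel" by (rule borel_measurable_continuous_onI[OF g])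
  have "expectation (\<lambda>\<omega>. g (U i \<omega>)) = (\<integral>x. indicator {0..1} x / measure lborel {0..1::real} * g x \<partial>lborel)"
    using distributed_integral[OF D, of g] gm by simp
  also have "\<dots> = set_lebesgue_integral lborel {0..1} g"
    by (simp add: set_lebesgue_integral_def)
  also have "\<dots> = integral {0..1} g"
    by (intro set_borel_integral_eq_integral(2) borel_integrable_atLeastAtMost') (rule continuous_on_subset[OF g], simp)
  finally show ?thesis .
qed

text \<open>For u in [h, 1 - h] the kernel window lies inside [0, 1], so the expectation is exactly
  1 and the leading term has no boundary bias.\<close>

lemma Gnh_eq_kernel_density:
  assumes K: "kernel K L" and n: "1 \<le> n" and h: "0 < h" and u: "h \<le> u" "u \<le> 1 - h"
    and U: "\<And>i \<omega>. U i \<omega> = F (b i \<omega>)"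
  shows "Gnh M b F K n h \<omega> u = sqrt (real n * h) * (1 / real n * (\<Sum>i = 1..n. Kh K h (u - U i \<omega>)) - 1)"
proof -
  interpret kernel K L by (rule K)
  have "(L / h\<^sup>2)-lipschitz_on UNIV (\<lambda>x. Kh K h (u - x))"
    using Kh_lip[OF h] L_nonneg h by (auto simp: lipschitz_on_def dist_real_def)
  hence c: "continuous_on UNIV (\<lambda>x. Kh K h (u - x))" by (rule lipschitz_on_continuous_on)
  have "((\<lambda>x. Kh K h (u - x)) has_integral 1) {0..1}"
    using has_integral_on_superset[OF Kh_has_integral[OF h, of u], of "{0..1}"] Kh_zero[OF h] u h by force
  hence "expectation (\<lambda>\<omega>'. Kh K h (u - F (b i \<omega>'))) = 1" if "1 \<le> i" for i
    using expectation_continuous[OF that c] by (simp add: U integral_unique)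
  hence "(\<Sum>i = 1..n. Kh K h (u - F (b i \<omega>)) - expectation (\<lambda>\<omega>'. Kh K h (u - F (b i \<omega>'))))
      = (\<Sum>i = 1..n. Kh K h (u - U i \<omega>)) - real n"
    unfolding U by (simp add: sum_subtractf)
  thus ?thesis unfolding Gnh_def using n by (simp add: right_diff_distrib)
qed

end

text \<open>The identity F (Q u) = u gives Q (F x) = x only for x in the range of Q. Bids fall into
  [Q 0, Q 1] almost surely, since F is 0 at Q 0 and 1 at Q 1, and the intermediate value theorem
  puts that interval into the range.\<close>

lemma quantile_transform:
  fixes F Q q :: "real \<Rightarrow> real"
  assumes prob: "prob_space Pr"
    and meas: "\<And>i. i \<ge> 1 \<Longrightarrow> b i \<in> borel_measurable Pr"
    and indep: "prob_space.indep_vars Pr (\<lambda>_. borel) b {1..}"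
    and cdf: "\<And>i x. i \<ge> 1 \<Longrightarrow> F x = measure Pr {\<omega> \<in> space Pr. b i \<omega> \<le> x}"
    and F_cont: "continuous_on UNIV F"
    and quantile: "\<And>u. u \<in> {0..1} \<Longrightarrow> F (Q u) = u"
    and Q_cont: "continuous_on {0..1} Q"
  shows "mono F" and "uniform_sample Pr (\<lambda>i \<omega>. F (b i \<omega>))"
    and "AE \<omega> in Pr. \<forall>i\<ge>1. b i \<omega> = Q (F (b i \<omega>))"
proof -
  interpret prob_space Pr by (rule prob)
  have bm[measurable]: "{\<omega>\<in>space Pr. b i \<omega> \<le> x} \<in> events" if "1 \<le> i" for i x
    using meas[OF that] by measurable
  have Fm[measurable]: "F \<in> borel_measurable borel" by (rule borel_measurable_continuous_onI[OF F_cont])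
  show mono: "mono F"
  proof (rule monoI)
    fix x y :: real assume "x \<le> y"
    thus "F x \<le> F y" unfolding cdf[of 1, OF order_refl] by (intro finite_measure_mono bm) auto
  qed
  show "uniform_sample Pr (\<lambda>i \<omega>. F (b i \<omega>))"
  proof (unfold_locales)
    show "indep_vars (\<lambda>_. borel) (\<lambda>i \<omega>. F (b i \<omega>)) {1..}"
      by (rule indep_vars_compose2[OF indep]) (rule Fm)
    fix i :: nat and t :: real assume i: "1 \<le> i" and t: "0 \<le> t" "t \<le> 1"
    have [measurable]: "b i \<in> borel_measurable Pr" by (rule meas[OF i])
    have "prob {\<omega>\<in>space Pr. b i \<omega> \<le> Q t} \<le> prob {\<omega>\<in>space Pr. F (b i \<omega>) \<le> t}"
      using monoD[OF mono] quantile[of t] t by (intro finite_measure_mono) (auto, metis)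
    hence lo: "t \<le> prob {\<omega>\<in>space Pr. F (b i \<omega>) \<le> t}" using cdf[OF i, of "Q t"] quantile[of t] t by simp
    \<comment> \<open>The strict inequality F (b i) <= t < s = F (Q s) lets monotonicity alone give
      b i <= Q s; then s decreases to t.\<close>
    have up: "prob {\<omega>\<in>space Pr. F (b i \<omega>) \<le> t} \<le> s" if s: "t < s" "s < 1" for s
    proof -
      have "b i \<omega> \<le> Q s" if "F (b i \<omega>) \<le> t" for \<omega>
        using that s t monoD[OF mono, of "Q s" "b i \<omega>"] quantile[of s] by (cases "b i \<omega> \<le> Q s") auto
      hence "prob {\<omega>\<in>space Pr. F (b i \<omega>) \<le> t} \<le> prob {\<omega>\<in>space Pr. b i \<omega> \<le> Q s}"
        by (intro finite_measure_mono) auto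
      thus ?thesis using cdf[OF i, of "Q s"] quantile[of s] s t by simp
    qed
    have "prob {\<omega>\<in>space Pr. F (b i \<omega>) \<le> t} \<le> t"
      using dense_ge_bounded[of t 1 "prob {\<omega>\<in>space Pr. F (b i \<omega>) \<le> t}", OF _ up] t by (cases "t < 1") auto
    thus "prob {\<omega>\<in>space Pr. F (b i \<omega>) \<le> t} = t" using lo by simp
  qed
  have "AE \<omega> in Pr. b i \<omega> = Q (F (b i \<omega>))" if i: "1 \<le> i" for i
  proof -
    have "AE \<omega> in Pr. \<omega> \<in> {\<omega>\<in>space Pr. b i \<omega> \<le> Q 1}"
      by (rule AE_prob_1) (use cdf[OF i, of "Q 1"] quantile[of 1] in simp)
    moreover have "AE \<omega> in Pr. \<omega> \<notin> {\<omega>\<in>space Pr. b i \<omega> \<le> Q 0}"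
      using cdf[OF i, of "Q 0"] quantile[of 0] i by (subst prob_eq_0[symmetric]) auto
    ultimately show ?thesis
    proof eventually_elim
      case (elim \<omega>)
      have le: "b i \<omega> \<le> Q 1" "Q 0 \<le> b i \<omega>" using elim by auto
      obtain u where "0 \<le> u" "u \<le> 1" "Q u = b i \<omega>" using IVT'[of Q 0 "b i \<omega>" 1] le Q_cont by auto
      thus ?case using quantile[of u] by auto
    qed
  qed
  hence "\<forall>i. AE \<omega> in Pr. 1 \<le> i \<longrightarrow> b i \<omega> = Q (F (b i \<omega>))" by auto
  thus "AE \<omega> in Pr. \<forall>i\<ge>1. b i \<omega> = Q (F (b i \<omega>))" by (subst AE_all_countable)
qed

subsection \<open>Comparison of rates\<close>

definition remainder_rate :: "nat \<Rightarrow> real \<Rightarrow> real" where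
  "remainder_rate n h = sqrt (real n) * h powr (3/2) + sqrt h + h powr (-1/2) * real n powr (-1/4) * ell n"

lemma powr_quarter: "0 \<le> x \<Longrightarrow> x powr (1/4) = sqrt (sqrt (x :: real))"
  by (simp add: powr_half_sqrt[symmetric] powr_powr)

lemma remainder_rate_eq:
  assumes "0 < h" "3 \<le> n"
  shows "remainder_rate n h = sqrt (real n * h) * h + sqrt h
     + sqrt (ln (real n)) * sqrt (sqrt (ln (ln (real n)))) / (sqrt h * sqrt (sqrt (real n)))"
proof -
  have "1 \<le> ln (real n)" using assms exp_le by (subst ln_ge_iff) auto
  hence ll: "0 \<le> ln (ln (real n))" by simp
  have "h powr (3/2) = h powr (1 + 1/2)" by simp
  also have "\<dots> = h * sqrt h" using assms by (subst powr_add) (simp add: powr_half_sqrt)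
  finally have 1: "h powr (3/2) = h * sqrt h" .
  have 2: "h powr (-1/2) = 1 / sqrt h" using assms by (simp add: powr_minus_divide powr_half_sqrt flip: minus_divide_left)
  have 3: "real n powr (-1/4) = 1 / sqrt (sqrt (real n))"
    by (simp add: powr_minus_divide powr_quarter flip: minus_divide_left)
  show ?thesis unfolding remainder_rate_def ell_def 1 2 3 powr_quarter[OF ll] by (simp add: real_sqrt_mult mult_ac)
qed

text \<open>Uniform in h, because the bandwidth sequence is arbitrary apart from its limits. The
  items are the sizes, after scaling by sqrt(n h), of the variation of q over a bandwidth, of the
  supremum, of the Bahadur--Kiefer remainder divided by h, of the squared kernel deviation, and of
  the loss in the regime n h <= ln n. In terms of p = sqrt h, r = n^(1/4), m = sqrt(ln n), l = (ln
  ln n)^(1/4) they become inequalities between monomials.\<close>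

lemma remainder_rate_dominates:
  shows "\<forall>\<^sub>F n in sequentially. \<forall>h>0.
     sqrt (real n * h) * h \<le> remainder_rate n h
   \<and> sqrt (real n * h) * sqrt (ln (ln (real n)) / real n) \<le> remainder_rate n h
   \<and> sqrt (real n * h) * (sqrt (sqrt (ln (ln (real n)) / real n) * ln (real n) / real n) / h) \<le> remainder_rate n h
   \<and> ln (real n) / sqrt (real n * h) \<le> remainder_rate n h
   \<and> (real n * h \<le> ln (real n) \<longrightarrow> sqrt (ln (real n)) * exp (ln (real n) / 8) \<le> remainder_rate n h)"
proof -
  have e1: "\<forall>\<^sub>F n in sequentially. ln (real n) \<le> sqrt (real n)" by real_asymp
  have e2: "\<forall>\<^sub>F n in sequentially. ln (real n) * real n powr (1/8) \<le> real n powr (1/4)" by real_asymp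
  have e3: "\<forall>\<^sub>F n in sequentially. 1 \<le> ln (ln (real n))" by real_asymp
  show ?thesis using e1 e2 e3 eventually_ge_at_top[of 3]
  proof eventually_elim
    case (elim n)
    note e1 = elim(1) and e2 = elim(2) and e3 = elim(3)
    show ?case
    proof (intro allI impI)
      fix h :: real assume h: "0 < h"
      have n0: "0 < real n" using elim by simp
      have ln1: "1 \<le> ln (real n)" using elim exp_le by (subst ln_ge_iff) auto
      define p r m l where "p = sqrt h" and "r = sqrt (sqrt (real n))" and "m = sqrt (ln (real n))" and "l = sqrt (sqrt (ln (ln (real n))))"
      have pos: "0 < p" "0 < r" "1 \<le> m" "1 \<le> l" using h n0 ln1 e3 by (auto simp: p_def r_def m_def l_def)
      have pe: "h = p\<^sup>2" using h by (simp add: p_def)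
      have re: "sqrt (real n) = r\<^sup>2" "real n = r\<^sup>2 * r\<^sup>2" using n0 by (auto simp: r_def)
      have me: "ln (real n) = m\<^sup>2" using ln1 by (simp add: m_def)
      have le: "sqrt (ln (ln (real n))) = l\<^sup>2" using e3 by (simp add: l_def)
      have snh: "sqrt (real n * h) = r\<^sup>2 * p" by (simp add: real_sqrt_mult re(1) p_def)
      have ratell: "sqrt (ln (ln (real n)) / real n) = l\<^sup>2 / r\<^sup>2" by (simp add: real_sqrt_divide re(1) le)
      define R3 where "R3 = m * l / (p * r)"
      have R: "remainder_rate n h = r\<^sup>2 * p * p\<^sup>2 + p + R3"
      proof -
        have "remainder_rate n h = sqrt (real n * h) * h + p + m * l / (p * r)"
          using remainder_rate_eq[OF h elim(4)] by (simp only: p_def r_def m_def l_def)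
        also have "\<dots> = r\<^sup>2 * p * h + p + R3" by (simp only: snh R3_def)
        also have "r\<^sup>2 * p * h = r\<^sup>2 * p * p\<^sup>2" using pe by (rule arg_cong)
        finally show ?thesis .
      qed
      have R3pos: "0 < R3" using pos by (simp add: R3_def)
      have mr: "m \<le> r"
      proof -
        have "m\<^sup>2 \<le> r\<^sup>2" using e1 unfolding me re(1) .
        thus ?thesis by (rule power2_le_imp_le) (use pos in auto)
      qed
      have R1pos: "0 \<le> r\<^sup>2 * p * p\<^sup>2" using pos by simp
      have 1: "sqrt (real n * h) * h \<le> remainder_rate n h" unfolding snh R using pe pos R3pos by simp
      have 4: "ln (real n) / sqrt (real n * h) \<le> R3"
      proof -
        have "m * m \<le> m * (l * r)" using mr pos mult_mono[of 1 l m r] by (intro mult_left_mono) auto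
        hence "m * m / (r * r * p) \<le> m * (l * r) / (r * r * p)" using pos by (intro divide_right_mono) auto
        also have "\<dots> = R3" using pos by (simp add: R3_def mult_ac)
        finally show ?thesis unfolding snh me by (simp add: power2_eq_square)
      qed
      have lm: "l\<^sup>2 \<le> m"
      proof -
        have "ln (ln (real n)) \<le> ln (real n)" using ln1 ln_le_minus_one[of "ln (real n)"] by simp
        hence "sqrt (ln (ln (real n))) \<le> m" unfolding m_def by (rule real_sqrt_le_mono)
        thus ?thesis by (simp add: le)
      qed
      have 2: "sqrt (real n * h) * sqrt (ln (ln (real n)) / real n) \<le> remainder_rate n h"
      \<comment> \<open>The threshold is h = sqrt(ln ln n / n). Above it the first summand of the
        rate suffices; below it the term is at most ln n / sqrt(n h), which \<open>4\<close>
        compares with the third summand.\<close>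
      proof (cases "l\<^sup>2 / r\<^sup>2 \<le> p\<^sup>2")
        case True
        have "r\<^sup>2 * p * (l\<^sup>2 / r\<^sup>2) \<le> r\<^sup>2 * p * p\<^sup>2" using True pos by (intro mult_left_mono) auto
        thus ?thesis unfolding snh ratell R using pos R3pos by linarith
      next
        case False
        have "r\<^sup>2 * p * (l\<^sup>2 / r\<^sup>2) = p\<^sup>2 * l\<^sup>2 / p" using pos by (simp add: power2_eq_square)
        also have "\<dots> \<le> (l\<^sup>2 / r\<^sup>2) * l\<^sup>2 / p" using False pos by (intro divide_right_mono mult_right_mono) auto
        also have "\<dots> \<le> (m / r\<^sup>2) * m / p" using lm pos by (intro divide_right_mono mult_mono) auto
        also have "\<dots> = ln (real n) / sqrt (real n * h)" unfolding snh me using pos by (simp add: power2_eq_square)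
        also have "\<dots> \<le> R3" by (rule 4)
        finally show ?thesis unfolding snh ratell R using pos R1pos by linarith
      qed
      have 3: "sqrt (real n * h) * (sqrt (sqrt (ln (ln (real n)) / real n) * ln (real n) / real n) / h) = R3"
      proof -
        have "sqrt (ln (ln (real n)) / real n) * ln (real n) / real n = l\<^sup>2 / r\<^sup>2 * m\<^sup>2 / real n"
          unfolding ratell unfolding me ..
        also have "\<dots> = l\<^sup>2 / r\<^sup>2 * m\<^sup>2 / (r\<^sup>2 * r\<^sup>2)" using re(2) by (rule arg_cong)
        also have "\<dots> = (l * m / (r * r * r))\<^sup>2" by (simp add: power2_eq_square mult_ac)
        finally have "sqrt (sqrt (ln (ln (real n)) / real n) * ln (real n) / real n) = l * m / (r * r * r)"
          using pos by simp
        thus ?thesis unfolding snh R3_def unfolding pe using pos by (simp add: power2_eq_square) (simp add: mult.commute)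
      qed
      \<comment> \<open>Here sqrt h <= m / r^2, so the third summand is at least r / m = n^(1/4) /
        sqrt(ln n), which is at least m n^(1/8) for the n considered.\<close>
      have 5: "sqrt (ln (real n)) * exp (ln (real n) / 8) \<le> R3" if "real n * h \<le> ln (real n)"
      proof -
        have "(r\<^sup>2 * p)\<^sup>2 \<le> m\<^sup>2" using that unfolding me snh[symmetric] using h by simp
        hence rp: "r\<^sup>2 * p \<le> m" by (rule power2_le_imp_le) (use pos in auto)
        have "sqrt (ln (real n)) * exp (ln (real n) / 8) \<le> r / m"
        proof -
          have "real n powr (1/8) = exp (ln (real n) / 8)" using n0 by (simp add: powr_def)
          hence "m\<^sup>2 * exp (ln (real n) / 8) \<le> r" using e2 powr_quarter[of "real n"] unfolding me[symmetric] r_def by simp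
          hence "m * exp (ln (real n) / 8) \<le> r / m" using pos by (simp add: pos_le_divide_eq power2_eq_square mult_ac)
          thus ?thesis by (simp add: m_def)
        qed
        also have "\<dots> \<le> 1 / (p * r)" using rp pos by (simp add: field_simps power2_eq_square)
        also have "\<dots> \<le> R3" unfolding R3_def using pos mult_mono[of 1 m 1 l] by (intro divide_right_mono) auto
        finally show ?thesis .
      qed
      have "R3 \<le> remainder_rate n h" unfolding R using R1pos pos by linarith
      thus "sqrt (real n * h) * h \<le> remainder_rate n h
   \<and> sqrt (real n * h) * sqrt (ln (ln (real n)) / real n) \<le> remainder_rate n h
   \<and> sqrt (real n * h) * (sqrt (sqrt (ln (ln (real n)) / real n) * ln (real n) / real n) / h) \<le> remainder_rate n h
   \<and> ln (real n) / sqrt (real n * h) \<le> remainder_rate n h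
   \<and> (real n * h \<le> ln (real n) \<longrightarrow> sqrt (ln (real n)) * exp (ln (real n) / 8) \<le> remainder_rate n h)"
        using 1 2 3 4 5 by (auto intro: order_trans)
    qed
  qed
qed

subsection \<open>The expansion\<close>

text \<open>Dividing by qh splits the error into f A (qh - q) / qh, which is the leading term up to
  W, and the contributions of \<open>Qh\<close> and \<open>Sh\<close>, which are of order E / c.
  \<open>c\<close> and \<open>W\<close> stay open because the two bandwidth regimes supply different
  values.\<close>

lemma studentized_T_decomposition:
  fixes s :: real
  assumes s: "0 \<le> s" and qh: "0 < c" "c \<le> qh"
    and \<phi>: "\<bar>f\<bar> \<le> Cf" and \<phi>A: "\<bar>f * A\<bar> \<le> CA"
    and E: "\<bar>Qh - Q\<bar> \<le> E" and S: "\<bar>Sh - S\<bar> \<le> CS * E"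
    and W: "\<bar>(qh - q) / qh + \<gamma>\<bar> \<le> W"
  shows "\<bar>s * ((f * (Qh + A * qh) + Sh) - (f * (Q + A * q) + S)) / qh - (- f * A * (s * \<gamma>))\<bar>
     \<le> s * ((Cf + CS) * E / c + CA * W)"
proof -
  have qh0: "0 < qh" using qh by simp
  have E0: "0 \<le> E" using E by simp
  have "s * ((f * (Qh + A * qh) + Sh) - (f * (Q + A * q) + S)) / qh - (- f * A * (s * \<gamma>))
     = s * ((f * (Qh - Q) + (Sh - S)) / qh + f * A * ((qh - q) / qh + \<gamma>))"
    using qh0 by (simp add: field_simps)
  moreover have "\<bar>(f * (Qh - Q) + (Sh - S)) / qh + f * A * ((qh - q) / qh + \<gamma>)\<bar> \<le> (Cf + CS) * E / c + CA * W"
  proof -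
    have "\<bar>f * (Qh - Q)\<bar> \<le> Cf * E" unfolding abs_mult using \<phi> E by (intro mult_mono) auto
    hence "\<bar>f * (Qh - Q) + (Sh - S)\<bar> \<le> (Cf + CS) * E" using S by (simp add: distrib_right)
    hence "\<bar>f * (Qh - Q) + (Sh - S)\<bar> / qh \<le> (Cf + CS) * E / c"
      using qh by (intro frac_le) auto
    moreover have "\<bar>f * A * ((qh - q) / qh + \<gamma>)\<bar> \<le> CA * W"
      unfolding abs_mult[of "f * A"] using \<phi>A W by (intro mult_mono) auto
    moreover have "\<bar>(f * (Qh - Q) + (Sh - S)) / qh\<bar> = \<bar>f * (Qh - Q) + (Sh - S)\<bar> / qh" using qh0 by simp
    ultimately show ?thesis by (intro order_trans[OF abs_triangle_ineq] add_mono) (simp_all only:)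
  qed
  ultimately show ?thesis using s by (simp only: abs_mult[of s]) (simp add: mult_left_mono)
qed

theorem mainTheorem7:
  fixes Pr :: "'a measure"
    and b :: "nat \<Rightarrow> 'a \<Rightarrow> real"
    and F Q q q' :: "real \<Rightarrow> real"
    and p :: "nat \<Rightarrow> real" and M :: nat
    and \<phi> \<psi> \<psi>' :: "real \<Rightarrow> real"
    and K :: "real \<Rightarrow> real"
    and h :: "nat \<Rightarrow> real"
  assumes prob: "prob_space Pr"
    and meas: "\<And>i. i \<ge> 1 \<Longrightarrow> b i \<in> borel_measurable Pr"
    and indep: "prob_space.indep_vars Pr (\<lambda>_. borel) b {1..}"
    and cdf: "\<And>i x. i \<ge> 1 \<Longrightarrow> F x = measure Pr {\<omega> \<in> space Pr. b i \<omega> \<le> x}"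
    and F_cont: "continuous_on UNIV F"
    and quantile: "\<And>u. u \<in> {0..1} \<Longrightarrow> F (Q u) = u"
    and Q_deriv: "\<And>u. u \<in> {0..1} \<Longrightarrow> (Q has_real_derivative q u) (at u within {0..1})"
    and q_deriv: "\<And>u. u \<in> {0..1} \<Longrightarrow> (q has_real_derivative q' u) (at u within {0..1})"
    and q'_cont: "continuous_on {0..1} q'"
    and q_pos: "\<And>u. u \<in> {0..1} \<Longrightarrow> q u > 0"
    and p_nonneg: "\<And>m. m \<in> {1..M} \<Longrightarrow> p m \<ge> 0"
    and A1'_nz: "\<And>u. u \<in> {0..1} \<Longrightarrow> deriv (A1 p M) u \<noteq> 0"
    and phi_C1: "\<exists>\<phi>'. continuous_on {0..1} \<phi>' \<and>
                   (\<forall>u\<in>{0..1}. (\<phi> has_real_derivative \<phi>' u) (at u within {0..1}))"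
    and psi_deriv: "\<And>u. u \<in> {0..1} \<Longrightarrow> (\<psi> has_real_derivative \<psi>' u) (at u within {0..1})"
    and psi'_cont: "continuous_on {0..1} \<psi>'"
    and K_nonneg: "\<And>z. K z \<ge> 0"
    and K_int: "(K has_integral 1) UNIV"
    and K_sq: "(\<lambda>z. (K z)\<^sup>2) integrable_on UNIV"
    and K_lip: "\<exists>L. lipschitz_on L UNIV K"
    and K_supp: "\<And>z. z \<notin> {-1..1} \<Longrightarrow> K z = 0"
    and h_lim: "h \<longlonglongrightarrow> 0"
    and nh_lim: "filterlim (\<lambda>n. real n * h n) at_top sequentially"
  shows "AE \<omega> in Pr. \<exists>C. \<forall>\<^sub>F n in sequentially. \<forall>us \<in> {h n..1 - h n}.
           \<bar>sqrt (real n * h n) * (That (Afun p M) \<phi> \<psi> \<psi>' K (h n) (\<lambda>i. b i \<omega>) n us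
                                    - Tfun \<phi> \<psi> (vfun (Afun p M) Q q) us)
               / qhat K (h n) (\<lambda>i. b i \<omega>) n us
            - (- \<phi> us * Afun p M us * Gnh Pr b F K n (h n) \<omega> us)\<bar>
           \<le> C * (sqrt (real n) * h n powr (3/2) + sqrt (h n)
                  + h n powr (-1/2) * real n powr (-1/4) * ell n)"
proof -
  obtain L where L: "L-lipschitz_on UNIV K" using K_lip by blast
  interpret kernel K L
  proof
    show "\<bar>K x - K y\<bar> \<le> L * \<bar>x - y\<bar>" for x y using lipschitz_onD[OF L, of x y] by (simp add: dist_real_def)
  qed (use K_nonneg K_supp K_int in auto)

  \<comment> \<open>Regularity constants of the deterministic functions on the unit interval\<close>
  have Q_cont: "continuous_on {0..1} Q" by (rule DERIV_continuous_on[OF Q_deriv])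
  have q_cont: "continuous_on {0..1} q" by (rule DERIV_continuous_on[OF q_deriv])
  have psi_cont: "continuous_on {0..1} \<psi>" by (rule DERIV_continuous_on[OF psi_deriv])
  have phi_cont: "continuous_on {0..1} \<phi>" using phi_C1 by (blast intro: DERIV_continuous_on)
  have qt: "mono F" "uniform_sample Pr (\<lambda>i \<omega>. F (b i \<omega>))" "AE \<omega> in Pr. \<forall>i\<ge>1. b i \<omega> = Q (F (b i \<omega>))"
    by (rule quantile_transform[of Pr b F Q]; (rule prob indep F_cont Q_cont | erule meas cdf quantile))+
  define U where "U = (\<lambda>i \<omega>. F (b i \<omega>))"
  interpret uniform_sample Pr U unfolding U_def by (rule qt(2))
  define A where "A = Afun p M"
  obtain A' where A': "continuous_on {0..1} A'" "\<And>u. u \<in> {0..1} \<Longrightarrow> (A has_real_derivative A' u) (at u)"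
    using Afun_C1[OF A1'_nz] unfolding A_def by blast
  have A_cont: "continuous_on {0..1} A"
    by (rule DERIV_continuous_on) (rule has_field_derivative_at_within[OF A'(2)])
  obtain Lq where Lq: "\<And>s t. s \<in> {0..1} \<Longrightarrow> t \<in> {0..1} \<Longrightarrow> \<bar>q s - q t\<bar> \<le> Lq * \<bar>s - t\<bar>"
    using C1_imp_lipschitz[OF q_deriv q'_cont] by blast
  obtain LQ where LQ: "\<And>s t. s \<in> {0..1} \<Longrightarrow> t \<in> {0..1} \<Longrightarrow> \<bar>Q s - Q t\<bar> \<le> LQ * \<bar>s - t\<bar>"
    using C1_imp_lipschitz[OF Q_deriv q_cont] by blast
  have Lq0: "0 \<le> Lq" and LQ0: "0 \<le> LQ" using Lq[of 0 1] LQ[of 0 1] by auto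
  obtain q1 where q1: "0 < q1" "\<And>u. u \<in> {0..1} \<Longrightarrow> \<bar>q u\<bar> \<le> q1" using continuous_on_unit_bounded[OF q_cont] by blast
  obtain u0 where u0: "u0 \<in> {0..1}" "\<And>u. u \<in> {0..1} \<Longrightarrow> q u0 \<le> q u"
    using continuous_attains_inf[OF _ _ q_cont] by auto
  define q0 where "q0 = q u0"
  have q0: "0 < q0" "\<And>u. u \<in> {0..1} \<Longrightarrow> q0 \<le> q u" using q_pos[OF u0(1)] u0(2) by (auto simp: q0_def)
  obtain Cf where Cf: "0 < Cf" "\<And>u. u \<in> {0..1} \<Longrightarrow> \<bar>\<phi> u\<bar> \<le> Cf" using continuous_on_unit_bounded[OF phi_cont] by blast
  obtain CA where CA: "0 < CA" "\<And>u. u \<in> {0..1} \<Longrightarrow> \<bar>\<phi> u * A u\<bar> \<le> CA"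
    using continuous_on_unit_bounded[OF continuous_on_mult[OF phi_cont A_cont]] by blast
  obtain C2 where C2: "0 < C2" "\<And>u. u \<in> {0..1} \<Longrightarrow> \<bar>A u * \<psi> u\<bar> \<le> C2"
    using continuous_on_unit_bounded[OF continuous_on_mult[OF A_cont psi_cont]] by blast
  obtain C1 where C1: "0 < C1" "\<And>u. u \<in> {0..1} \<Longrightarrow> \<bar>chi A \<psi> \<psi>' u\<bar> \<le> C1"
  proof -
    have "continuous_on {0..1} (\<lambda>u. (1 - A' u) * \<psi> u - A u * \<psi>' u)"
      by (intro continuous_intros A'(1) A_cont psi_cont psi'_cont)
    then obtain C where "0 < C" "\<And>u. u \<in> {0..1} \<Longrightarrow> \<bar>(1 - A' u) * \<psi> u - A u * \<psi>' u\<bar> \<le> C"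
      using continuous_on_unit_bounded by blast
    thus ?thesis using that A'(2) by (metis DERIV_imp_deriv chi_def)
  qed
  define CS where "CS = C1 + 2 * C2"
  have CS0: "0 < CS" using C1 C2 by (simp add: CS_def)
  obtain z0 \<rho> c where zc: "0 < \<rho>" "0 < c" "\<And>z. \<bar>z - z0\<bar> \<le> \<rho> \<Longrightarrow> c \<le> K z" using exists_positive_interval by blast
  \<comment> \<open>With w = m / (2 n exp (1 + 4 ln n / m)) and m >= \<rho> n h / 2, the bound c q0
    w / h is at least \<open>c1\<close> exp (- 4 ln n / m). If n h >= ln n, the last exponent is at
    least - 8 / \<rho>, which gives \<open>cI\<close>.\<close>
  define c1 where "c1 = c * q0 * \<rho> / 4 * exp (- 1)"
  have c1: "0 < c1" using zc q0 by (simp add: c1_def)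
  define cI where "cI = c1 * exp (- 8 / \<rho>)"
  have cI: "0 < cI" using c1 by (simp add: cI_def)

  define rt where "rt = (\<lambda>n. sqrt (ln (ln (real n)) / real n))"
  \<comment> \<open>\<open>a1\<close> is floored at ln n / n because the oscillation bound starts
    there; it equals h n in the regime n h >= ln n. \<open>a2\<close> uses 400 instead of 386 to
    exceed the supremum bound strictly, and 400 has the root 20.\<close>
  define a1 where "a1 = (\<lambda>n. max (h n) (ln (real n) / real n))"
  define a2 where "a2 = (\<lambda>n. 400 * rt n)"
  define m where "m = (\<lambda>n. nat \<lfloor>\<rho> * (real n * h n)\<rfloor>)"
  \<comment> \<open>The value 33 / \<rho> makes \<rho> n h >= 33, hence m >= 32 after taking the
    floor, so that 4 ln n / m <= ln n / 8 in the worst case: this is the n powr (-1/8) in the lower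
    bound for \<open>qhat\<close>.\<close>
  have ev_h: "\<forall>\<^sub>F n in sequentially. max (1 :: real) (33 / \<rho>) \<le> real n * h n"
    using nh_lim unfolding filterlim_at_top by blast
  have ev_rt: "\<forall>\<^sub>F n in sequentially. 386 * rt n \<le> 1" unfolding rt_def by real_asymp
  have ev_rt0: "\<forall>\<^sub>F n in sequentially. 0 < rt n" unfolding rt_def by real_asymp
  have ev_a2: "\<forall>\<^sub>F n in sequentially. ln (real n) / real n \<le> a2 n" unfolding a2_def rt_def by real_asymp
  have ev_a1: "\<forall>\<^sub>F n in sequentially. ln (real n) / real n \<le> a1 n" by (simp add: a1_def)
  have ev_m: "\<forall>\<^sub>F n in sequentially. 4 \<le> m n"
    using ev_h
  proof eventually_elim
    case (elim n)
    hence "33 \<le> \<rho> * (real n * h n)" using zc by (simp add: field_simps)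
    thus ?case unfolding m_def by linarith
  qed
  have ev_eps: "\<forall>\<^sub>F n in sequentially. Lq * (h n + 386 * rt n + 1 / real n) \<le> q0 / 2"
  proof -
    have "rt \<longlonglongrightarrow> 0" unfolding rt_def by real_asymp
    hence "(\<lambda>n. Lq * (h n + 386 * rt n + 1 / real n)) \<longlonglongrightarrow> Lq * (0 + 386 * 0 + 0)"
      using h_lim by (intro tendsto_intros lim_const_over_n)
    hence "\<forall>\<^sub>F n in sequentially. Lq * (h n + 386 * rt n + 1 / real n) < q0 / 2"
      using q0 by (intro order_tendstoD(2)) auto
    thus ?thesis by (rule eventually_mono) simp
  qed
  \<comment> \<open>388 = 386 + 1 + 1 bounds D + h + 1/n in units of the rate; 20 L = 2 * 10 * L
    bounds the kernel deviation, 400 L^2 is its square, and 400 L = 2 * 10 * sqrt 400 * L belongs to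
    the Bahadur--Kiefer term. \<open>CI\<close> serves the case n h >= ln n, \<open>CII\<close> the
    other.\<close>
  define CI where "CI = (Cf + CS) * (386 * LQ) / cI + CA * (2 / q0 * (388 * Lq) * (1 + 20 * L) + q1 / cI * (400 * L * (1 + 20 * L) + 400 * L\<^sup>2))"
  define CII where "CII = (Cf + CS) * LQ / c1 + CA * (1 + q1 / c1 + 20 * L)"
  have C0: "0 \<le> CI" "0 \<le> CII" unfolding CI_def CII_def using Cf CS0 LQ0 cI CA q0 Lq0 L_nonneg q1 c1
    by (auto intro!: add_nonneg_nonneg mult_nonneg_nonneg divide_nonneg_pos)

  \<comment> \<open>The pathwise bound\<close>
  have "AE \<omega> in Pr. \<forall>\<^sub>F n in sequentially. \<forall>us \<in> {h n..1 - h n}.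
           \<bar>sqrt (real n * h n) * (That A \<phi> \<psi> \<psi>' K (h n) (\<lambda>i. b i \<omega>) n us - Tfun \<phi> \<psi> (vfun A Q q) us)
               / qhat K (h n) (\<lambda>i. b i \<omega>) n us
            - (- \<phi> us * A us * Gnh Pr b F K n (h n) \<omega> us)\<bar> \<le> (CI + CII) * remainder_rate n (h n)"
    using qt(3) AE_sample_in_unit chung_smirnov oscillation_ecdf[OF ev_a1] oscillation_ecdf[OF ev_a2] spacings_lower_bound[OF ev_m]
  proof eventually_elim
    case (elim \<omega>)
    note bQ = elim(1) and Upos = elim(2)
    define x where "x = (\<lambda>i. b i \<omega>)"
    define V where "V = (\<lambda>i. U i \<omega>)"
    have V: "\<And>i. 1 \<le> i \<Longrightarrow> 0 < V i \<and> V i \<le> 1" using Upos by (auto simp: V_def)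
    have osV: "order_stat V n i = F (order_stat x n i)" if "1 \<le> i" "i \<le> n" for n i
      using order_stat_comp_mono[OF qt(1) that, of x] by (simp add: V_def U_def x_def)
    have osx: "order_stat x n i = Q (order_stat V n i)" if i: "1 \<le> i" "i \<le> n" for n i
    proof -
      obtain j where "j \<in> {1..n}" "order_stat x n i = x j" using order_stat_eq_sample[OF i, of x] by blast
      thus ?thesis using bQ osV[OF i] by (simp add: x_def)
    qed
    show ?case using elim(3-6) ev_h ev_rt ev_rt0 ev_eps remainder_rate_dominates eventually_ge_at_top[of 3]
      unfolding x_def[symmetric] V_def[symmetric]
    proof eventually_elim
      case (elim n)
      define hn where "hn = h n"
      define s where "s = sqrt (real n * hn)"
      define R where "R = remainder_rate n hn"
      define D where "D = 386 * rt n"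
      have n: "1 \<le> n" "3 \<le> n" "0 < real n" using elim by auto
      have ln1: "1 \<le> ln (real n)" using n exp_le by (subst ln_ge_iff) auto
      have nh1: "1 \<le> real n * hn" and nhr: "33 / \<rho> \<le> real n * hn" using elim(5) by (auto simp: hn_def)
      have h0: "0 < hn" using nh1 n by (smt (verit) mult_nonneg_nonpos)
      have s1: "1 \<le> s" using nh1 by (simp add: s_def)
      have s2: "s * s = real n * hn" using nh1 by (simp add: s_def)
      have rates: "s * hn \<le> R" "s * rt n \<le> R" "s * (sqrt (rt n * ln (real n) / real n) / hn) \<le> R" "ln (real n) / s \<le> R"
         "real n * hn \<le> ln (real n) \<Longrightarrow> sqrt (ln (real n)) * exp (ln (real n) / 8) \<le> R"
        using elim(9) h0 unfolding s_def R_def rt_def by auto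
      have R0: "0 \<le> R" using rates(1) s1 h0 by (smt (verit) mult_nonneg_nonneg)
      have Dle: "\<bar>ecdf V n t - t\<bar> \<le> D" if "0 \<le> t" "t \<le> 1" for t using elim(1) that by (auto simp: D_def rt_def)
      have D1: "D \<le> 1" using elim(6) by (simp add: D_def)
      have D0: "0 < D" using elim(7) by (simp add: D_def)
      have Da2: "D < a2 n" using elim(7) by (simp add: D_def a2_def)
      define B1 where "B1 = 10 * sqrt (a1 n * ln (real n) / real n)"
      define B2 where "B2 = 10 * sqrt (a2 n * ln (real n) / real n)"
      define \<Gamma> where "\<Gamma> = 2 * L * B1 / hn"
      define \<delta> where "\<delta> = 2 * L * B2 / hn"
      define \<epsilon> where "\<epsilon> = Lq * (hn + D + 1 / real n)"
      define E where "E = LQ * D"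
      have Edef: "\<bar>Qhat x n u - Q u\<bar> \<le> E" if u: "u \<in> {0..1}" for u
      proof -
        define k where "k = (if u < 1 then nat \<lfloor>real n * u\<rfloor> + 1 else n)"
        have k: "1 \<le> k" "k \<le> n" using floor_index[of u n] u n unfolding k_def by auto
        have "Qhat x n u = Q (Qhat V n u)" using osx[OF k] by (simp add: Qhat_def k_def split: if_splits)
        moreover have "Qhat V n u \<in> {0..1}"
        proof -
          have "Qhat V n u = order_stat V n k" by (simp add: Qhat_def k_def)
          then obtain j where "j \<in> {1..n}" "Qhat V n u = V j" using order_stat_eq_sample[OF k, of V] by auto
          thus ?thesis using V[of j] by auto
        qed
        ultimately have "\<bar>Qhat x n u - Q u\<bar> \<le> LQ * \<bar>Qhat V n u - u\<bar>" using LQ[of "Qhat V n u" u] u by simp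
        also have "\<dots> \<le> E" unfolding E_def using Qhat_near_argument[OF n(1) V _ _ Dle, of u] u LQ0 by (intro mult_left_mono) auto
        finally show ?thesis .
      qed
      have sE: "s * E \<le> 386 * LQ * R"
        using mult_left_mono[OF rates(2), of "386 * LQ"] LQ0 by (simp add: E_def D_def mult_ac)
      define mr where "mr = real (m n)"
      have mr: "\<rho> * (real n * hn) / 2 \<le> mr" "mr \<le> \<rho> * (real n * hn)" "32 \<le> mr"
      proof -
        have "33 \<le> \<rho> * (real n * hn)" using nhr zc by (simp add: field_simps)
        thus "\<rho> * (real n * hn) / 2 \<le> mr" "mr \<le> \<rho> * (real n * hn)" "32 \<le> mr"
          unfolding mr_def m_def hn_def by linarith+
      qed
      show ?case unfolding hn_def[symmetric] R_def[symmetric]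
      proof
        fix us assume us': "us \<in> {hn..1 - hn}"
        hence us: "hn \<le> us" "us \<le> 1 - hn" "us \<in> {0..1}" using h0 by auto
        define qh where "qh = qhat K hn x n us"
        define g where "g = qhat K hn V n us"
        define \<gamma> where "\<gamma> = 1 / real n * (\<Sum>i = 1..n. Kh K hn (us - V i)) - 1"
        have G: "Gnh Pr b F K n hn \<omega> us = s * \<gamma>"
          using Gnh_eq_kernel_density[OF kernel_axioms n(1) h0 us(1,2), of F b \<omega>] by (simp add: U_def V_def s_def \<gamma>_def)
        have \<gamma>: "\<bar>\<gamma>\<bar> \<le> \<Gamma>" unfolding \<gamma>_def \<Gamma>_def
        proof (rule kernel_density_deviation[OF n(1) h0 us(1,2)])
          fix t assume t: "0 \<le> t" "t \<le> 1" "\<bar>t - us\<bar> \<le> hn"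
          show "\<bar>(ecdf V n t - t) - (ecdf V n us - us)\<bar> \<le> B1"
            using elim(2) t us(3) by (auto simp: B1_def a1_def hn_def)
        qed
        have g: "\<bar>g - 1 + \<gamma>\<bar> \<le> \<delta>"
        proof -
          have "\<bar>g + 1 / real n * (\<Sum>i = 1..n. Kh K hn (us - V i)) - 2\<bar> \<le> \<delta>" unfolding g_def \<delta>_def
            by (rule spacing_density_plus_kernel_density[OF n(1) h0 us(1,2) V Dle Da2])
               (use elim(3) in \<open>auto simp: B2_def\<close>)
          thus ?thesis by (simp add: \<gamma>_def algebra_simps)
        qed
        have lin: "\<bar>qh - q us * g\<bar> \<le> \<epsilon> * g" unfolding qh_def g_def \<epsilon>_def
          by (rule qhat_linearization[OF n(1) h0 us(1,2) V Dle Q_deriv Lq osx])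
        have qlow: "c1 * exp (- (4 * ln (real n) / mr)) \<le> qh"
        proof -
          define w where "w = mr / (2 * real n * exp (1 + 4 * ln (real n) / mr))"
          have "c / hn * (q0 * w) \<le> qh" unfolding qh_def
          proof (rule qhat_lower_bound[OF n(1) h0 us(1,2) V Q_deriv q0(2,1) osx zc(3,2,1), where m = "m n"])
            show "1 \<le> m n" "real (m n) \<le> \<rho> * (real n * hn)" using mr by (auto simp: mr_def)
            show "w \<le> order_stat V n (i + m n) - order_stat V n i" if "1 \<le> i" "i + m n \<le> n" for i
              using elim(4) that by (auto simp: w_def mr_def intro!: less_imp_le)
          qed
          moreover have "c1 * exp (- (4 * ln (real n) / mr)) \<le> c / hn * (q0 * w)"
          proof -
            define e where "e = exp (1 + 4 * ln (real n) / mr)"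
            have e0: "0 < e" by (simp add: e_def)
            have "c1 * exp (- (4 * ln (real n) / mr)) = c * q0 * \<rho> / 4 / e"
              by (simp add: c1_def e_def exp_add exp_minus field_simps)
            also have "\<dots> = c / hn * (q0 * ((\<rho> * (real n * hn) / 2) / (2 * real n * e)))" using h0 n e0 by simp
            also have "\<dots> \<le> c / hn * (q0 * (mr / (2 * real n * e)))"
              using mr h0 n e0 zc q0 by (intro mult_left_mono divide_right_mono) auto
            finally show ?thesis by (simp add: w_def e_def)
          qed
          ultimately show ?thesis by linarith
        qed
        have Serr: "\<bar>Shat A \<psi> \<psi>' x n us - integral {us..1} (\<lambda>t. \<psi> t * vfun A Q q t)\<bar> \<le> CS * E"
          unfolding CS_def using us(3)
          by (intro Shat_error[OF n(1) _ _ A' psi_deriv psi'_cont Q_deriv q_cont Edef C1(2) C2(2)]) auto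
        have target: "\<bar>s * (That A \<phi> \<psi> \<psi>' K hn x n us - Tfun \<phi> \<psi> (vfun A Q q) us) / qh
            - (- \<phi> us * A us * Gnh Pr b F K n hn \<omega> us)\<bar> \<le> s * ((Cf + CS) * E / cc + CA * W)"
          if "0 < cc" "cc \<le> qh" "\<bar>(qh - q us) / qh + \<gamma>\<bar> \<le> W" for cc W
          using studentized_T_decomposition[OF _ that(1,2) Cf(2)[OF us(3)] CA(2)[OF us(3)] Edef[OF us(3)] Serr that(3), of s] s1
          unfolding That_def Tfun_def vhat_def vfun_def[of A Q q us] qh_def[symmetric] G by simp
        have qus: "q0 \<le> q us" "q us \<le> q1" using q0(2)[OF us(3)] q1(2)[OF us(3)] by auto
        have "\<bar>s * (That A \<phi> \<psi> \<psi>' K hn x n us - Tfun \<phi> \<psi> (vfun A Q q) us) / qh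
            - (- \<phi> us * A us * Gnh Pr b F K n hn \<omega> us)\<bar> \<le> (CI + CII) * R"
        \<comment> \<open>For n h >= ln n the kernel deviation bound \<Gamma> is at most 20 L and
          \<open>qh\<close> stays above \<open>cI\<close>, so expanding (qh - q) / qh pays off.
          Otherwise \<Gamma> may be large, and (qh - q) / qh and \<gamma> are bounded
          separately.\<close>
        proof (cases "ln (real n) \<le> real n * hn")
          case True
          have qc: "cI \<le> qh"
          proof -
            have "4 * ln (real n) / mr \<le> 8 / \<rho>"
            proof -
              have "\<rho> * ln (real n) \<le> \<rho> * (real n * hn)" using True zc by (intro mult_left_mono) auto
              hence "\<rho> * ln (real n) \<le> 2 * mr" using mr by linarith
              thus ?thesis using zc mr by (simp add: field_simps)
            qed
            hence "cI \<le> c1 * exp (- (4 * ln (real n) / mr))" unfolding cI_def using c1 by (intro mult_left_mono) auto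
            thus ?thesis using qlow by linarith
          qed
          have a1h: "a1 n = hn" using True n by (simp add: a1_def hn_def max_def field_simps)
          have \<Gamma>s: "\<Gamma> = 20 * L * (sqrt (ln (real n)) / s)"
          proof -
            have "sqrt (hn * ln (real n) / real n) = hn * (sqrt (ln (real n)) / s)"
            proof -
              have "hn * ln (real n) / real n = hn\<^sup>2 * (ln (real n) / (real n * hn))" using h0 n by (simp add: power2_eq_square)
              thus ?thesis unfolding s_def using h0 by (simp add: real_sqrt_mult real_sqrt_divide)
            qed
            thus ?thesis unfolding \<Gamma>_def B1_def a1h using h0 by simp
          qed
          have \<Gamma>2: "s * \<Gamma>\<^sup>2 = 400 * L\<^sup>2 * (ln (real n) / s)"
            unfolding \<Gamma>s using ln1 s1 by (simp add: power_mult_distrib power_divide power2_eq_square)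
          have \<Gamma>1: "\<Gamma> \<le> 20 * L"
          proof -
            have "sqrt (ln (real n)) / s \<le> 1" using True s1 by (simp add: s_def)
            from mult_left_mono[OF this, of "20 * L"] show ?thesis unfolding \<Gamma>s using L_nonneg by simp
          qed
          have \<Gamma>0: "0 \<le> \<Gamma>" using \<gamma> by linarith
          have \<delta>0: "0 \<le> \<delta>" using g by linarith
          have eps: "0 \<le> \<epsilon>" "\<epsilon> \<le> q0 / 2" using elim(8) Lq0 h0 D0 by (auto simp: \<epsilon>_def D_def hn_def)
          have s\<epsilon>: "s * \<epsilon> \<le> 388 * Lq * R"
          proof -
            have "1 / real n \<le> hn" using nh1 n by (simp add: field_simps)
            hence "s * (1 / real n) \<le> s * hn" using s1 by (intro mult_left_mono) auto
            hence "s * (1 / real n) \<le> R" using rates(1) by linarith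
            moreover have "s * D = 386 * (s * rt n)" by (simp add: D_def)
            ultimately have "s * hn + s * D + s * (1 / real n) \<le> 388 * R" using rates by linarith
            from mult_left_mono[OF this Lq0] show ?thesis by (simp add: \<epsilon>_def distrib_left mult_ac)
          qed
          have s\<delta>: "s * \<delta> \<le> 400 * L * R"
          proof -
            have "a2 n * ln (real n) / real n = 20\<^sup>2 * (rt n * ln (real n) / real n)" by (simp add: a2_def)
            hence "sqrt (a2 n * ln (real n) / real n) = 20 * sqrt (rt n * ln (real n) / real n)"
              by (simp only: real_sqrt_mult) simp
            hence "s * \<delta> = 400 * L * (s * (sqrt (rt n * ln (real n) / real n) / hn))" by (simp add: \<delta>_def B2_def)
            thus ?thesis using mult_left_mono[OF rates(3), of "400 * L"] L_nonneg by simp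
          qed
          have s\<Gamma>2: "s * \<Gamma>\<^sup>2 \<le> 400 * L\<^sup>2 * R" unfolding \<Gamma>2 using rates(4) by (intro mult_left_mono) auto
          have "\<bar>(qh - q us) / qh + \<gamma>\<bar> \<le> 2 / q0 * \<epsilon> * (1 + \<Gamma>) + q1 / cI * (\<delta> * (1 + \<Gamma>) + \<Gamma>\<^sup>2)"
            by (rule studentized_quantile_density_error[OF qus q0(1) qc cI lin eps g \<gamma>])
          also have "\<dots> \<le> 2 / q0 * \<epsilon> * (1 + 20 * L) + q1 / cI * (\<delta> * (1 + 20 * L) + \<Gamma>\<^sup>2)"
            using \<Gamma>1 q0 eps q1 cI \<delta>0 by (intro add_mono mult_left_mono) auto
          finally have W: "\<bar>(qh - q us) / qh + \<gamma>\<bar> \<le> 2 / q0 * \<epsilon> * (1 + 20 * L) + q1 / cI * (\<delta> * (1 + 20 * L) + \<Gamma>\<^sup>2)" .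
          note target[OF cI qc W]
          also have "s * ((Cf + CS) * E / cI + CA * (2 / q0 * \<epsilon> * (1 + 20 * L) + q1 / cI * (\<delta> * (1 + 20 * L) + \<Gamma>\<^sup>2)))
             = (Cf + CS) * (s * E) / cI + CA * (2 / q0 * (s * \<epsilon>) * (1 + 20 * L) + q1 / cI * ((s * \<delta>) * (1 + 20 * L) + s * \<Gamma>\<^sup>2))"
            by (simp add: algebra_simps)
          also have "\<dots> \<le> (Cf + CS) * (386 * LQ * R) / cI + CA * (2 / q0 * (388 * Lq * R) * (1 + 20 * L) + q1 / cI * ((400 * L * R) * (1 + 20 * L) + 400 * L\<^sup>2 * R))"
            using sE s\<epsilon> s\<delta> s\<Gamma>2 Cf CS0 cI CA q0 q1 L_nonneg
            by (intro add_mono mult_left_mono mult_right_mono divide_right_mono) auto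
          also have "\<dots> = CI * R" by (simp add: CI_def algebra_simps)
          also have "\<dots> \<le> (CI + CII) * R" using C0 R0 by (intro mult_right_mono) auto
          finally show ?thesis .
        next
          case False
          \<comment> \<open>Here m >= 32 leaves \<open>qh\<close> >= c1 n powr (-1/8); the loss 1 /
            \<open>cc\<close> multiplies s <= sqrt(ln n) and is absorbed by the fifth item of
            \<open>remainder_rate_dominates\<close>.\<close>
          define cc where "cc = c1 * exp (- (ln (real n) / 8))"
          have cc0: "0 < cc" using c1 by (simp add: cc_def)
          have qc: "cc \<le> qh"
          proof -
            have "4 * ln (real n) / mr \<le> 4 * ln (real n) / 32" using mr ln1 by (intro divide_left_mono) auto
            hence "cc \<le> c1 * exp (- (4 * ln (real n) / mr))" unfolding cc_def using c1 by (intro mult_left_mono) auto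
            thus ?thesis using qlow by linarith
          qed
          have qh0: "0 < qh" using qc cc0 by linarith
          have W: "\<bar>(qh - q us) / qh + \<gamma>\<bar> \<le> 1 + q1 / cc + \<Gamma>"
          proof -
            have "(qh - q us) / qh = 1 - q us / qh" using qh0 by (simp add: diff_divide_distrib)
            moreover have "q us / qh \<le> q1 / cc" using qus qc cc0 q0 by (intro frac_le) auto
            moreover have "0 \<le> q us / qh" using qus q0 qh0 by simp
            ultimately show ?thesis using \<gamma> by linarith
          qed
          define ex where "ex = exp (ln (real n) / 8)"
          have ex1: "1 \<le> ex" using ln1 by (simp add: ex_def)
          have icc: "y / cc = y / c1 * ex" for y by (simp add: cc_def ex_def exp_minus field_simps)
          have a1n: "a1 n = ln (real n) / real n" using False n by (simp add: a1_def hn_def max_def field_simps)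
          have s\<Gamma>: "s * \<Gamma> \<le> 20 * L * R"
          proof -
            have "ln (real n) / real n * ln (real n) / real n = (ln (real n) / real n)\<^sup>2" by (simp add: power2_eq_square)
            hence "sqrt (a1 n * ln (real n) / real n) = ln (real n) / real n" unfolding a1n using ln1 by simp
            hence "s * \<Gamma> = 20 * L * (s * (ln (real n) / (real n * hn)))" by (simp add: \<Gamma>_def B1_def)
            also have "s * (ln (real n) / (real n * hn)) = ln (real n) / s" using s1 by (simp flip: s2)
            finally show ?thesis using mult_left_mono[OF rates(4), of "20 * L"] L_nonneg by simp
          qed
          have sex: "s * ex \<le> R"
          proof -
            have "s \<le> sqrt (ln (real n))" using False by (simp add: s_def)
            hence "s * ex \<le> sqrt (ln (real n)) * ex" using ex1 by (intro mult_right_mono) auto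
            thus ?thesis using rates(5) False unfolding ex_def by linarith
          qed
          have E1: "E \<le> LQ" using mult_left_mono[OF D1 LQ0] by (simp add: E_def)
          note target[OF cc0 qc W]
          also have "s * ((Cf + CS) * E / cc + CA * (1 + q1 / cc + \<Gamma>))
              = (Cf + CS) * E / c1 * (s * ex) + CA * (s + q1 / c1 * (s * ex) + s * \<Gamma>)"
            unfolding icc by (simp add: algebra_simps)
          also have "\<dots> \<le> (Cf + CS) * LQ / c1 * R + CA * (R + q1 / c1 * R + 20 * L * R)"
          proof -
            have "s * 1 \<le> s * ex" using ex1 s1 by (intro mult_left_mono) auto
            hence sR: "s \<le> R" using sex by linarith
            have "(Cf + CS) * E / c1 * (s * ex) \<le> (Cf + CS) * LQ / c1 * R"
              using E1 sex Cf CS0 c1 LQ0 s1 ex1 by (intro mult_mono divide_right_mono mult_left_mono) auto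
            moreover have "q1 / c1 * (s * ex) \<le> q1 / c1 * R" using sex q1 c1 by (intro mult_left_mono) auto
            ultimately show ?thesis using sR s\<Gamma> CA sex q1 c1 by (intro add_mono mult_left_mono) auto
          qed
          also have "\<dots> = CII * R" by (simp add: CII_def algebra_simps)
          also have "\<dots> \<le> (CI + CII) * R" using C0 R0 by (intro mult_right_mono) auto
          finally show ?thesis .
        qed
        thus "\<bar>sqrt (real n * hn) * (That A \<phi> \<psi> \<psi>' K hn x n us - Tfun \<phi> \<psi> (vfun A Q q) us) / qhat K hn x n us
            - (- \<phi> us * A us * Gnh Pr b F K n hn \<omega> us)\<bar> \<le> (CI + CII) * R"
          unfolding s_def qh_def .
      qed
    qed
  qed
  thus ?thesis unfolding A_def remainder_rate_def by (rule AE_mp) (auto intro!: AE_I2)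
qed

end
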